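(* Let $q$ be an odd prime power, $F=\mathbb{F}_q$, $G=\mathrm{PSL}_2(F)$ acting by conjugation on the space $V$ of trace-zero $2\times 2$ matrices over $F$, $R=S(V^* )=F[x_1,x_2,x_3]$, and $\Omega=R\otimes\Lambda(V^* )$, with $f_1,f_2,f_3,f_4\in R^G$ and $\phi$ as defined in the context. Then a minimal generating set for $\Omega^G$ as an $F$-algebra is given by \begin{align*}\{&f_1,\ f_2,\ f_3,\ f_4,\\ &\mathrm{d}f_1,\ \mathrm{d}f_2,\ \mathrm{d}f_3,\ \phi(\mathrm{d}f_2\wedge \mathrm{d}f_3),\ \phi(\mathrm{d}f_3\wedge \mathrm{d}f_1),\ \phi(\mathrm{d}f_1\wedge \mathrm{d}f_2),\\ &\phi^{-1}(\mathrm{d}f_1),\ \phi^{-1}(\mathrm{d}f_2),\ \phi^{-1}(\mathrm{d}f_3),\\ &\mathrm{d}x_1\wedge \mathrm{d}x_2\wedge \mathrm{d}x_3\}.\end{align*}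
   Context: Let $F=\mathbb{F}_q$ with $q$ odd, let $V$ be the $F$-vector space of $2\times 2$ matrices of trace zero, with basis $v_1=\begin{pmatrix}0&-1\\0&0\end{pmatrix}$, $v_2=\begin{pmatrix}1&0\\0&-1\end{pmatrix}$, $v_3=\begin{pmatrix}0&0\\1&0\end{pmatrix}$, and let $x_1,x_2,x_3$ be the dual basis of $V^*$. $\mathrm{SL}_2(F)$ acts on $V$ by $g\cdot v=gvg^{-1}$ with kernel $\{\pm I\}$; $G=\mathrm{SL}_2(F)/\{\pm I\}=\mathrm{PSL}_2(F)$. $G$ acts on $V^*$ by $(g\cdot f)(v)=f(g^{-1}\cdot v)$, and on $R=S(V^* )=F[x_1,x_2,x_3]$ by algebra automorphisms; $R^G$ is the ring of invariants. $\Omega=\bigoplus_{i=0}^3\Omega^i$ with $\Omega^i=R\otimes\Lambda^i(V^* )$ is the algebra of differential forms, with multiplication the exterior product extended $R$-linearly, and the diagonal $G$-action $g\cdot(f\otimes w)=(g\cdot f)\otimes(g\cdot w)$. The $R$-basis of $\Omega^1$ corresponding to $x_1,x_2,x_3$ is written $\mathrm{d}x_1,\mathrm{d}x_2,\mathrm{d}x_3$, and for $f\in R$, $\mathrm{d}f=\sum_j \frac{\partial f}{\partial x_j}\mathrm{d}x_j$. $\Omega^G$ is the (bigraded) algebra of $G$-fixed points. A generating set is minimal if no element of it can be omitted. Polynomials: $f_1=x_1x_3-x_2^2$; $f_2=x_1^qx_3+x_1x_3^q-2x_2^{q+1}$; $$f_3=\prod_{(b,c)\in L}(x_1+bx_2+cx_3),\qquad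 L=\{(b,c): b\in F,\ c\in F^*,\ b^2-4c \text{ is not a square in } F\},$$ an invariant of degree $\frac12q(q-1)$; $f_4$ is the determinant of the Jacobian matrix $\left(\partial f_i/\partial x_j\right)_{1\le i,j\le 3}$. (It is known that $f_1,f_2,f_3$ is a homogeneous system of parameters for $R^G$ and that $R^G$ is free over $F[f_1,f_2,f_3]$ with basis $1,f_4$.) $\phi:\Lambda^2(V^* )\to V^*=\Lambda^1(V^* )$ is the isomorphism of $FG$-modules given by $\phi(\mathrm{d}x_2\wedge \mathrm{d}x_3)=\mathrm{d}x_3$, $\phi(\mathrm{d}x_3\wedge \mathrm{d}x_1)=-2\,\mathrm{d}x_2$, $\phi(\mathrm{d}x_1\wedge \mathrm{d}x_2)=\mathrm{d}x_1$; extended $R$-linearly it gives an isomorphism $\Omega^2\to\Omega^1$, which restricts to an isomorphism of $R^G$-modules $(\Omega^2)^G\to(\Omega^1)^G$. All of these are denoted $\phi$. *)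

theory Defs
  imports
    "HOL-Analysis.Analysis"
    "HOL-Algebra.Coset"
    "HOL-Library.Poly_Mapping"
begin

text \<open>
  The ground field F is a type of class \<open>{field, finite}\<close>, so that q is its cardinality.
  All objects attached to the three variables are indexed by the type \<open>3\<close>, whose elements are
  1, 2, 3. Beware that in this type 3 is 0, so that its linear order is 3 < 1 < 2.
\<close>


section \<open>The polynomial ring R\<close>

type_synonym 'a mpoly3 = "(3 \<Rightarrow>\<^sub>0 nat) \<Rightarrow>\<^sub>0 'a"

definition Const :: "'a::zero \<Rightarrow> 'a mpoly3"
  where "Const c = Poly_Mapping.single 0 c"

definition xvar :: "3 \<Rightarrow> 'a::zero_neq_one mpoly3"
  where "xvar i = Poly_Mapping.single (Poly_Mapping.single i 1) 1"

text \<open>The F-algebra endomorphism of R sending each variable \<open>x\<^sub>i\<close> to \<open>\<sigma> i\<close>:\<close>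

definition subst :: "(3 \<Rightarrow> 'a::comm_ring_1 mpoly3) \<Rightarrow> 'a mpoly3 \<Rightarrow> 'a mpoly3"
  where "subst \<sigma> p = (\<Sum>m\<in>Poly_Mapping.keys p.
    Const (Poly_Mapping.lookup p m) * (\<Prod>i\<in>UNIV. \<sigma> i ^ Poly_Mapping.lookup m i))"

text \<open>For an exponent vector m without \<open>x\<^sub>i\<close> the subtraction below truncates, but then the
  coefficient is zero.\<close>

definition partial :: "3 \<Rightarrow> 'a::comm_ring_1 mpoly3 \<Rightarrow> 'a mpoly3"
  where "partial i p = (\<Sum>m\<in>Poly_Mapping.keys p.
    Poly_Mapping.single (m - Poly_Mapping.single i 1)
      (of_nat (Poly_Mapping.lookup m i) * Poly_Mapping.lookup p m))"


section \<open>The group G and its action on V, on the dual of V and on R\<close>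

definition SL2 :: "('a::field^2^2) monoid"
  where "SL2 = \<lparr>carrier = {g. det g = 1}, mult = (**), one = mat 1\<rparr>"

definition PSL2 :: "('a::field^2^2) set monoid"
  where "PSL2 = SL2 Mod {mat 1, - mat 1}"

definition V :: "('a::field^2^2) set"
  where "V = {v. trace v = 0}"

definition vbasis :: "'a::field^2^2^3"
  where "vbasis = vector
    [vector [vector [0, - 1], vector [0, 0]],
     vector [vector [1, 0], vector [0, - 1]],
     vector [vector [0, 0], vector [1, 0]]]"

definition xcoord :: "3 \<Rightarrow> 'a::field^2^2 \<Rightarrow> 'a"
  where "xcoord i v = (vector [- (v $ 1 $ 2), v $ 1 $ 1, v $ 2 $ 1] :: 'a^3) $ i"

lemma vbasis_in_V: "vbasis $ i \<in> V"
  using exhaust_3[of i] by (auto simp: V_def vbasis_def trace_def sum_2)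

lemma xcoord_dual_basis: "xcoord i (vbasis $ j) = (if i = j then 1 else 0)"
  using exhaust_3[of i] exhaust_3[of j] by (auto simp: xcoord_def vbasis_def)

lemma V_expansion:
  assumes "v \<in> V"
  shows "v $ i $ j = (\<Sum>k\<in>UNIV. xcoord k v * vbasis $ k $ i $ j)"
  using assms exhaust_2[of i] exhaust_2[of j]
  by (auto simp: V_def trace_def sum_2 sum_3 xcoord_def vbasis_def eq_neg_iff_add_eq_0 add.commute)

text \<open>An element of PSL2 is a coset C; all its representatives act in the same way on V, and
  \<open>the_elem\<close> selects the common value.\<close>

definition act_V :: "('a::field^2^2) set \<Rightarrow> 'a^2^2 \<Rightarrow> 'a^2^2"
  where "act_V C v = the_elem ((\<lambda>g. g ** v ** matrix_inv g) ` C)"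

lemma matrix_inv_inverse:
  fixes g :: "'a::field^'n^'n"
  assumes "det g \<noteq> 0"
  shows "matrix_inv g ** g = mat 1" "g ** matrix_inv g = mat 1"
proof -
  have "\<exists>h. g ** h = mat 1 \<and> h ** g = mat 1"
    using assms by (simp add: invertible_det_nz[symmetric] invertible_def)
  then have "g ** matrix_inv g = mat 1 \<and> matrix_inv g ** g = mat 1"
    unfolding matrix_inv_def by (rule someI_ex)
  then show "matrix_inv g ** g = mat 1" "g ** matrix_inv g = mat 1"
    by blast+
qed

lemma matrix_inv_unique:
  fixes g :: "'a::field^'n^'n"
  assumes "h ** g = mat 1"
  shows "matrix_inv g = h"
proof -
  have "det h * det g = 1" using assms by (metis det_I det_mul)
  then have "det g \<noteq> 0" by auto
  then have "h ** (g ** matrix_inv g) = h"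
    using matrix_inv_inverse(2)[of g] by simp
  then show ?thesis
    using assms by (simp add: matrix_mul_assoc)
qed

lemma matrix_mult_minus:
  fixes a b :: "'a::field^'n^'n"
  shows "(- a) ** b = - (a ** b)" "a ** (- b) = - (a ** b)"
  by (simp_all add: matrix_matrix_mult_def vec_eq_iff sum_negf)

lemma act_V_representative:
  fixes C :: "('a::field^2^2) set"
  assumes "C \<in> carrier PSL2" "g \<in> C"
  shows "act_V C v = g ** v ** matrix_inv g"
proof -
  from assms(1) obtain a where a: "det a = 1" "C = {a, - a}"
    by (auto simp: PSL2_def FactGroup_def RCOSETS_def r_coset_def SL2_def matrix_mult_minus)
  have m: "matrix_inv a ** a = mat 1" using matrix_inv_inverse[of a] a by simp
  have "matrix_inv (- a) = - matrix_inv a"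
    by (rule matrix_inv_unique) (simp add: matrix_mult_minus m)
  then have "(\<lambda>g. g ** v ** matrix_inv g) ` C = {a ** v ** matrix_inv a}"
    by (simp add: a matrix_mult_minus)
  moreover from this have "g ** v ** matrix_inv g \<in> {a ** v ** matrix_inv a}" using assms(2) by blast
  ultimately show ?thesis by (simp add: act_V_def)
qed

definition act_dual :: "('a::field^2^2) set \<Rightarrow> ('a^2^2 \<Rightarrow> 'a) \<Rightarrow> 'a^2^2 \<Rightarrow> 'a"
  where "act_dual C h = (\<lambda>v. h (act_V (inv\<^bsub>PSL2\<^esub> C) v))"

text \<open>A linear form h on V, regarded as a homogeneous polynomial of degree 1:\<close>

definition lin_poly :: "('a::field^2^2 \<Rightarrow> 'a) \<Rightarrow> 'a mpoly3"
  where "lin_poly h = (\<Sum>k\<in>UNIV. Const (h (vbasis $ k)) * xvar k)"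

definition act_poly :: "('a::field^2^2) set \<Rightarrow> 'a mpoly3 \<Rightarrow> 'a mpoly3"
  where "act_poly C p = subst (\<lambda>i. lin_poly (act_dual C (xcoord i))) p"


section \<open>Differential forms\<close>

text \<open>
  A form is given by its coefficients with respect to the R-basis \<open>dx\<^sub>S\<close>, where S runs through the
  subsets of the index set and \<open>dx\<^sub>S\<close> is the exterior product of the \<open>dx\<^sub>i\<close> for i in S, in
  increasing order. Since 3 < 1 < 2 here, the basis element for S = {2, 3} is
  \<open>dx\<^sub>3 \<and> dx\<^sub>2\<close>. The R-module structure is given by \<open>+\<close> and \<open>*s\<close>; the product is \<open>wedge\<close> and
  not the componentwise \<open>*\<close> of vectors.
\<close>

type_synonym 'a form = "('a mpoly3, 3 set) vec"

definition wedge_sign :: "3 set \<Rightarrow> 3 set \<Rightarrow> 'a::comm_ring_1"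
  where "wedge_sign A B = (- 1) ^ card {(a, b). a \<in> A \<and> b \<in> B \<and> b < a}"

definition wedge :: "'a::comm_ring_1 form \<Rightarrow> 'a form \<Rightarrow> 'a form"  (infixl \<open>\<^bold>\<and>\<close> 70)
  where "\<omega> \<^bold>\<and> \<eta> = (\<chi> S. \<Sum>A\<in>Pow S. wedge_sign A (S - A) * (\<omega> $ A) * (\<eta> $ (S - A)))"

definition of_poly :: "'a::comm_ring_1 mpoly3 \<Rightarrow> 'a form"
  where "of_poly p = axis {} p"

definition dx :: "3 \<Rightarrow> 'a::comm_ring_1 form"
  where "dx i = axis {i} 1"

definition Omega :: "nat \<Rightarrow> 'a::comm_ring_1 form set"
  where "Omega k = {\<omega>. \<forall>S. \<omega> $ S \<noteq> 0 \<longrightarrow> card S = k}"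

definition diff :: "'a::comm_ring_1 mpoly3 \<Rightarrow> 'a form"
  where "diff p = (\<Sum>j\<in>UNIV. partial j p *s dx j)"

text \<open>A linear form h on V, regarded as a 1-form with constant coefficients:\<close>

definition lin_form :: "('a::field^2^2 \<Rightarrow> 'a) \<Rightarrow> 'a form"
  where "lin_form h = (\<Sum>k\<in>UNIV. Const (h (vbasis $ k)) *s dx k)"

definition wedge_list :: "'a::comm_ring_1 form list \<Rightarrow> 'a form"
  where "wedge_list \<omega>s = foldr (\<^bold>\<and>) \<omega>s (of_poly 1)"

text \<open>The diagonal action: \<open>f dx\<^sub>S\<close> is sent to the product of \<open>C \<cdot> f\<close> and the \<open>C \<cdot> dx\<^sub>i\<close>
  for i in S.\<close>

definition act_form :: "('a::field^2^2) set \<Rightarrow> 'a form \<Rightarrow> 'a form"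
  where "act_form C \<omega> = (\<Sum>S\<in>UNIV. act_poly C (\<omega> $ S) *s
    wedge_list (map (\<lambda>i. lin_form (act_dual C (xcoord i))) (sorted_list_of_set S)))"

definition invariant_forms :: "'a::field form set"
  where "invariant_forms = {\<omega>. \<forall>C\<in>carrier PSL2. act_form C \<omega> = \<omega>}"

inductive_set generated_algebra :: "'a::comm_ring_1 form set \<Rightarrow> 'a form set"
  for B :: "'a form set"
  where
    scalar: "of_poly (Const c) \<in> generated_algebra B"
  | base: "\<omega> \<in> B \<Longrightarrow> \<omega> \<in> generated_algebra B"
  | add: "\<omega> \<in> generated_algebra B \<Longrightarrow> \<eta> \<in> generated_algebra B \<Longrightarrow> \<omega> + \<eta> \<in> generated_algebra B"
  | mult: "\<omega> \<in> generated_algebra B \<Longrightarrow> \<eta> \<in> generated_algebra B \<Longrightarrow> \<omega> \<^bold>\<and> \<eta> \<in> generated_algebra B"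

definition minimal_generating_set :: "'a::comm_ring_1 form set \<Rightarrow> 'a form set \<Rightarrow> bool"
  where "minimal_generating_set B A \<longleftrightarrow>
    generated_algebra B = A \<and> (\<forall>b\<in>B. generated_algebra (B - {b}) \<noteq> A)"

text \<open>The coefficient of \<open>\<omega>\<close> at \<open>dx\<^sub>i \<and> dx\<^sub>j\<close>, for distinct i and j. The sign accounts for i and j
  possibly not being in increasing order.\<close>

definition coeff2 :: "3 \<Rightarrow> 3 \<Rightarrow> 'a::comm_ring_1 form \<Rightarrow> 'a mpoly3"
  where "coeff2 i j \<omega> = wedge_sign {i} {j} * \<omega> $ {i, j}"

definition phi :: "'a::comm_ring_1 form \<Rightarrow> 'a form"
  where "phi \<omega> = coeff2 2 3 \<omega> *s dx 3 + coeff2 3 1 \<omega> *s ((- 2) *s dx 2) + coeff2 1 2 \<omega> *s dx 1"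

lemma three_order: "(3::3) < 2" "(3::3) < 1" "(1::3) < 2"
  unfolding less_bit1_def by (simp_all only: bit1.Rep_numeral bit1.Rep_1, simp_all)
lemma three_order_not: "\<not> (2::3) < 3" "\<not> (1::3) < 3" "\<not> (2::3) < 1"
  using three_order by (auto dest: less_asym simp only:)

lemma wedge_sign_pairs: "wedge_sign {2} {3} = (-1::'a::comm_ring_1)"
  "wedge_sign {3} {1} = (1::'a)" "wedge_sign {1} {2} = (1::'a)"
proof -
  have a: "{(a::3,b::3). a \<in> {2} \<and> b \<in> {3} \<and> b < a} = {(2,3)}"
    using three_order three_order_not by (auto simp only:)
  have b: "{(a::3,b::3). a \<in> {3} \<and> b \<in> {1} \<and> b < a} = {}"
    using three_order three_order_not by (auto simp only:)
  have c: "{(a::3,b::3). a \<in> {1} \<and> b \<in> {2} \<and> b < a} = {}"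
    using three_order three_order_not by (auto simp only:)
  show "wedge_sign {2} {3} = (-1::'a::comm_ring_1)"
    "wedge_sign {3} {1} = (1::'a)" "wedge_sign {1} {2} = (1::'a)"
    unfolding wedge_sign_def a b c by simp_all
qed

lemma dx_wedge_dx:
  assumes "i \<noteq> j"
  shows "dx i \<^bold>\<and> dx j = axis {i,j} (wedge_sign {i} {j} :: 'a::comm_ring_1 mpoly3)"
proof -
  have "(\<Sum>A\<in>Pow S. wedge_sign A (S - A) * (axis {i} 1 $ A) * (axis {j} 1 $ (S - A)))
    = (axis {i,j} (wedge_sign {i} {j} :: 'a mpoly3)) $ S" for S
  proof (cases "S = {i,j}")
    case True
    have e: "{i,j} - {i} = {j}" using assms by auto
    have "(\<Sum>A\<in>Pow S. wedge_sign A (S - A) * (axis {i} 1 $ A) * ((axis {j} 1 :: 'a form) $ (S - A))) =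
     (\<Sum>A\<in>{{i}}. wedge_sign A (S - A) * (axis {i} 1 $ A) * ((axis {j} 1 :: 'a form) $ (S - A)))"
      by (rule sum.mono_neutral_right) (auto simp: True axis_def)
    then show ?thesis using True e by (simp add: axis_def)
  next
    case False
    then show ?thesis using assms by (intro trans[OF sum.neutral]) (auto simp: axis_def)
  qed
  then show ?thesis by (simp add: wedge_def dx_def vec_eq_iff)
qed

lemma three_distinct: "(2::3) \<noteq> 3" "(3::3) \<noteq> 1" "(1::3) \<noteq> 2"  "(3::3) \<noteq> 2" "(1::3) \<noteq> 3" "(2::3) \<noteq> 1" by auto

lemma three_pairs_distinct: "{2::3,3} \<noteq> {3,1}" "{2::3,3} \<noteq> {1,2}" "{3::3,1} \<noteq> {1,2}"
  using three_distinct by blast+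

lemma phi_values: "phi (dx 2 \<^bold>\<and> dx 3) = (dx 3 :: 'a::comm_ring_1 form)"
  "phi (dx 3 \<^bold>\<and> dx 1) = ((-2) *s dx 2 :: 'a form)"
  "phi (dx 1 \<^bold>\<and> dx 2) = (dx 1 :: 'a form)"
  using three_pairs_distinct three_pairs_distinct[symmetric]
  by (simp_all add: phi_def coeff2_def dx_wedge_dx three_distinct wedge_sign_pairs
      axis_def)

text \<open>The map \<open>phi\<close> is defined on all forms and is bijective only from \<open>Omega 2\<close> to \<open>Omega 1\<close>:\<close>

definition phi_inv :: "'a::comm_ring_1 form \<Rightarrow> 'a form"
  where "phi_inv = inv_into (Omega 2) phi"


section \<open>The polynomials \<open>f\<^sub>1\<close>, \<dots>, \<open>f\<^sub>4\<close>\<close>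

definition f1 :: "'a::{field,finite} mpoly3"
  where "f1 = xvar 1 * xvar 3 - xvar 2 ^ 2"

definition f2 :: "'a::{field,finite} mpoly3"
  where "f2 = xvar 1 ^ CARD('a) * xvar 3 + xvar 1 * xvar 3 ^ CARD('a)
    - 2 * xvar 2 ^ (CARD('a) + 1)"

definition L :: "('a::{field,finite} \<times> 'a) set"
  where "L = {(b, c). c \<noteq> 0 \<and> \<not> (\<exists>d. b ^ 2 - 4 * c = d ^ 2)}"

definition f3 :: "'a::{field,finite} mpoly3"
  where "f3 = (\<Prod>(b, c)\<in>L. xvar 1 + Const b * xvar 2 + Const c * xvar 3)"

definition f4 :: "'a::{field,finite} mpoly3"
  where "f4 = det (\<chi> i j. partial j ((vector [f1, f2, f3] :: 'a mpoly3^3) $ i))"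

end

theory Submission
  imports Defs "HOL-Computational_Algebra.Polynomial"
begin

text \<open>
  Let s be the reflection \<open>x\<^sub>2 \<mapsto> - x\<^sub>2\<close>, which normalizes G; every invariant is the sum of an s-even and
  an s-odd one. The even invariants form \<open>A = F[f\<^sub>1, f\<^sub>2, f\<^sub>3]\<close>: on the cone \<open>(u\<^sup>2, uv, v\<^sup>2)\<close>, whose ideal is
  generated by \<open>f\<^sub>1\<close>, they become invariants of \<open>SL\<^sub>2\<close> in two variables, and \<open>f\<^sub>2, f\<^sub>3\<close> become the square of
  the first and the second Dickson invariant. An odd invariant is divisible by \<open>x\<^sub>2\<close>, hence by all linear
  forms in its G-orbit, hence by \<open>f\<^sub>4\<close>, which is their product up to a scalar.

  With \<open>J\<^sub>i = df\<^sub>i\<close> and \<open>N\<^sub>i = df\<^sub>j \<and> df\<^sub>k\<close>, Cramer's rule expresses \<open>f\<^sub>4 u\<close> for an invariant 1-form u through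
  the \<open>J\<^sub>i\<close> with invariant coefficients, whose odd parts are divisible by \<open>f\<^sub>4\<close>. After subtracting the
  resulting combination of the \<open>J\<^sub>i\<close>, the dual Cramer rule and the invariant bilinear form on 1-forms show
  that the rest is a combination of the \<open>\<phi> N\<^sub>i\<close>. This yields 1-forms and, through \<open>\<phi>\<close>, 2-forms.

  No generator can be omitted: for each one there is a subalgebra that contains the others but not this one.
  For most generators, it is cut out by the condition that pairing with \<open>N\<^sub>i\<close> or \<open>J\<^sub>i\<close> gives an invariant
  whose odd part is \<open>f\<^sub>4\<close> times a polynomial without constant term.
\<close>

section \<open>Polynomials in three variables\<close>

text \<open>The substitution \<open>rho\<close> sends the symmetric matrix X with rows (x1, x2),
  (x2, x3) to g X g^T. So \<open>f1\<close> is a determinant, \<open>f2\<close> is its polar form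
  evaluated at x and x^q, and the equation of the cone says that X is singular. On the cone x1 + b
  x2 + c x3 becomes u^2 + b u v + c v^2: the factors of \<open>f3\<close> are the irreducible ones,
  while the orbit of x2 consists, up to scalars, of the forms that split into distinct factors.

  That \<open>f4\<close> is a product of linear forms is never computed: oddness and invariance give
  divisibility by every form of the orbit, and their number reaches the degree bound of
  \<open>f4\<close>.

  Two facts keep the families of generators apart. First, s has determinant -1, so phi anticommutes
  with it, and the df_i and phi(df_j ^ df_k) have opposite parity. Second, the gradients vanish at
  the origin, so every pairing with them has constant term 0; this makes the conditions that cut out
  the subalgebras stable under multiplication by invariants.\<close>

definition insertion :: "('a::comm_ring_1 \<Rightarrow> 'b::comm_ring_1) \<Rightarrow> (3 \<Rightarrow> 'b) \<Rightarrow> 'a mpoly3 \<Rightarrow> 'b"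
  where "insertion \<kappa> \<sigma> p = (\<Sum>m\<in>Poly_Mapping.keys p.
    \<kappa> (Poly_Mapping.lookup p m) * (\<Prod>i\<in>UNIV. \<sigma> i ^ Poly_Mapping.lookup m i))"

definition ring_hom :: "('a::comm_ring_1 \<Rightarrow> 'b::comm_ring_1) \<Rightarrow> bool"
  where "ring_hom h \<longleftrightarrow> h 1 = 1 \<and> (\<forall>x y. h (x + y) = h x + h y) \<and> (\<forall>x y. h (x * y) = h x * h y)"

lemma ring_homD:
  assumes "ring_hom h"
  shows "h 0 = 0" "h 1 = 1" "h (x + y) = h x + h y" "h (x * y) = h x * h y"
    "h (- x) = - h x" "h (x - y) = h x - h y" "h (x ^ n) = h x ^ n" "h (of_nat n) = of_nat n"
    "h (numeral k) = numeral k" "h (sum f A) = (\<Sum>i\<in>A. h (f i))" "h (prod f A) = (\<Prod>i\<in>A. h (f i))"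
proof -
  have one: "h 1 = 1" and add: "\<And>x y. h (x + y) = h x + h y" and mult: "\<And>x y. h (x * y) = h x * h y"
    using assms by (auto simp: ring_hom_def)
  have zero: "h 0 = 0" using add[of 0 0] by simp
  have neg: "h (- x) = - h x" for x using add[of x "- x"] zero by (simp add: eq_neg_iff_add_eq_0 add.commute)
  show "h 0 = 0" "h 1 = 1" "h (x + y) = h x + h y" "h (x * y) = h x * h y" "h (- x) = - h x"
    using zero one add mult neg by auto
  show "h (x - y) = h x - h y" using add[of x "- y"] neg by simp
  show "h (x ^ n) = h x ^ n" by (induction n) (auto simp: one mult)
  have nat: "h (of_nat n) = of_nat n" for n by (induction n) (auto simp: one zero add)
  show "h (of_nat n) = of_nat n" by (rule nat)
  show "h (numeral k) = numeral k" using nat[of "numeral k"] by simp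
  show "h (sum f A) = (\<Sum>i\<in>A. h (f i))" by (induction A rule: infinite_finite_induct) (auto simp: zero add)
  show "h (prod f A) = (\<Prod>i\<in>A. h (f i))" by (induction A rule: infinite_finite_induct) (auto simp: one mult)
qed

lemma mpoly3_single_induct [case_names zero single add]:
  fixes p :: "'a::comm_ring_1 mpoly3"
  assumes "P 0" "\<And>m c. P (Poly_Mapping.single m c)" "\<And>p q. P p \<Longrightarrow> P q \<Longrightarrow> P (p + q)"
  shows "P p"
proof -
  have "p = (\<Sum>m\<in>Poly_Mapping.keys p. Poly_Mapping.single m (Poly_Mapping.lookup p m))"
    by (rule poly_mapping_eqI) (auto simp: lookup_sum lookup_single when_def in_keys_iff)
  moreover have "P (\<Sum>m\<in>A. Poly_Mapping.single m (Poly_Mapping.lookup p m))" if "finite A" for A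
    using that by induction (auto intro: assms)
  ultimately show ?thesis by (metis finite_keys)
qed

lemma ring_hom_insertion:
  assumes "ring_hom \<kappa>"
  shows "ring_hom (insertion \<kappa> \<sigma>)"
    and "insertion \<kappa> \<sigma> (Const c) = \<kappa> c" and "insertion \<kappa> \<sigma> (xvar i) = \<sigma> i"
proof -
  note h = ring_homD[OF assms]
  let ?e = "insertion \<kappa> \<sigma>"
  let ?mon = "\<lambda>m. \<Prod>i\<in>UNIV. \<sigma> i ^ Poly_Mapping.lookup m i"
  \<comment> \<open>Sums over \<open>keys\<close> are not additive, since terms may cancel; over a
    common finite superset of the supports they are.\<close>
  have superset: "?e p = (\<Sum>m\<in>A. \<kappa> (Poly_Mapping.lookup p m) * ?mon m)"
    if "finite A" "Poly_Mapping.keys p \<subseteq> A" for p A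
    unfolding insertion_def by (rule sum.mono_neutral_left) (use that in \<open>auto simp: in_keys_iff h\<close>)
  have single: "?e (Poly_Mapping.single m c) = \<kappa> c * ?mon m" for m c
    by (subst superset[of "{m}"]) auto
  have add: "?e (p + q) = ?e p + ?e q" for p q
  proof -
    let ?A = "Poly_Mapping.keys p \<union> Poly_Mapping.keys q"
    show ?thesis
      by (subst (1 2 3) superset[of ?A])
        (use Poly_Mapping.keys_add[of p q] in \<open>auto simp: lookup_add h distrib_right sum.distrib\<close>)
  qed
  have zero: "?e 0 = 0" by (simp add: insertion_def)
  have mon_add: "?mon (m + n) = ?mon m * ?mon n" for m n
    by (simp add: lookup_add power_add prod.distrib)
  have mult_single: "?e (Poly_Mapping.single m c * q) = ?e (Poly_Mapping.single m c) * ?e q" for m c q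
    by (induction q rule: mpoly3_single_induct)
      (simp_all add: zero add mult_single single mon_add h distrib_left algebra_simps del: mult_cancel_left)
  have mult: "?e (p * q) = ?e p * ?e q" for p q
    by (induction p rule: mpoly3_single_induct) (auto simp: zero add mult_single distrib_right)
  show C: "?e (Const c) = \<kappa> c" for c by (simp add: Const_def single)
  have "?e 1 = 1" using C[of 1] h by (simp add: Const_def)
  then show "ring_hom ?e" by (auto simp: ring_hom_def add mult)
  have "?mon (Poly_Mapping.single i 1) = (\<Prod>j\<in>UNIV. if j = i then \<sigma> i else 1)"
    by (rule prod.cong) (auto simp: lookup_single when_def)
  then show "?e (xvar i) = \<sigma> i" using h by (simp add: xvar_def single)
qed

lemma ring_hom_Const: "ring_hom (Const :: 'a::comm_ring_1 \<Rightarrow> _)"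
  by (auto simp: ring_hom_def Const_def single_add mult_single)

lemmas Const_simps = ring_homD[OF ring_hom_Const]

lemma subst_insertion: "subst = insertion Const"
  by (simp add: fun_eq_iff subst_def insertion_def)

lemma ring_hom_subst: "ring_hom (subst \<sigma>)"
  by (simp add: subst_insertion ring_hom_insertion ring_hom_Const)

lemmas subst_hom = ring_homD[OF ring_hom_subst]

lemma subst_Const [simp]: "subst \<sigma> (Const c) = Const c"
  and subst_xvar [simp]: "subst \<sigma> (xvar i) = \<sigma> i"
  by (simp_all add: subst_insertion ring_hom_insertion ring_hom_Const)

lemma mpoly3_induct [case_names Const xvar add mult]:
  fixes p :: "'a::comm_ring_1 mpoly3"
  assumes C: "\<And>c. P (Const c)" and X: "\<And>i. P (xvar i)"
    and add: "\<And>p q. P p \<Longrightarrow> P q \<Longrightarrow> P (p + q)" and mult: "\<And>p q. P p \<Longrightarrow> P q \<Longrightarrow> P (p * q)"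
  shows "P p"
proof -
  have pow: "P (p ^ n)" if "P p" for p n
    by (induction n) (use C[of 1] that in \<open>auto intro: mult simp: Const_simps\<close>)
  have one: "P 1" using C[of 1] by (simp add: Const_simps)
  have zero: "P 0" using C[of 0] by (simp add: Const_simps)
  have eq: "Poly_Mapping.single m c = Const c * (\<Prod>i\<in>UNIV. xvar i ^ Poly_Mapping.lookup m i)"
    for m and c :: 'a
  proof -
    have p: "xvar i ^ n = Poly_Mapping.single (Poly_Mapping.single i n) (1::'a)" for i n
      by (induction n) (simp_all add: xvar_def mult_single flip: single_add)
    have "(\<Prod>i\<in>A. xvar i ^ Poly_Mapping.lookup m i)
        = Poly_Mapping.single (\<Sum>i\<in>A. Poly_Mapping.single i (Poly_Mapping.lookup m i)) (1::'a)" for A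
      by (induction A rule: infinite_finite_induct) (simp_all add: p mult_single)
    moreover have "(\<Sum>i\<in>UNIV. Poly_Mapping.single i (Poly_Mapping.lookup m i)) = m"
      by (rule poly_mapping_eqI) (simp add: lookup_sum lookup_single when_def)
    ultimately show ?thesis by (simp add: Const_def mult_single)
  qed
  have "P (Poly_Mapping.single m c)" for m c
    unfolding eq prod.distrib
    by (intro mult C, rule finite_induct[where P = "\<lambda>A. P (\<Prod>i\<in>A. xvar i ^ Poly_Mapping.lookup m i)"])
      (auto intro: one mult pow X)
  then show ?thesis by (induction p rule: mpoly3_single_induct) (auto intro: zero add)
qed

lemma ring_hom_mpoly3_eqI:
  assumes "ring_hom h" "ring_hom k" "\<And>c. h (Const c) = k (Const c)" "\<And>i. h (xvar i) = k (xvar i)"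
  shows "h p = k p"
  by (induction p rule: mpoly3_induct) (simp_all add: assms ring_homD[OF assms(1)] ring_homD[OF assms(2)])

lemma ring_hom_id: "ring_hom (\<lambda>x. x)"
  by (simp add: ring_hom_def)

lemma ring_hom_comp: "ring_hom h \<Longrightarrow> ring_hom k \<Longrightarrow> ring_hom (\<lambda>x. h (k x))"
  by (simp add: ring_hom_def)

lemma subst_subst: "subst \<sigma> (subst \<tau> p) = subst (\<lambda>i. subst \<sigma> (\<tau> i)) p"
  by (rule ring_hom_mpoly3_eqI) (simp_all add: ring_hom_subst ring_hom_comp)

lemma subst_xvar_id: "subst xvar p = p"
  by (rule ring_hom_mpoly3_eqI) (simp_all add: ring_hom_subst, simp add: ring_hom_def)

text \<open>Substitution respects congruences modulo d. The use is that p is congruent, modulo a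
  linear form, to its restriction to the plane where the form vanishes.\<close>

lemma dvd_subst_diff:
  assumes "\<And>i. d dvd \<sigma> i - \<tau> i"
  shows "d dvd subst \<sigma> p - subst \<tau> p"
proof (induction p rule: mpoly3_induct)
  case (add p q)
  have "subst \<sigma> (p + q) - subst \<tau> (p + q) = (subst \<sigma> p - subst \<tau> p) + (subst \<sigma> q - subst \<tau> q)"
    by (simp add: subst_hom)
  with add show ?case by (metis dvd_add)
next
  case (mult p q)
  have "subst \<sigma> (p * q) - subst \<tau> (p * q)
      = subst \<sigma> p * (subst \<sigma> q - subst \<tau> q) + (subst \<sigma> p - subst \<tau> p) * subst \<tau> q"
    by (simp add: subst_hom algebra_simps)
  with mult show ?case by (metis dvd_add dvd_mult dvd_mult2)
qed (use assms in auto)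

lemma dvd_minus_subst:
  assumes "\<And>i. d dvd xvar i - \<tau> i"
  shows "d dvd p - subst \<tau> p"
  using dvd_subst_diff[of d xvar \<tau> p] assms by (simp add: subst_xvar_id)

lemma Const_eq_iff [simp]: "Const c = Const d \<longleftrightarrow> c = d"
  unfolding Const_def by (metis lookup_single_eq)

lemma Const_eq_0_iff [simp]: "Const c = 0 \<longleftrightarrow> c = (0::'a::comm_ring_1)"
  using Const_eq_iff[of c 0] by (simp only: Const_simps)

lemma two_neq_0_mpoly3: "(2::'a::comm_ring_1) \<noteq> 0 \<Longrightarrow> (2::'a mpoly3) \<noteq> 0"
  by (metis Const_eq_0_iff Const_simps(9))

definition const_term :: "'a::comm_ring_1 mpoly3 \<Rightarrow> 'a"
  where "const_term = insertion (\<lambda>c. c) (\<lambda>_. 0)"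

lemma ring_hom_const_term: "ring_hom const_term"
  unfolding const_term_def by (rule ring_hom_insertion(1)[OF ring_hom_id])

lemmas const_term_hom = ring_homD[OF ring_hom_const_term]

lemma const_term_Const [simp]: "const_term (Const c) = c"
  and const_term_xvar [simp]: "const_term (xvar i) = 0"
  by (simp_all add: const_term_def ring_hom_insertion(2,3)[OF ring_hom_id])

lemma const_term_subst:
  assumes "\<And>i. const_term (\<sigma> i) = 0"
  shows "const_term (subst \<sigma> p) = const_term p"
  by (induction p rule: mpoly3_induct) (simp_all add: assms subst_hom const_term_hom)

section \<open>Total degree\<close>

text \<open>The grading by total degree is read off after replacing each variable \<open>x\<^sub>i\<close> by \<open>t x\<^sub>i\<close>.\<close>

definition scale :: "'a::comm_ring_1 mpoly3 \<Rightarrow> 'a mpoly3 poly"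
  where "scale = insertion (\<lambda>c. [:Const c:]) (\<lambda>i. [:0, xvar i:])"

definition tdeg :: "'a::comm_ring_1 mpoly3 \<Rightarrow> nat"
  where "tdeg p = degree (scale p)"

lemma ring_hom_pConst: "ring_hom (\<lambda>c::'a::comm_ring_1. [:Const c:])"
  by (simp add: ring_hom_def Const_simps)

lemma ring_hom_scale: "ring_hom scale"
  by (simp add: scale_def ring_hom_insertion ring_hom_pConst)

lemmas scale_hom = ring_homD[OF ring_hom_scale]

lemma scale_Const [simp]: "scale (Const c) = [:Const c:]"
  and scale_xvar [simp]: "scale (xvar i) = [:0, xvar i:]"
  by (simp_all add: scale_def ring_hom_insertion ring_hom_pConst)

lemma poly_scale_1: "poly (scale p) 1 = p"
  by (induction p rule: mpoly3_induct) (simp_all add: scale_hom)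

lemma poly_scale_0: "poly (scale p) 0 = Const (const_term p)"
  by (induction p rule: mpoly3_induct) (simp_all add: scale_hom const_term_hom Const_simps)

lemma scale_eq_0_iff [simp]: "scale p = 0 \<longleftrightarrow> p = 0"
  by (metis poly_scale_1 poly_0 scale_hom(1))

text \<open>A polynomial in t of degree 0 has the same value at t = 1, which is p, and at t = 0,
  which is the constant term.\<close>

lemma tdeg_eq_0: "tdeg p = 0 \<Longrightarrow> p = Const (const_term p)"
proof -
  assume "tdeg p = 0"
  then obtain r where "scale p = [:r:]" unfolding tdeg_def by (metis degree_eq_zeroE)
  then show ?thesis using poly_scale_1[of p] poly_scale_0[of p] by simp
qed

lemma tdeg_mult:
  fixes p q :: "'a::field mpoly3"
  shows "p \<noteq> 0 \<Longrightarrow> q \<noteq> 0 \<Longrightarrow> tdeg (p * q) = tdeg p + tdeg q"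
  by (simp add: tdeg_def scale_hom degree_mult_eq)

lemma tdeg_mult_le: "tdeg (p * q) \<le> tdeg p + tdeg q"
  by (simp add: tdeg_def scale_hom degree_mult_le)

lemma tdeg_add_le: "tdeg p \<le> n \<Longrightarrow> tdeg q \<le> n \<Longrightarrow> tdeg (p + q) \<le> n"
  and tdeg_diff_le: "tdeg p \<le> n \<Longrightarrow> tdeg q \<le> n \<Longrightarrow> tdeg (p - q) \<le> n"
  by (simp_all add: tdeg_def scale_hom degree_add_le degree_diff_le)

lemma tdeg_uminus [simp]: "tdeg (- p) = tdeg p"
  by (simp add: tdeg_def scale_hom)

lemma tdeg_sum_le: "(\<And>i. i \<in> A \<Longrightarrow> tdeg (f i) \<le> n) \<Longrightarrow> tdeg (sum f A) \<le> n"
  by (induction A rule: infinite_finite_induct) (simp_all add: tdeg_add_le, simp_all add: tdeg_def scale_hom)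

lemma tdeg_Const [simp]: "tdeg (Const c) = 0"
  by (simp add: tdeg_def)

lemma tdeg_numeral [simp]: "tdeg (numeral k) = 0"
  by (metis Const_simps(9) tdeg_Const)

lemma tdeg_power:
  fixes p :: "'a::field mpoly3"
  shows "tdeg (p ^ n) = n * tdeg p"
  by (cases "p = 0") (auto simp: tdeg_def scale_hom degree_power_eq power_0_left)

lemma xvar_neq_0 [simp]: "xvar i \<noteq> (0::'a::comm_ring_1 mpoly3)"
  unfolding xvar_def by (metis lookup_single_eq lookup_zero zero_neq_one)

lemma tdeg_xvar [simp]: "tdeg (xvar i :: 'a::comm_ring_1 mpoly3) = 1"
  by (simp add: tdeg_def)

lemma tdeg_prod:
  fixes f :: "'b \<Rightarrow> 'a::field mpoly3"
  assumes "\<And>i. i \<in> A \<Longrightarrow> f i \<noteq> 0"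
  shows "tdeg (prod f A) = (\<Sum>i\<in>A. tdeg (f i))"
  using assms
proof (induction A rule: infinite_finite_induct)
  case (insert x F)
  then have "prod f F \<noteq> 0" by simp
  with insert show ?case by (simp add: tdeg_mult)
qed (simp_all add: tdeg_def scale_hom)

text \<open>Degrees add, so the cofactor is a constant. This identifies \<open>f4\<close> and
  \<open>skew\<close> with products of linear forms without any expansion of those products.\<close>

lemma dvd_tdeg_le_imp_associated:
  fixes d p :: "'a::field mpoly3"
  assumes "d dvd p" "p \<noteq> 0" "tdeg p \<le> tdeg d"
  obtains c where "c \<noteq> 0" "p = Const c * d"
proof -
  from assms(1) obtain u where u: "p = d * u" by blast
  then have "tdeg u = 0" using assms tdeg_mult[of d u] by auto
  then obtain c where c: "u = Const c" using tdeg_eq_0 by blast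
  then have "c \<noteq> 0" using u assms(2) by (auto simp: Const_simps)
  with that u c show ?thesis by (simp add: mult.commute)
qed

section \<open>Partial derivatives\<close>

text \<open>Read coefficientwise, differentiation is free of truncated subtraction, and its
  additivity becomes evident.\<close>

lemma lookup_partial:
  "Poly_Mapping.lookup (partial i p) n =
    of_nat (Suc (Poly_Mapping.lookup n i)) * Poly_Mapping.lookup p (n + Poly_Mapping.single i 1)"
proof -
  let ?s = "Poly_Mapping.single i (1::nat)"
  have "Poly_Mapping.lookup (partial i p) n = (\<Sum>m\<in>Poly_Mapping.keys p.
      if m - ?s = n then of_nat (Poly_Mapping.lookup m i) * Poly_Mapping.lookup p m else 0)"
    by (simp add: partial_def lookup_sum lookup_single when_def)
  also have "\<dots> = (\<Sum>m\<in>Poly_Mapping.keys p.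
      if m = n + ?s then of_nat (Suc (Poly_Mapping.lookup n i)) * Poly_Mapping.lookup p m else 0)"
  proof (rule sum.cong[OF refl])
    fix m
    show "(if m - ?s = n then of_nat (Poly_Mapping.lookup m i) * Poly_Mapping.lookup p m else 0)
      = (if m = n + ?s then of_nat (Suc (Poly_Mapping.lookup n i)) * Poly_Mapping.lookup p m else 0)"
    proof (cases "Poly_Mapping.lookup m i = 0")
      case True
      then have "m \<noteq> n + ?s" by (auto simp: lookup_add)
      with True show ?thesis by simp
    next
      case False
      have "m = (m - ?s) + ?s"
        by (rule poly_mapping_eqI) (use False in \<open>auto simp: lookup_add lookup_minus lookup_single when_def\<close>)
      then have "m - ?s = n \<longleftrightarrow> m = n + ?s" by (metis add_right_cancel)
      then show ?thesis by (auto simp: lookup_add)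
    qed
  qed
  also have "\<dots> = of_nat (Suc (Poly_Mapping.lookup n i)) * Poly_Mapping.lookup p (n + ?s)"
    by (simp add: in_keys_iff)
  finally show ?thesis .
qed

lemma partial_add: "partial i (p + q) = partial i p + partial i q"
  by (rule poly_mapping_eqI) (simp only: lookup_partial lookup_add distrib_left)

lemma partial_single:
  "partial i (Poly_Mapping.single m c) =
    Poly_Mapping.single (m - Poly_Mapping.single i 1) (of_nat (Poly_Mapping.lookup m i) * c)"
  by (cases "c = 0") (simp_all add: partial_def)

lemma partial_zero [simp]: "partial i 0 = 0"
  by (simp add: partial_def)

lemma partial_Const [simp]: "partial i (Const c) = 0"
  by (simp add: Const_def partial_single)

lemma partial_xvar: "partial i (xvar j) = (if i = j then 1 else 0)"
  by (simp add: xvar_def partial_single lookup_single when_def)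

lemma partial_mult: "partial i (p * q) = partial i p * q + p * partial i q"
proof -
  let ?s = "Poly_Mapping.single i (1::nat)"
  have ss: "partial i (Poly_Mapping.single m c * Poly_Mapping.single n d) =
      partial i (Poly_Mapping.single m c) * Poly_Mapping.single n d
      + Poly_Mapping.single m c * partial i (Poly_Mapping.single n d)" for m n and c d :: 'a
  proof -
    have 1: "Poly_Mapping.single (m - ?s + n) (of_nat (Poly_Mapping.lookup m i) * (c * d))
      = Poly_Mapping.single (m + n - ?s) (of_nat (Poly_Mapping.lookup m i) * (c * d))"
    proof (cases "Poly_Mapping.lookup m i = 0")
      case False
      have "m - ?s + n = m + n - ?s"
        by (rule poly_mapping_eqI) (use False in \<open>auto simp: lookup_add lookup_minus lookup_single when_def\<close>)
      then show ?thesis by simp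
    qed simp
    have 2: "Poly_Mapping.single (m + (n - ?s)) (of_nat (Poly_Mapping.lookup n i) * (c * d))
      = Poly_Mapping.single (m + n - ?s) (of_nat (Poly_Mapping.lookup n i) * (c * d))"
    proof (cases "Poly_Mapping.lookup n i = 0")
      case False
      have "m + (n - ?s) = m + n - ?s"
        by (rule poly_mapping_eqI) (use False in \<open>auto simp: lookup_add lookup_minus lookup_single when_def\<close>)
      then show ?thesis by simp
    qed simp
    show ?thesis
      using 1 2 by (simp add: partial_single mult_single lookup_add distrib_right mult.assoc
          mult.left_commute[of c] flip: single_add)
  qed
  have s: "partial i (Poly_Mapping.single m c * q) =
      partial i (Poly_Mapping.single m c) * q + Poly_Mapping.single m c * partial i q" for m c
    by (induction q rule: mpoly3_single_induct) (simp_all add: ss partial_add algebra_simps)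
  show ?thesis
    by (induction p rule: mpoly3_single_induct) (simp_all add: s partial_add distrib_left distrib_right add_ac)
qed

lemma partial_uminus: "partial i (- p) = - partial i p"
  using partial_add[of i p "- p"] by (simp add: eq_neg_iff_add_eq_0 add.commute)

lemma partial_diff: "partial i (p - q) = partial i p - partial i q"
  using partial_add[of i p "- q"] by (simp add: partial_uminus)

lemma partial_numeral [simp]: "partial i (numeral k) = 0"
  by (metis Const_simps(9) partial_Const)

lemma partial_one [simp]: "partial i 1 = 0"
  by (metis Const_simps(2) partial_Const)

lemma partial_power: "partial i (p ^ n) = of_nat n * p ^ (n - 1) * partial i p"
proof (induction n)
  case (Suc n)
  then show ?case by (cases n) (simp_all add: partial_mult algebra_simps)
qed simp

lemma partial_prod:
  assumes "finite A"
  shows "partial i (prod f A) = (\<Sum>a\<in>A. partial i (f a) * prod f (A - {a}))"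
  using assms
proof induction
  case (insert x F)
  have "(\<Sum>a\<in>F. partial i (f a) * prod f (insert x F - {a}))
      = (\<Sum>a\<in>F. f x * (partial i (f a) * prod f (F - {a})))"
  proof (rule sum.cong[OF refl])
    fix a assume "a \<in> F"
    then have "insert x F - {a} = insert x (F - {a})" using insert by auto
    then show "partial i (f a) * prod f (insert x F - {a}) = f x * (partial i (f a) * prod f (F - {a}))"
      using insert by (simp add: mult.left_commute)
  qed
  then show ?case using insert by (simp add: partial_mult sum_distrib_left)
qed simp

lemma chain_rule:
  "partial j (subst \<sigma> p) = (\<Sum>i\<in>UNIV. subst \<sigma> (partial i p) * partial j (\<sigma> i))"
proof (induction p rule: mpoly3_induct)
  case (xvar i)
  have "(\<Sum>k\<in>UNIV. subst \<sigma> (if k = i then 1 else 0) * partial j (\<sigma> k))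
      = (\<Sum>k\<in>UNIV. if k = i then partial j (\<sigma> i) else 0)"
    by (rule sum.cong) (auto simp: subst_hom)
  then show ?case by (simp add: partial_xvar)
next
  case (add p q)
  then show ?case by (simp add: subst_hom partial_add sum.distrib algebra_simps)
next
  case (mult p q)
  then show ?case
    by (simp add: subst_hom partial_add partial_mult sum.distrib sum_distrib_left sum_distrib_right algebra_simps)
qed (simp_all add: subst_hom)

section \<open>Finite fields\<close>

text \<open>Multiplication by a nonzero element permutes the nonzero elements; comparing their
  products gives a^(q-1) = 1.\<close>

lemma power_card_eq_self: "(a::'a::{field,finite}) ^ CARD('a) = a"
proof (cases "a = 0")
  case False
  let ?S = "UNIV - {0::'a}"
  have "bij_betw ((*) a) ?S ?S"
    by (rule bij_betw_byWitness[where f' = "\<lambda>x. x / a"]) (use False in auto)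
  then have "(\<Prod>x\<in>?S. a * x) = \<Prod>?S"
    by (rule prod.reindex_bij_betw)
  then have "a ^ card ?S * \<Prod>?S = \<Prod>?S" by (simp add: prod.distrib)
  then have "a ^ card ?S = 1" by simp
  then have "a * a ^ (CARD('a) - 1) = a" by (simp add: card_Diff_subset)
  then show ?thesis by (metis finite_UNIV_card_ge_0 finite power_minus_mult mult.commute)
qed simp

lemma one_less_card_field: "1 < CARD('a::{field,finite})"
proof -
  have "card {0, 1::'a} \<le> CARD('a)" by (rule card_mono) auto
  then show ?thesis by simp
qed

text \<open>The polynomial \<open>(X + 1)\<^sup>q - X\<^sup>q - 1\<close> has degree less than q and vanishes on the whole field.\<close>

lemma of_nat_choose_card_eq_0:
  assumes "0 < k" "k < CARD('a::{field,finite})"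
  shows "of_nat (CARD('a) choose k) = (0::'a)"
proof -
  let ?q = "CARD('a)"
  define P :: "'a poly" where "P = (\<Sum>k\<in>{0<..<?q}. monom (of_nat (?q choose k)) k)"
  have set: "{..?q} = insert 0 (insert ?q {0<..<?q})" by auto
  have "poly P x = 0" for x
  proof -
    have "x + 1 = (x + 1) ^ ?q" by (simp add: power_card_eq_self)
    also have "\<dots> = (\<Sum>k\<le>?q. of_nat (?q choose k) * x ^ k)"
      by (simp add: binomial_ring)
    also have "\<dots> = 1 + x ^ ?q + poly P x"
      unfolding set by (simp add: P_def poly_sum poly_monom)
    finally show ?thesis by (simp add: power_card_eq_self)
  qed
  then have roots: "{x. poly P x = 0} = UNIV" by auto
  have "degree P \<le> ?q - 1"
    unfolding P_def by (rule degree_sum_le) (auto intro: order.trans[OF degree_monom_le])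
  then have "P = 0"
    using card_poly_roots_bound[of P] roots one_less_card_field[where ?'a = 'a] by fastforce
  moreover have "coeff P k = of_nat (?q choose k)"
    using assms by (simp add: P_def coeff_sum)
  ultimately show ?thesis by simp
qed

lemma of_nat_card_eq_0: "of_nat CARD('a) = (0::'a::{field,finite})"
  using of_nat_choose_card_eq_0[of 1, where ?'a = 'a] one_less_card_field[where ?'a = 'a] by simp

lemma of_nat_card_mpoly3: "of_nat CARD('a) = (0::'a::{field,finite} mpoly3)"
  by (metis of_nat_card_eq_0 Const_simps(1,8))

lemma frobenius_add:
  "(x + y :: 'a::{field,finite} mpoly3) ^ CARD('a) = x ^ CARD('a) + y ^ CARD('a)"
proof -
  let ?q = "CARD('a)"
  have set: "{..?q} = insert 0 (insert ?q {0<..<?q})" by auto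
  have z: "of_nat (?q choose k) = (0::'a mpoly3)" if "k \<in> {0<..<?q}" for k
  proof -
    have "of_nat (?q choose k) = Const (of_nat (?q choose k) :: 'a)" by (simp only: Const_simps)
    with that show ?thesis by (simp add: of_nat_choose_card_eq_0 Const_simps)
  qed
  have "(x + y) ^ ?q = (\<Sum>k\<le>?q. of_nat (?q choose k) * x ^ k * y ^ (?q - k))"
    by (rule binomial_ring)
  also have "\<dots> = y ^ ?q + x ^ ?q" unfolding set by (simp add: z)
  finally show ?thesis by simp
qed

lemma frobenius_Const: "Const (c::'a::{field,finite}) ^ CARD('a) = Const c"
  by (metis Const_simps(7) power_card_eq_self)

text \<open>Stands in for the cyclicity of the multiplicative group: otherwise the remainder e of k
  modulo q - 1 is positive, and X^e - 1 has q - 1 roots although e < q - 1.\<close>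

lemma card_field_minus_1_dvd:
  assumes "\<And>r::'a::{field,finite}. r \<noteq> 0 \<Longrightarrow> r ^ k = 1"
  shows "(CARD('a) - 1) dvd k"
proof (rule ccontr)
  let ?n = "CARD('a) - 1"
  assume "\<not> ?n dvd k"
  then have pos: "0 < k mod ?n" by (simp add: dvd_eq_mod_eq_0)
  have n: "0 < ?n" using one_less_card_field[where ?'a = 'a] by simp
  have "r ^ (k mod ?n) = 1" if "r \<noteq> 0" for r :: 'a
  proof -
    have "r ^ ?n * r = r"
      by (metis power_card_eq_self power_minus_mult zero_less_card_finite)
    then have "r ^ ?n = 1" using that by simp
    moreover have "r ^ (?n * (k div ?n) + k mod ?n) = 1"
      unfolding mult_div_mod_eq by (rule assms[OF that])
    ultimately show ?thesis by (metis power_add power_mult power_one mult_1)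
  qed
  then have sub: "UNIV - {0::'a} \<subseteq> {r. poly (monom 1 (k mod ?n) - 1) r = 0}"
    by (auto simp: poly_monom)
  let ?P = "monom 1 (k mod ?n) - (1::'a poly)"
  have "coeff ?P (k mod ?n) = 1" using pos by simp
  then have P0: "?P \<noteq> 0" by (metis coeff_0 zero_neq_one)
  have "?n \<le> card {r. poly ?P r = 0}"
    using card_mono[OF _ sub] by (simp add: card_Diff_subset)
  also have "\<dots> \<le> degree ?P" using card_poly_roots_bound[OF P0] .
  also have "\<dots> \<le> k mod ?n" by (rule degree_diff_le) (auto intro: degree_monom_le)
  also have "\<dots> < ?n" using n by simp
  finally show False by simp
qed

section \<open>Squares and nonsquares in a field of odd order\<close>

definition nz_squares :: "'a::field set" where "nz_squares = {d ^ 2 | d. d \<noteq> 0}"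

definition nonsquares :: "'a::field set" where "nonsquares = {x. \<not> (\<exists>d. x = d ^ 2)}"

locale odd_card =
  fixes F :: "'a::{field,finite} itself"
  assumes odd: "odd CARD('a)"
begin

lemma two_neq_0: "(2::'a) \<noteq> 0"
proof
  assume "(2::'a) = 0"
  moreover obtain k where "CARD('a) = 2 * k + 1" using odd oddE by blast
  ultimately show False using of_nat_card_eq_0[where ?'a = 'a] by simp
qed

lemma four_neq_0: "(4::'a) \<noteq> 0"
  using two_neq_0 by (metis mult_eq_0_iff mult_2 numeral_Bit0)

text \<open>Squaring is two-to-one on the nonzero elements, since d and - d differ in odd
  characteristic.\<close>

lemma card_nz_squares: "2 * card (nz_squares :: 'a set) = CARD('a) - 1"
proof -
  have set: "UNIV - {0::'a} = {d. d \<noteq> 0}" by auto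
  have "{d::'a. d \<noteq> 0} = (\<Union>x\<in>nz_squares. {d. d ^ 2 = x})"
    by (auto simp: nz_squares_def)
  also have "card \<dots> = (\<Sum>x\<in>nz_squares. card {d::'a. d ^ 2 = x})"
    by (rule card_UN_disjoint) auto
  also have "\<dots> = (\<Sum>x\<in>(nz_squares :: 'a set). 2)"
  proof (rule sum.cong[OF refl])
    fix x :: 'a assume "x \<in> nz_squares"
    then obtain d where d: "d \<noteq> 0" "x = d ^ 2" by (auto simp: nz_squares_def)
    then have "{e. e ^ 2 = x} = {d, - d}" by (auto simp: power2_eq_iff)
    moreover have "d \<noteq> - d"
    proof
      assume "d = - d"
      then have "2 * d = 0" by (metis add.right_inverse mult_2)
      with d(1) two_neq_0 show False by (metis mult_eq_0_iff)
    qed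
    ultimately show "card {e. e ^ 2 = x} = 2" by simp
  qed
  finally have "card {d::'a. d \<noteq> 0} = 2 * card (nz_squares :: 'a set)" by simp
  moreover have "card {d::'a. d \<noteq> 0} = CARD('a) - 1"
    unfolding set[symmetric] by (simp add: card_Diff_subset)
  ultimately show ?thesis by simp
qed

lemma card_nonsquares: "2 * card (nonsquares :: 'a set) = CARD('a) - 1"
proof -
  have U: "(UNIV - {0} :: 'a set) = nz_squares \<union> nonsquares"
    by (auto simp: nz_squares_def nonsquares_def)
  have "card (UNIV - {0} :: 'a set) = card (nz_squares :: 'a set) + card (nonsquares :: 'a set)"
    unfolding U by (rule card_Un_disjoint) (auto simp: nz_squares_def nonsquares_def)
  then show ?thesis using card_nz_squares by (simp add: card_Diff_subset)
qed

text \<open>The forms x1 + b x2 + c x3 that split into two distinct factors on the cone; those of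
  \<open>L\<close> are irreducible there.\<close>

definition Lplus :: "('a \<times> 'a) set"
  where "Lplus = {(b, c). b ^ 2 - 4 * c \<in> nz_squares}"

lemma L_alt: "(L :: ('a \<times> 'a) set) = {(b, c). b ^ 2 - 4 * c \<in> nonsquares}"
  by (force simp: L_def nonsquares_def)

text \<open>For fixed b the discriminant takes every value exactly once, as 4 is invertible.\<close>

lemma card_disc: "card {(b, c). b ^ 2 - 4 * c \<in> S} = CARD('a) * card (S :: 'a set)"
proof -
  have "bij_betw (\<lambda>(b, c). (b, b ^ 2 - 4 * c)) {(b, c). b ^ 2 - 4 * c \<in> S} (UNIV \<times> S)"
    by (rule bij_betw_byWitness[where f' = "\<lambda>(b, y). (b, (b ^ 2 - y) / 4)"])
      (use four_neq_0 in \<open>auto simp: diff_divide_distrib\<close>)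
  then show ?thesis by (simp add: bij_betw_same_card card_cartesian_product)
qed

lemma card_L: "2 * card (L :: ('a \<times> 'a) set) = CARD('a) * (CARD('a) - 1)"
  unfolding L_alt card_disc using card_nonsquares by (metis mult.left_commute)

lemma card_Lplus: "card Lplus = card (L :: ('a \<times> 'a) set)"
  using card_nz_squares card_nonsquares unfolding L_alt Lplus_def card_disc by simp

text \<open>Makes \<open>f3\<close> a product of more than one linear form, so that its derivatives
  vanish at the origin.\<close>

lemma card_L_gt_1: "1 < card (L :: ('a \<times> 'a) set)"
proof -
  have "3 \<le> CARD('a)" using odd one_less_card_field[where ?'a = 'a] by presburger
  then have "3 * 2 \<le> CARD('a) * (CARD('a) - 1)" by (intro mult_le_mono) auto
  then show ?thesis using card_L by simp
qed

end

section \<open>Linear forms\<close>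

definition trip :: "'b \<Rightarrow> 'b \<Rightarrow> 'b \<Rightarrow> 3 \<Rightarrow> 'b"
  where "trip x y z i = (if i = 1 then x else if i = 2 then y else z)"

lemma trip_simps [simp]: "trip x y z 1 = x" "trip x y z 2 = y" "trip x y z 3 = z"
  by (simp_all add: trip_def)

lemma trip_eqI: "f 1 = x \<Longrightarrow> f 2 = y \<Longrightarrow> f 3 = z \<Longrightarrow> f = trip x y z"
  by (rule ext) (metis exhaust_3 trip_simps)

definition lin :: "'a::comm_ring_1 \<Rightarrow> 'a \<Rightarrow> 'a \<Rightarrow> 'a mpoly3"
  where "lin a b c = Const a * xvar 1 + Const b * xvar 2 + Const c * xvar 3"

lemma subst_lin: "subst \<sigma> (lin a b c) = Const a * \<sigma> 1 + Const b * \<sigma> 2 + Const c * \<sigma> 3"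
  by (simp add: lin_def subst_hom)

lemma xvar_lin: "xvar 1 = lin 1 0 0" "xvar 2 = lin 0 1 0" "xvar 3 = lin 0 0 1"
  by (simp_all add: lin_def Const_simps)

lemma lin_eq_iff [simp]: "lin a b c = lin a' b' c' \<longleftrightarrow> a = a' \<and> b = b' \<and> c = c'"
proof
  assume "lin a b c = lin a' b' c'"
  then have "subst \<sigma> (lin a b c) = subst \<sigma> (lin a' b' c')" for \<sigma> by simp
  from this[of "trip 1 0 0"] this[of "trip 0 1 0"] this[of "trip 0 0 1"]
  show "a = a' \<and> b = b' \<and> c = c'" by (simp add: subst_lin)
qed simp

lemma lin_eq_0_iff [simp]: "lin a b c = 0 \<longleftrightarrow> a = 0 \<and> b = 0 \<and> c = (0::'a::comm_ring_1)"
proof -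
  have "lin 0 0 0 = (0::'a mpoly3)" by (simp add: lin_def Const_simps)
  then show ?thesis using lin_eq_iff[of a b c 0 0 0] by simp
qed

lemma lin_0 [simp]: "lin 0 0 0 = 0"
  by (simp add: lin_def Const_simps)

lemma const_term_lin [simp]: "const_term (lin a b c) = 0"
  by (simp add: lin_def const_term_hom)

lemma Const_mult_lin: "Const k * lin a b c = lin (k * a) (k * b) (k * c)"
  by (simp add: lin_def Const_simps algebra_simps)

lemma tdeg_lin:
  fixes a b c :: "'a::field"
  assumes "lin a b c \<noteq> 0"
  shows "tdeg (lin a b c) = 1"
proof -
  have "tdeg (lin a b c) \<noteq> 0"
    using tdeg_eq_0[of "lin a b c"] assms by (auto simp: Const_simps)
  moreover have "tdeg (lin a b c) \<le> 1" unfolding lin_def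
    by (intro tdeg_add_le) (auto intro: order.trans[OF tdeg_mult_le])
  ultimately show ?thesis by simp
qed

text \<open>One linear form for each point of the projective plane: the first nonzero coefficient is
  1, so different members are not proportional.\<close>

definition normalized :: "('a::field \<times> 'a \<times> 'a) set"
  where "normalized = range (\<lambda>(b, c). (1, b, c)) \<union> range (\<lambda>c. (0, 1, c)) \<union> {(0, 0, 1)}"

fun lin3 :: "'a::comm_ring_1 \<times> 'a \<times> 'a \<Rightarrow> 'a mpoly3"
  where "lin3 (a, b, c) = lin a b c"

text \<open>For a normalized triple this is the restriction to the plane where the form vanishes,
  obtained by solving for the variable with the leading coefficient 1.\<close>

fun kill :: "'a::field \<times> 'a \<times> 'a \<Rightarrow> 3 \<Rightarrow> 'a mpoly3"
  where "kill (a, b, c) = (if a \<noteq> 0 then trip (lin 0 (- b) (- c)) (xvar 2) (xvar 3)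
    else if b \<noteq> 0 then trip (xvar 1) (lin 0 0 (- c)) (xvar 3) else trip (xvar 1) (xvar 2) 0)"

lemma lin_add: "lin a b c + lin a' b' c' = lin (a + a') (b + b') (c + c')"
  and lin_diff: "lin a b c - lin a' b' c' = lin (a - a') (b - b') (c - c')"
  and lin_minus: "- lin a b c = lin (- a) (- b) (- c)"
  by (simp_all add: lin_def Const_simps algebra_simps)

lemma subst_kill_lin3_eq_0_iff:
  assumes "t \<in> normalized" "t' \<in> normalized"
  shows "subst (kill t) (lin3 t') = 0 \<longleftrightarrow> t = t'"
  using assms
  by (auto simp: normalized_def subst_lin xvar_lin Const_mult_lin lin_add)

lemma lin3_dvd_minus_subst_kill:
  assumes "t \<in> normalized"
  shows "lin3 t dvd p - subst (kill t) p"
proof (rule dvd_minus_subst)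
  fix i :: 3
  show "lin3 t dvd xvar i - kill t i"
    using assms exhaust_3[of i] by (auto simp: normalized_def xvar_lin lin_diff)
qed

text \<open>Divisibility by a linear form becomes vanishing under a ring homomorphism into a domain;
  in this way the form acts as a prime.\<close>

lemma lin3_dvd_iff:
  assumes "t \<in> normalized"
  shows "lin3 t dvd p \<longleftrightarrow> subst (kill t) p = 0"
proof
  assume "lin3 t dvd p"
  then show "subst (kill t) p = 0"
    using subst_kill_lin3_eq_0_iff[OF assms assms] by (auto simp: subst_hom elim!: dvdE)
next
  assume "subst (kill t) p = 0"
  then show "lin3 t dvd p" using lin3_dvd_minus_subst_kill[OF assms, of p] by simp
qed

text \<open>The forms are divided out one at a time: restriction to the plane of one form does not
  annihilate another, so the quotient is still divisible by the remaining ones.\<close>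

lemma prod_lin3_dvd:
  assumes "finite S" "S \<subseteq> normalized" "\<And>t. t \<in> S \<Longrightarrow> lin3 t dvd p"
  shows "(\<Prod>t\<in>S. lin3 t) dvd p"
  using assms
proof (induction S arbitrary: p)
  case (insert t S)
  then obtain r where r: "p = lin3 t * r" by (meson dvdE insertI1)
  have "lin3 t' dvd r" if "t' \<in> S" for t'
  proof -
    have n: "t' \<in> normalized" "t \<in> normalized" "t' \<noteq> t" using insert that by auto
    have "subst (kill t') (lin3 t * r) = 0"
      using insert.prems(2)[of t'] that r n lin3_dvd_iff by blast
    moreover have "subst (kill t') (lin3 t) \<noteq> 0" using n subst_kill_lin3_eq_0_iff by blast
    ultimately have "subst (kill t') r = 0" by (simp add: subst_hom)
    then show ?thesis using n lin3_dvd_iff by blast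
  qed
  then have "(\<Prod>t\<in>S. lin3 t) dvd r" using insert by auto
  then show ?case using insert r by (simp add: mult_dvd_mono)
qed simp

lemma lin3_neq_0: "t \<in> normalized \<Longrightarrow> lin3 t \<noteq> 0"
  by (auto simp: normalized_def)

lemma tdeg_prod_lin3:
  assumes "S \<subseteq> normalized"
  shows "tdeg (\<Prod>t\<in>S. lin3 t) = card S"
proof -
  have "tdeg (lin3 t) = 1" if "t \<in> S" for t
    using lin3_neq_0[of t] that assms by (metis lin3.elims subsetD tdeg_lin)
  moreover have "lin3 t \<noteq> 0" if "t \<in> S" for t using that assms lin3_neq_0 by blast
  ultimately show ?thesis by (simp add: tdeg_prod del: lin3.simps)
qed

lemma frobenius_lin:
  fixes a b c :: "'a::{field,finite}"
  shows "lin a b c ^ CARD('a) =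
    Const a * xvar 1 ^ CARD('a) + Const b * xvar 2 ^ CARD('a) + Const c * xvar 3 ^ CARD('a)"
  by (simp add: lin_def frobenius_add power_mult_distrib frobenius_Const)

section \<open>The action on polynomials\<close>

text \<open>The substitution induced by conjugation with the matrix with rows (a, b) and (c, d).
  It is the symmetric square of the standard representation.\<close>

definition rho :: "'a::comm_ring_1 \<Rightarrow> 'a \<Rightarrow> 'a \<Rightarrow> 'a \<Rightarrow> 3 \<Rightarrow> 'a mpoly3"
  where "rho a b c d = trip (lin (a ^ 2) (2 * a * b) (b ^ 2)) (lin (a * c) (a * d + b * c) (b * d))
    (lin (c ^ 2) (2 * c * d) (d ^ 2))"

definition invariants :: "'a::comm_ring_1 mpoly3 set"
  where "invariants = {p. \<forall>a b c d. a * d - b * c = 1 \<longrightarrow> subst (rho a b c d) p = p}"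

lemma subst_rho_lin:
  "subst (rho a b c d) (lin x y z) =
    lin (x * a ^ 2 + y * (a * c) + z * c ^ 2) (x * (2 * a * b) + y * (a * d + b * c) + z * (2 * c * d))
      (x * b ^ 2 + y * (b * d) + z * d ^ 2)"
  by (simp add: subst_lin rho_def Const_mult_lin lin_add)

text \<open>Substitution is a right action, so the matrix of the inner substitution comes first in
  the product.\<close>

lemma subst_rho_rho:
  "subst (rho a b c d) (subst (rho a' b' c' d') p) =
    subst (rho (a' * a + b' * c) (a' * b + b' * d) (c' * a + d' * c) (c' * b + d' * d)) p"
proof -
  have "(\<lambda>i. subst (rho a b c d) (rho a' b' c' d' i)) =
      rho (a' * a + b' * c) (a' * b + b' * d) (c' * a + d' * c) (c' * b + d' * d)"
    unfolding rho_def[of "a' * a + b' * c"]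
    by (rule trip_eqI; simp only: rho_def[of a'] trip_simps subst_rho_lin lin_eq_iff)
      (auto simp: power2_eq_square algebra_simps)
  then show ?thesis by (simp add: subst_subst)
qed

lemma invariantsD: "p \<in> invariants \<Longrightarrow> a * d - b * c = 1 \<Longrightarrow> subst (rho a b c d) p = p"
  by (simp add: invariants_def)

lemma invariants_ring:
  "Const k \<in> invariants"
  "p \<in> invariants \<Longrightarrow> r \<in> invariants \<Longrightarrow> p + r \<in> invariants"
  "p \<in> invariants \<Longrightarrow> r \<in> invariants \<Longrightarrow> p - r \<in> invariants"
  "p \<in> invariants \<Longrightarrow> r \<in> invariants \<Longrightarrow> p * r \<in> invariants"
  by (auto simp: invariants_def subst_hom)

lemma invariants_cancel:
  fixes p r :: "'a::field mpoly3"
  assumes "p * r \<in> invariants" "p \<in> invariants" "p \<noteq> 0"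
  shows "r \<in> invariants"
proof -
  have "subst (rho a b c d) r = r" if "a * d - b * c = 1" for a b c d :: 'a
  proof -
    have "p * subst (rho a b c d) r = p * r"
      using invariantsD[OF assms(1) that] invariantsD[OF assms(2) that] by (simp add: subst_hom)
    then show ?thesis using assms(3) by simp
  qed
  then show ?thesis by (simp add: invariants_def)
qed

text \<open>The special linear group is generated by its unipotent upper and lower triangular elements.\<close>

lemma invariants_unipotentI:
  fixes p :: "'a::field mpoly3"
  assumes up: "\<And>t. subst (rho 1 t 0 1) p = p" and low: "\<And>t. subst (rho 1 0 t 1) p = p"
  shows "p \<in> invariants"
proof -
  have nz: "subst (rho a b c d) p = p" if "a * d - b * c = 1" "c \<noteq> 0" for a b c d :: 'a
  proof -
    \<comment> \<open>For nonzero c the matrix is a product of upper, lower and upper unipotent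
      matrices with parameters r, c, s. The diagonal entries determine r and s, and the determinant
      then determines b.\<close>
    define r s where "r = (a - 1) / c" and "s = (d - 1) / c"
    have ad: "a = 1 + c * r" "d = 1 + c * s" using that(2) by (simp_all add: r_def s_def)
    have "c * b = c * (r + s + c * r * s)" using that(1) unfolding ad by algebra
    then have b: "b = r + s + c * r * s" using that(2) by simp
    have "p = subst (rho 1 s 0 1) (subst (rho 1 0 c 1) (subst (rho 1 r 0 1) p))"
      by (simp add: up low)
    also have "\<dots> = subst (rho a b c d) p"
      unfolding ad b by (simp add: subst_rho_rho algebra_simps)
    finally show ?thesis by simp
  qed
  have "subst (rho a b c d) p = p" if det: "a * d - b * c = 1" for a b c d :: 'a
  proof (cases "c = 0")
    case True
    then have "d \<noteq> 0" using det by auto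
    \<comment> \<open>Here a is nonzero, and a lower unipotent factor adds it to the vanishing
      corner.\<close>
    have "subst (rho a b c d) p = subst (rho a b c d) (subst (rho 1 0 1 1) p)" by (simp add: low)
    also have "\<dots> = subst (rho a b (a + c) (b + d)) p" by (simp add: subst_rho_rho)
    also have "\<dots> = p"
      using det True by (intro nz) (auto simp: algebra_simps)
    finally show ?thesis .
  qed (use nz det in auto)
  then show ?thesis by (simp add: invariants_def)
qed

section \<open>The reflection and parity\<close>

abbreviation flip2 :: "3 \<Rightarrow> 'a::comm_ring_1 mpoly3"
  where "flip2 \<equiv> trip (xvar 1) (- xvar 2) (xvar 3)"

definition even_poly :: "'a::comm_ring_1 mpoly3 \<Rightarrow> bool"
  where "even_poly p \<longleftrightarrow> subst flip2 p = p"

definition odd_poly :: "'a::comm_ring_1 mpoly3 \<Rightarrow> bool"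
  where "odd_poly p \<longleftrightarrow> subst flip2 p = - p"

lemma subst_flip2_lin: "subst flip2 (lin a b c) = lin a (- b) c"
  by (simp add: subst_lin, simp add: lin_def Const_simps)

lemma subst_flip2_flip2: "subst flip2 (subst flip2 p) = p"
proof -
  have "(\<lambda>i. subst flip2 (flip2 i)) = (xvar :: 3 \<Rightarrow> 'a mpoly3)"
    by (rule ext) (metis (no_types, lifting) exhaust_3 subst_hom(5) trip_simps subst_xvar minus_minus)
  then show ?thesis by (simp add: subst_subst subst_xvar_id)
qed

text \<open>The reflection is induced by diag(1, -1). Conjugation with that matrix negates the
  off-diagonal entries b and c and preserves the determinant.\<close>

lemma flip2_invariants:
  assumes "p \<in> invariants"
  shows "subst flip2 p \<in> invariants"
proof -
  have "subst (rho a b c d) (subst flip2 p) = subst flip2 p" if "a * d - b * c = 1" for a b c d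
  proof -
    have "(\<lambda>i. subst (rho a b c d) (flip2 i)) = (\<lambda>i. subst flip2 (rho a (- b) (- c) d i))"
      (is "?l = ?r")
    proof -
      have "?r = trip (?l 1) (?l 2) (?l 3)"
        by (rule trip_eqI) (simp_all add: rho_def subst_flip2_lin subst_hom lin_minus)
      moreover have "?l = trip (?l 1) (?l 2) (?l 3)" by (rule trip_eqI) (rule refl)+
      ultimately show ?thesis by (rule trans[OF _ sym, rotated])
    qed
    then have "subst (rho a b c d) (subst flip2 p) = subst flip2 (subst (rho a (- b) (- c) d) p)"
      by (simp add: subst_subst)
    also have "\<dots> = subst flip2 p" using that by (simp add: invariantsD[OF assms])
    finally show ?thesis .
  qed
  then show ?thesis by (simp add: invariants_def)
qed

lemma even_poly_closed:
  "even_poly (Const k)"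
  "even_poly p \<Longrightarrow> even_poly r \<Longrightarrow> even_poly (p + r)"
  "even_poly p \<Longrightarrow> even_poly r \<Longrightarrow> even_poly (p - r)"
  "even_poly p \<Longrightarrow> even_poly r \<Longrightarrow> even_poly (p * r)"
  "odd_poly p \<Longrightarrow> odd_poly r \<Longrightarrow> even_poly (p * r)"
  "odd_poly p \<Longrightarrow> odd_poly r \<Longrightarrow> odd_poly (p + r)"
  "odd_poly p \<Longrightarrow> odd_poly r \<Longrightarrow> odd_poly (p - r)"
  "odd_poly p \<Longrightarrow> even_poly r \<Longrightarrow> odd_poly (p * r)"
  "even_poly p \<Longrightarrow> odd_poly r \<Longrightarrow> odd_poly (p * r)"
  by (simp_all add: even_poly_def odd_poly_def subst_hom)

lemma partial_flip2:
  "subst flip2 (partial 1 p) = partial 1 (subst flip2 p)"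
  "subst flip2 (partial 2 p) = - partial 2 (subst flip2 p)"
  "subst flip2 (partial 3 p) = partial 3 (subst flip2 p)"
  by (simp_all add: chain_rule sum_3 partial_xvar partial_uminus)

lemma even_poly_partial:
  "even_poly p \<Longrightarrow> even_poly (partial 1 p)" "even_poly p \<Longrightarrow> odd_poly (partial 2 p)"
  "even_poly p \<Longrightarrow> even_poly (partial 3 p)"
  by (simp_all add: even_poly_def odd_poly_def partial_flip2)

section \<open>Invariance and parity of the three basic polynomials\<close>

lemma f3_lin: "f3 = (\<Prod>(b, c)\<in>L. lin 1 b c)"
  by (simp add: f3_def lin_def Const_simps)

context odd_card
begin

lemma subst_f1: "subst (rho a b c d) (f1 :: 'a mpoly3) = Const ((a * d - b * c) ^ 2) * f1"
proof -
  let ?C = "Const :: 'a \<Rightarrow> 'a mpoly3"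
  have "subst (rho a b c d) (f1 :: 'a mpoly3) = (?C a ^ 2 * xvar 1 + 2 * ?C a * ?C b * xvar 2 + ?C b ^ 2 * xvar 3)
      * (?C c ^ 2 * xvar 1 + 2 * ?C c * ?C d * xvar 2 + ?C d ^ 2 * xvar 3)
      - (?C a * ?C c * xvar 1 + (?C a * ?C d + ?C b * ?C c) * xvar 2 + ?C b * ?C d * xvar 3) ^ 2"
    by (simp add: f1_def subst_hom rho_def lin_def Const_simps)
  also have "\<dots> = (?C a * ?C d - ?C b * ?C c) ^ 2 * f1" unfolding f1_def by algebra
  finally show ?thesis by (simp add: Const_simps)
qed

text \<open>The q-th power of a linear form over F has the same coefficients in the x_i^q, so both
  arguments of the polar form are transformed by the same matrix.\<close>

lemma subst_f2: "subst (rho a b c d) (f2 :: 'a mpoly3) = Const ((a * d - b * c) ^ 2) * f2"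
proof -
  let ?C = "Const :: 'a \<Rightarrow> 'a mpoly3" and ?q = "CARD('a)"
  let ?y = "\<lambda>i. xvar i ^ ?q :: 'a mpoly3"
  have "subst (rho a b c d) (f2 :: 'a mpoly3)
      = lin (a ^ 2) (2 * a * b) (b ^ 2) ^ ?q * lin (c ^ 2) (2 * c * d) (d ^ 2)
        + lin (a ^ 2) (2 * a * b) (b ^ 2) * lin (c ^ 2) (2 * c * d) (d ^ 2) ^ ?q
        - 2 * (lin (a * c) (a * d + b * c) (b * d) ^ ?q * lin (a * c) (a * d + b * c) (b * d))"
    by (simp add: f2_def subst_hom rho_def)
  also have "\<dots> = (?C a ^ 2 * ?y 1 + 2 * ?C a * ?C b * ?y 2 + ?C b ^ 2 * ?y 3)
      * (?C c ^ 2 * xvar 1 + 2 * ?C c * ?C d * xvar 2 + ?C d ^ 2 * xvar 3)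
      + (?C a ^ 2 * xvar 1 + 2 * ?C a * ?C b * xvar 2 + ?C b ^ 2 * xvar 3)
      * (?C c ^ 2 * ?y 1 + 2 * ?C c * ?C d * ?y 2 + ?C d ^ 2 * ?y 3)
      - 2 * ((?C a * ?C c * ?y 1 + (?C a * ?C d + ?C b * ?C c) * ?y 2 + ?C b * ?C d * ?y 3)
        * (?C a * ?C c * xvar 1 + (?C a * ?C d + ?C b * ?C c) * xvar 2 + ?C b * ?C d * xvar 3))"
    unfolding frobenius_lin by (simp add: lin_def Const_simps)
  also have "\<dots> = (?C a * ?C d - ?C b * ?C c) ^ 2 * (?y 1 * xvar 3 + xvar 1 * ?y 3 - 2 * (?y 2 * xvar 2))"
    by algebra
  finally show ?thesis by (simp add: Const_simps f2_def mult.commute)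
qed

lemma f1_invariant: "(f1 :: 'a mpoly3) \<in> invariants"
  and f2_invariant: "(f2 :: 'a mpoly3) \<in> invariants"
  by (simp_all add: invariants_def subst_f1 subst_f2 Const_simps)

lemma zero_notin_nonsquares: "(0::'a) \<notin> nonsquares"
  by (auto simp: nonsquares_def intro: exI[of _ 0])

lemma nonsquares_mult_square:
  assumes "e \<noteq> (0::'a)"
  shows "x / e ^ 2 \<in> nonsquares \<longleftrightarrow> x \<in> nonsquares"
proof -
  have "x / e ^ 2 = d ^ 2 \<longleftrightarrow> x = (d * e) ^ 2" for d
    using assms by (simp add: power_mult_distrib field_simps)
  moreover have "(\<exists>d. x = (d * e) ^ 2) \<longleftrightarrow> (\<exists>d. x = d ^ 2)"
    using assms by (metis nonzero_eq_divide_eq)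
  ultimately show ?thesis by (simp only: nonsquares_def mem_Collect_eq)
qed

text \<open>A zero would exhibit the discriminant as the square of b + 2 c t.\<close>

lemma L_value_neq_0:
  assumes "(b, c) \<in> (L :: ('a \<times> 'a) set)"
  shows "1 + b * t + c * t ^ 2 \<noteq> 0" "c \<noteq> 0"
proof -
  have ns: "b ^ 2 - 4 * c \<in> nonsquares" using assms by (simp add: L_alt)
  show "c \<noteq> 0" using assms by (simp add: L_def)
  show "1 + b * t + c * t ^ 2 \<noteq> 0"
  proof
    assume 0: "1 + b * t + c * t ^ 2 = 0"
    have "b ^ 2 - 4 * c = (b + 2 * c * t) ^ 2 - 4 * c * (1 + b * t + c * t ^ 2)"
      by algebra
    then have "b ^ 2 - 4 * c = (b + 2 * c * t) ^ 2" by (simp add: 0)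
    with ns show False by (auto simp: nonsquares_def)
  qed
qed

text \<open>The coefficients change as those of T^2 + b T + c under T -> T + t. This preserves the
  discriminant and hence permutes \<open>L\<close>.\<close>

lemma f3_upper: "subst (rho 1 t 0 1) (f3 :: 'a mpoly3) = f3"
proof -
  have "subst (rho 1 t 0 1) (f3 :: 'a mpoly3) =
      (\<Prod>(b, c)\<in>L. lin 1 (2 * t + b) (t ^ 2 + b * t + c))"
    by (simp add: f3_lin subst_hom subst_rho_lin case_prod_beta)
  also have "\<dots> = (\<Prod>(b, c)\<in>L. lin 1 b c)"
    by (rule prod.reindex_bij_witness[where
        i = "\<lambda>(b, c). (b - 2 * t, t ^ 2 - b * t + c)" and j = "\<lambda>(b, c). (2 * t + b, t ^ 2 + b * t + c)"])
      (auto simp: L_alt power2_eq_square algebra_simps)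
  finally show ?thesis by (simp add: f3_lin)
qed

text \<open>In contrast to \<open>f3_upper\<close>, the leading coefficients turn into e = 1 + b t +
  c t^2 and have to be normalized to 1 again. The point is that the product of all e over
  \<open>L\<close> is 1.\<close>

lemma f3_lower: "subst (rho 1 0 t 1) (f3 :: 'a mpoly3) = f3"
proof -
  let ?e = "\<lambda>b c. 1 + b * t + c * t ^ 2"
  define J where "J t = (\<lambda>(b, c). ((b + 2 * c * t) / (1 + b * t + c * t ^ 2), c / (1 + b * t + c * t ^ 2)))"
    for t :: 'a
  \<comment> \<open>Dividing the coefficients by e divides the discriminant by the square of
    e.\<close>
  have J_L: "J t x \<in> L" if "x \<in> L" for x t
  proof -
    obtain b c where x: "x = (b, c)" by (cases x)
    let ?e = "1 + b * t + c * t ^ 2"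
    have e: "?e \<noteq> 0" using L_value_neq_0 that x by blast
    have eq: "(b + 2 * c * t) ^ 2 - 4 * c * ?e = b ^ 2 - 4 * c" by algebra
    have "((b + 2 * c * t) / ?e) ^ 2 - 4 * (c / ?e) = ((b + 2 * c * t) ^ 2 - 4 * c * ?e) / ?e ^ 2"
      using e by (simp add: power_divide diff_divide_distrib power2_eq_square)
    then show ?thesis
      using that x nonsquares_mult_square[OF e] by (simp add: J_def L_alt eq)
  qed
  have J_J: "J (- t) (J t x) = x" if "x \<in> L" for x t
  proof -
    obtain b c where x: "x = (b, c)" by (cases x)
    let ?e = "1 + b * t + c * t ^ 2"
    have e: "?e \<noteq> 0" using L_value_neq_0 that x by blast
    have 1: "1 + (b + 2 * c * t) / ?e * - t + c / ?e * (- t) ^ 2 = 1 / ?e"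
      using e by (simp add: divide_simps) algebra
    have 2: "(b + 2 * c * t) / ?e + 2 * (c / ?e) * - t = b / ?e"
      using e by (simp add: divide_simps)
    have "J (- t) (J t x) = (b / ?e / (1 / ?e), c / ?e / (1 / ?e))"
      by (simp only: x J_def case_prod_conv 1 2)
    then show ?thesis using e x by simp
  qed
  have reindex: "(\<Prod>x\<in>L. h (J t x)) = (\<Prod>x\<in>L. h x)" for h :: "'a \<times> 'a \<Rightarrow> 'a mpoly3"
    by (rule prod.reindex_bij_witness[where i = "J (- t)" and j = "J t"])
      (use J_L J_J[of _ t] J_J[of _ "- t"] in auto)
  \<comment> \<open>Write c = e (c / e). Since c / e is the last coefficient after the permutation
    \<open>J t\<close>, the product of all c cancels, leaving 1 as the product of all e.\<close>
  have "(\<Prod>(b, c)\<in>L. Const c) = (\<Prod>(b, c)\<in>L. Const (?e b c) * Const (c / ?e b c :: 'a))"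
    by (rule prod.cong) (use L_value_neq_0 in \<open>auto simp flip: Const_simps\<close>)
  also have "\<dots> = (\<Prod>(b, c)\<in>L. Const (?e b c)) * (\<Prod>x\<in>L. (\<lambda>(b, c). Const c) (J t x))"
    by (simp add: case_prod_beta prod.distrib J_def)
  finally have "(\<Prod>(b, c)\<in>L. Const c) * (\<Prod>(b, c)\<in>L. Const (?e b c)) = (\<Prod>(b, c)\<in>L. Const (c :: 'a)) * 1"
    unfolding reindex by (simp add: mult.commute)
  moreover have "(\<Prod>(b, c)\<in>L. Const (c :: 'a)) \<noteq> 0" using L_value_neq_0 by auto
  ultimately have e1: "(\<Prod>(b, c)\<in>L. Const (?e b c)) = 1" by (simp only: mult_cancel_left) auto
  have "subst (rho 1 0 t 1) (f3 :: 'a mpoly3) = (\<Prod>(b, c)\<in>L. lin (?e b c) (b + 2 * c * t) c)"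
    by (simp add: f3_lin subst_hom subst_rho_lin case_prod_beta algebra_simps)
  also have "\<dots> = (\<Prod>x\<in>L. (\<lambda>(b, c). Const (?e b c)) x * (\<lambda>(b, c). lin 1 b c) (J t x))"
    by (rule prod.cong) (use L_value_neq_0 in \<open>auto simp: J_def Const_mult_lin\<close>)
  also have "\<dots> = (\<Prod>(b, c)\<in>L. lin 1 b c)"
    unfolding prod.distrib reindex e1 by simp
  finally show ?thesis by (simp add: f3_lin)
qed

lemma f3_invariant: "(f3 :: 'a mpoly3) \<in> invariants"
  by (intro invariants_unipotentI f3_upper f3_lower)

lemma even_f1: "even_poly (f1 :: 'a mpoly3)"
  by (simp add: even_poly_def f1_def subst_hom)

lemma even_f2: "even_poly (f2 :: 'a mpoly3)"
  using odd by (simp add: even_poly_def f2_def subst_hom)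

lemma even_f3: "even_poly (f3 :: 'a mpoly3)"
proof -
  have "subst flip2 (f3 :: 'a mpoly3) = (\<Prod>(b, c)\<in>L. lin 1 (- b) c)"
    by (simp add: f3_lin subst_hom subst_flip2_lin case_prod_beta)
  also have "\<dots> = (\<Prod>(b, c)\<in>L. lin 1 b c)"
    by (rule prod.reindex_bij_witness[where i = "\<lambda>(b, c). (- b, c)" and j = "\<lambda>(b, c). (- b, c)"])
      (auto simp: L_alt)
  finally show ?thesis by (simp add: even_poly_def f3_lin)
qed

end

section \<open>The Jacobian determinant\<close>

definition fs :: "3 \<Rightarrow> 'a::{field,finite} mpoly3"
  where "fs = trip f1 f2 f3"

lemma partial_f1:
  "partial 1 f1 = xvar 3" "partial 2 f1 = - 2 * xvar 2" "partial 3 f1 = xvar 1"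
  by (simp_all add: f1_def partial_diff partial_mult partial_power partial_xvar)

lemma partial_f2:
  "partial 1 (f2 :: 'a::{field,finite} mpoly3) = xvar 3 ^ CARD('a)"
  "partial 2 (f2 :: 'a mpoly3) = - 2 * xvar 2 ^ CARD('a)"
  "partial 3 (f2 :: 'a mpoly3) = xvar 1 ^ CARD('a)"
  by (simp_all add: f2_def partial_diff partial_add partial_mult partial_power partial_xvar of_nat_card_mpoly3)

lemma f4_eq:
  "(f4 :: 'a::{field,finite} mpoly3) =
    2 * (xvar 1 * xvar 2 ^ CARD('a) - xvar 2 * xvar 1 ^ CARD('a)) * partial 1 f3
    + (xvar 1 * xvar 3 ^ CARD('a) - xvar 3 * xvar 1 ^ CARD('a)) * partial 2 f3
    + 2 * (xvar 2 * xvar 3 ^ CARD('a) - xvar 3 * xvar 2 ^ CARD('a)) * partial 3 f3"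
  by (simp add: f4_def det_3 partial_f1 partial_f2 algebra_simps)

context odd_card
begin

lemma odd_f4: "odd_poly (f4 :: 'a mpoly3)"
  unfolding f4_eq
  using even_poly_partial[OF even_f3] odd
  by (simp add: even_poly_def odd_poly_def subst_hom algebra_simps)

definition other_factors :: "'a \<times> 'a \<Rightarrow> 'a mpoly3"
  where "other_factors x = (\<Prod>(b, c)\<in>L - {x}. lin 1 b c)"

lemma partial_lin:
  "partial 1 (lin a b c) = Const a" "partial 2 (lin a b c) = Const b" "partial 3 (lin a b c) = Const c"
  by (simp_all add: lin_def partial_add partial_mult partial_xvar)

lemma partial_f3:
  "partial 1 (f3 :: 'a mpoly3) = (\<Sum>x\<in>L. other_factors x)"
  "partial 2 (f3 :: 'a mpoly3) = (\<Sum>x\<in>L. Const (fst x) * other_factors x)"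
  "partial 3 (f3 :: 'a mpoly3) = (\<Sum>x\<in>L. Const (snd x) * other_factors x)"
  by (simp_all add: f3_lin partial_prod other_factors_def case_prod_beta partial_lin Const_simps)

lemma tdeg_other_factors: "x \<in> L \<Longrightarrow> tdeg (other_factors x) = card (L :: ('a \<times> 'a) set) - 1"
  unfolding other_factors_def by (subst tdeg_prod) (auto simp: case_prod_beta tdeg_lin card_Diff_singleton)

text \<open>The minors formed from the gradients of \<open>f1\<close> and \<open>f2\<close>
  contribute q + 1, the gradient of \<open>f3\<close> one less than its degree. The bound is the
  number of \<open>plus_lines\<close>.\<close>

lemma tdeg_f4: "tdeg (f4 :: 'a mpoly3) \<le> CARD('a) + card (L :: ('a \<times> 'a) set)"
proof -
  let ?q = "CARD('a)" and ?l = "card (L :: ('a \<times> 'a) set)"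
  have d: "tdeg (\<Sum>x\<in>L. Const (h x) * other_factors x) \<le> ?l - 1" for h :: "'a \<times> 'a \<Rightarrow> 'a"
    by (rule tdeg_sum_le) (auto intro!: order.trans[OF tdeg_mult_le] simp: tdeg_other_factors)
  have p: "tdeg (xvar i * xvar j ^ ?q - xvar j * xvar i ^ ?q :: 'a mpoly3) \<le> 1 + ?q" for i j
    by (intro tdeg_diff_le; rule order.trans[OF tdeg_mult_le]) (simp_all add: tdeg_power)
  have m: "tdeg (r * s) \<le> ?q + ?l" if "tdeg r \<le> 1 + ?q" "tdeg s \<le> ?l - 1" for r s :: "'a mpoly3"
    using tdeg_mult_le[of r s] that card_L_gt_1 by linarith
  have m2: "tdeg (2 * r :: 'a mpoly3) \<le> n" if "tdeg r \<le> n" for r n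
    using tdeg_mult_le[of 2 r] that by simp
  show ?thesis
    unfolding f4_eq partial_f3
    using d[of "\<lambda>_. 1"] d[of fst] d[of snd]
    by (intro tdeg_add_le m m2 p) (simp_all add: Const_simps)
qed

lemma power_card_minus_self_neq_0: "xvar i ^ CARD('a) - xvar i \<noteq> (0 :: 'a mpoly3)"
proof
  assume "xvar i ^ CARD('a) - xvar i = (0 :: 'a mpoly3)"
  then have "tdeg (xvar i ^ CARD('a) :: 'a mpoly3) = tdeg (xvar i :: 'a mpoly3)" by simp
  then show False using one_less_card_field[where ?'a = 'a] by (simp add: tdeg_power)
qed

lemma skew_neq_0:
  assumes "i \<noteq> j"
  shows "xvar i * xvar j ^ CARD('a) - xvar j * xvar i ^ CARD('a) \<noteq> (0 :: 'a mpoly3)"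
proof
  assume "xvar i * xvar j ^ CARD('a) - xvar j * xvar i ^ CARD('a) = (0 :: 'a mpoly3)"
  then have "subst (xvar(i := 1)) (xvar i * xvar j ^ CARD('a) - xvar j * xvar i ^ CARD('a)) = (0 :: 'a mpoly3)"
    by (simp add: subst_hom)
  then show False using assms power_card_minus_self_neq_0[of j] by (simp add: subst_hom)
qed

text \<open>On the plane of one factor of \<open>f3\<close> a single summand of its gradient
  survives. The determinant becomes 4 c - b^2 times the nonzero product of the other factors times
  x2 x3^q - x3 x2^q, and nonsquares are nonzero.\<close>

lemma f4_neq_0: "f4 \<noteq> (0 :: 'a mpoly3)"
proof
  let ?q = "CARD('a)"
  obtain b c where bc: "(b, c) \<in> (L :: ('a \<times> 'a) set)"
    using card_L_gt_1 by (metis card.empty ex_in_conv not_less_zero surj_pair)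
  define \<sigma> where "\<sigma> = kill (1, b, c)"
  have \<sigma>: "\<sigma> 1 = lin 0 (- b) (- c)" "\<sigma> 2 = xvar 2" "\<sigma> 3 = xvar 3" by (simp_all add: \<sigma>_def)
  have n: "(1, x, y) \<in> normalized" for x y :: 'a by (auto simp: normalized_def)
  have "subst \<sigma> (other_factors x) = 0" if "x \<in> L" "x \<noteq> (b, c)" for x
  proof -
    have "subst \<sigma> (lin 1 b c) = 0"
      using subst_kill_lin3_eq_0_iff[OF n n, of b c b c] by (simp add: \<sigma>_def)
    moreover have "(b, c) \<in> L - {x}" using bc that by auto
    ultimately show ?thesis
      unfolding other_factors_def subst_hom prod_zero_iff[OF finite] by (metis (no_types, lifting) case_prod_conv)
  qed
  then have sum: "(\<Sum>x\<in>L. Const (h x) * subst \<sigma> (other_factors x)) = Const (h (b, c)) * subst \<sigma> (other_factors (b, c))"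
    for h :: "'a \<times> 'a \<Rightarrow> 'a"
    using bc by (subst sum.mono_neutral_right[of L "{(b, c)}"]) auto
  let ?D = "subst \<sigma> (other_factors (b, c))"
  have D: "?D \<noteq> 0"
    unfolding other_factors_def subst_hom \<sigma>_def
    using subst_kill_lin3_eq_0_iff[OF n n, of b c] by (auto simp: prod_zero_iff)
  let ?B = "Const b :: 'a mpoly3" and ?C = "Const c :: 'a mpoly3"
  let ?x2 = "xvar 2 :: 'a mpoly3" and ?x3 = "xvar 3 :: 'a mpoly3"
  have p: "subst \<sigma> (partial 1 f3) = ?D" "subst \<sigma> (partial 2 f3) = ?B * ?D" "subst \<sigma> (partial 3 f3) = ?C * ?D"
    unfolding partial_f3 using sum[of "\<lambda>_. 1"] sum[of fst] sum[of snd] by (simp_all add: subst_hom Const_simps)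
  assume "f4 = (0 :: 'a mpoly3)"
  then have "0 = subst \<sigma> (f4 :: 'a mpoly3)" by (simp add: subst_hom)
  also have "\<dots> = 2 * ((- ?B * ?x2 - ?C * ?x3) * ?x2 ^ ?q - ?x2 * (- ?B * ?x2 ^ ?q - ?C * ?x3 ^ ?q)) * ?D
      + ((- ?B * ?x2 - ?C * ?x3) * ?x3 ^ ?q - ?x3 * (- ?B * ?x2 ^ ?q - ?C * ?x3 ^ ?q)) * (?B * ?D)
      + 2 * (?x2 * ?x3 ^ ?q - ?x3 * ?x2 ^ ?q) * (?C * ?D)"
    unfolding f4_eq by (simp add: subst_hom \<sigma> p frobenius_lin) (simp add: lin_def Const_simps)
  also have "\<dots> = (4 * ?C - ?B ^ 2) * (?x2 * ?x3 ^ ?q - ?x3 * ?x2 ^ ?q) * ?D" by algebra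
  finally have "4 * ?C - ?B ^ 2 = 0" using D skew_neq_0[of 2 3] by auto
  then have "Const (4 * c - b ^ 2) = 0" by (simp add: Const_simps)
  then have "b ^ 2 - 4 * c = 0" by simp
  then show False using bc zero_notin_nonsquares by (simp add: L_alt)
qed

section \<open>Odd invariants\<close>

text \<open>The G-orbit of x2 up to scalars: the forms a x1 + b x2 + c x3 whose discriminant b^2 - 4
  a c is a nonzero square. For a = 0 and b = 1 the discriminant is 1.\<close>

definition plus_lines :: "('a \<times> 'a \<times> 'a) set"
  where "plus_lines = (\<lambda>(b, c). (1, b, c)) ` Lplus \<union> range (\<lambda>c. (0, 1, c))"

lemma plus_lines_normalized: "plus_lines \<subseteq> normalized"
  by (auto simp: plus_lines_def normalized_def)

lemma card_plus_lines: "card plus_lines = CARD('a) + card (L :: ('a \<times> 'a) set)"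
proof -
  have "card plus_lines = card ((\<lambda>(b, c). (1::'a, b, c)) ` Lplus) + card (range (\<lambda>c::'a. (0::'a, 1::'a, c)))"
    unfolding plus_lines_def by (rule card_Un_disjoint) auto
  also have "\<dots> = card Lplus + CARD('a)"
    by (subst (1 2) card_image) (auto simp: inj_on_def)
  finally show ?thesis by (simp add: card_Lplus)
qed

text \<open>The reflection fixes the plane x2 = 0 pointwise, so there an odd polynomial equals its
  own negative and vanishes. Invariance carries the divisor x2 along its orbit.\<close>

lemma plus_line_dvd:
  assumes p: "p \<in> invariants" "odd_poly p" and t: "t \<in> plus_lines"
  shows "lin3 t dvd p"
proof -
  have "subst (trip (xvar 1) 0 (xvar 3)) p = subst (trip (xvar 1) 0 (xvar 3)) (subst flip2 p)"
    unfolding subst_subst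
    by (rule arg_cong[where f = "\<lambda>\<sigma>. subst \<sigma> p"], rule trip_eqI[symmetric]) (simp_all add: subst_hom)
  also have "\<dots> = - subst (trip (xvar 1) 0 (xvar 3)) p"
    using p by (simp add: odd_poly_def subst_hom)
  finally have "2 * subst (trip (xvar 1) 0 (xvar 3)) p = 0" by (metis add.right_inverse mult_2)
  then have "subst (kill (0, 1, 0)) p = 0"
    using two_neq_0_mpoly3[OF two_neq_0] by simp
  then have "lin 0 1 0 dvd p" using lin3_dvd_iff[of "(0, 1, 0)" p] by (auto simp: normalized_def)
  then obtain r where r: "p = lin 0 1 0 * r" by blast
  have dvd: "lin (a * c) (a * d + b * c) (b * d) dvd p" if "a * d - b * c = 1" for a b c d
    using invariantsD[OF p(1) that] unfolding r
    by (metis (no_types, lifting) dvd_triv_left mult_1 mult_zero_left add_0 add_0_right subst_hom(4) subst_rho_lin)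
  consider b c d where "t = (1, b, c)" "d \<noteq> 0" "b ^ 2 - 4 * c = d ^ 2" | c where "t = (0, 1, c)"
    using t by (auto simp: plus_lines_def Lplus_def nz_squares_def)
  then show ?thesis
  proof cases
    case 1
    \<comment> \<open>These are the roots r, r' of T^2 - b T + c. The matrix with rows (1, r), (k, k
      r') sends x2 to k times the desired form, and k = - 1 / d makes its determinant 1.\<close>
    let ?r = "(b + d) / 2" and ?r' = "(b - d) / 2"
    have sum: "?r + ?r' = b" using two_neq_0 by (simp add: field_simps)
    have "(b + d) * (b - d) = 4 * c" using 1(3) by algebra
    then have prod: "?r * ?r' = c" using four_neq_0 by (simp add: field_simps)
    have diff: "?r - ?r' = d" using two_neq_0 four_neq_0 by (simp add: field_simps)
    let ?k = "- 1 / d"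
    have "1 * (?k * x) - y * ?k = (y - x) / d" for x y by (simp add: diff_divide_distrib)
    from this[of ?r' ?r] have "1 * (?k * ?r') - ?r * ?k = 1" using 1(2) diff by simp
    note dvd[OF this]
    moreover have "lin (1 * k) (1 * (k * y) + x * k) (x * (k * y)) = Const k * lin 1 (x + y) (x * y)" for k x y :: 'a
      by (simp add: Const_mult_lin algebra_simps)
    ultimately have "Const ?k * lin 1 b c dvd p" by (simp only: sum prod)
    then show ?thesis unfolding 1 lin3.simps by (rule dvd_mult_right)
  next
    case 2
    then show ?thesis using dvd[of 1 1 c 0] by simp
  qed
qed

text \<open>Since \<open>f4\<close> is itself odd, it is divisible by the product over the orbit,
  and by degree the two agree up to a scalar. The invariance of \<open>f4\<close> is a hypothesis
  because it is derived later, from that of the gradients.\<close>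

lemma f4_dvd:
  assumes f4: "f4 \<in> (invariants :: 'a mpoly3 set)" and p: "p \<in> invariants" "odd_poly (p :: 'a mpoly3)"
  obtains r where "p = f4 * r" "r \<in> invariants" "even_poly r"
proof -
  let ?E = "(\<Prod>t\<in>plus_lines. lin3 t) :: 'a mpoly3"
  have dvd: "?E dvd g" if "g \<in> invariants" "odd_poly g" for g
    by (rule prod_lin3_dvd) (use that plus_lines_normalized plus_line_dvd in auto)
  have "tdeg (f4 :: 'a mpoly3) \<le> tdeg ?E"
    using tdeg_f4 by (simp add: tdeg_prod_lin3[OF plus_lines_normalized] card_plus_lines)
  then obtain k where k: "k \<noteq> 0" "f4 = Const k * ?E"
    using dvd_tdeg_le_imp_associated[OF dvd[OF f4 odd_f4] f4_neq_0] by blast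
  obtain s where s: "p = ?E * s" using dvd[OF p] by blast
  define r where "r = Const (inverse k) * s"
  have "Const k * Const (inverse k) = (1 :: 'a mpoly3)"
    using k(1) by (simp add: Const_simps flip: Const_simps(4))
  then have eq: "p = f4 * r" by (simp add: r_def k(2) s)
  have inv: "r \<in> invariants" using invariants_cancel f4 f4_neq_0 p(1) eq by blast
  have "f4 * subst flip2 r = f4 * r"
    using p(2) odd_f4 unfolding eq odd_poly_def by (simp add: subst_hom)
  then have "even_poly r" using f4_neq_0 by (simp add: even_poly_def)
  with that eq inv show ?thesis by blast
qed

end

section \<open>Degree of a substitution\<close>

lemma prod_3: "(\<Prod>i\<in>(UNIV :: 3 set). f i) = f 1 * f 2 * f 3"
  unfolding UNIV_3 by (simp add: ac_simps)

lemma single_eq: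
  "Poly_Mapping.single m c = Const c * (\<Prod>i\<in>UNIV. xvar i ^ Poly_Mapping.lookup m i)"
  for c :: "'a::comm_ring_1"
proof -
  have "subst xvar (Poly_Mapping.single m c) = Const c * (\<Prod>i\<in>UNIV. xvar i ^ Poly_Mapping.lookup m i)"
    by (cases "c = 0") (simp_all add: subst_def Const_simps)
  then show ?thesis by (simp add: subst_xvar_id)
qed

lemma scale_xvar_monom: "scale (xvar i) = monom (xvar i) 1"
  by (simp add: monom_altdef)

text \<open>Scaling multiplies each monomial by t to the power of its degree, so the coefficients of
  p survive in the homogeneous parts.\<close>

lemma lookup_coeff_scale:
  "Poly_Mapping.lookup (coeff (scale p) (\<Sum>i\<in>UNIV. Poly_Mapping.lookup m i)) m = Poly_Mapping.lookup p m"
proof (induction p rule: mpoly3_single_induct)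
  case (single m' c)
  have "scale (Poly_Mapping.single m' c)
      = monom (Poly_Mapping.single m' c) (\<Sum>i\<in>UNIV. Poly_Mapping.lookup m' i)"
    unfolding single_eq
    by (simp add: scale_hom prod_3 sum_3 scale_xvar_monom monom_power mult_monom smult_monom mult.assoc add.assoc
        del: scale_xvar)
  then show ?case by (auto simp: lookup_single when_def)
qed (simp_all add: scale_hom lookup_add)

lemma keys_le_tdeg:
  assumes "m \<in> Poly_Mapping.keys p"
  shows "(\<Sum>i\<in>UNIV. Poly_Mapping.lookup m i) \<le> tdeg p"
proof -
  have "coeff (scale p) (\<Sum>i\<in>UNIV. Poly_Mapping.lookup m i) \<noteq> 0"
    using lookup_coeff_scale[of p m] assms by (auto simp: in_keys_iff)
  then show ?thesis unfolding tdeg_def by (rule le_degree)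
qed

text \<open>The target is general so that the bound covers both the restriction to an axis and,
  composed with \<open>scale\<close>, an arbitrary substitution.\<close>

lemma degree_insertion_le:
  fixes \<sigma> :: "3 \<Rightarrow> 'b::comm_ring_1 poly" and p :: "'a::comm_ring_1 mpoly3"
  assumes "\<And>c. degree (\<kappa> c) = 0" "\<And>i. degree (\<sigma> i) \<le> k"
  shows "degree (insertion \<kappa> \<sigma> p) \<le> k * tdeg p"
  unfolding insertion_def
proof (rule degree_sum_le[OF finite_keys])
  fix m assume m: "m \<in> Poly_Mapping.keys p"
  have "degree (\<sigma> i ^ n) \<le> k * n" for i n
    using order.trans[OF degree_power_le mult_le_mono1[OF assms(2)]] .
  then have "degree (\<Prod>i\<in>UNIV. \<sigma> i ^ Poly_Mapping.lookup m i) \<le> k * (\<Sum>i\<in>UNIV. Poly_Mapping.lookup m i)"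
    unfolding prod_3 sum_3 distrib_left
    by (meson add_mono degree_mult_le order.trans)
  also have "\<dots> \<le> k * tdeg p" using keys_le_tdeg[OF m] by simp
  finally show "degree (\<kappa> (Poly_Mapping.lookup p m) * (\<Prod>i\<in>UNIV. \<sigma> i ^ Poly_Mapping.lookup m i)) \<le> k * tdeg p"
    using degree_mult_le assms(1) by (metis add_0 order.trans)
qed

lemma tdeg_subst_le:
  assumes "\<And>i. tdeg (\<sigma> i) \<le> k"
  shows "tdeg (subst \<sigma> p) \<le> k * tdeg p"
proof -
  have "scale (subst \<sigma> p) = insertion (\<lambda>c. [:Const c:]) (\<lambda>i. scale (\<sigma> i)) p"
    by (rule ring_hom_mpoly3_eqI)
      (simp_all add: ring_hom_comp ring_hom_scale ring_hom_subst ring_hom_insertion ring_hom_pConst)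
  then show ?thesis
    unfolding tdeg_def[of "subst \<sigma> p"]
    using degree_insertion_le[of "\<lambda>c. [:Const c:]" "\<lambda>i. scale (\<sigma> i)" k p] assms by (simp add: tdeg_def)
qed

lemma tdeg_trip_le: "tdeg x \<le> k \<Longrightarrow> tdeg y \<le> k \<Longrightarrow> tdeg z \<le> k \<Longrightarrow> tdeg (trip x y z i) \<le> k"
  using exhaust_3[of i] by auto

lemma tdeg_0 [simp]: "tdeg 0 = 0"
  by (simp add: tdeg_def scale_hom)

section \<open>Restriction to the first coordinate axis\<close>

definition restrict1 :: "'a::comm_ring_1 mpoly3 \<Rightarrow> 'a poly"
  where "restrict1 = insertion (\<lambda>c. [:c:]) (trip [:0, 1:] 0 0)"

lemma ring_hom_poly_const: "ring_hom (\<lambda>c::'a::comm_ring_1. [:c:])"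
  by (simp add: ring_hom_def)

lemma ring_hom_restrict1: "ring_hom restrict1"
  by (simp add: restrict1_def ring_hom_insertion ring_hom_poly_const)

lemmas restrict1_hom = ring_homD[OF ring_hom_restrict1]

lemma restrict1_Const [simp]: "restrict1 (Const c) = [:c:]"
  and restrict1_xvar [simp]: "restrict1 (xvar i) = trip [:0, 1:] 0 0 i"
  by (simp_all add: restrict1_def ring_hom_insertion ring_hom_poly_const)

lemma degree_restrict1_le: "degree (restrict1 p) \<le> tdeg p"
proof -
  have "degree (trip [:0, 1 :: 'a:] 0 0 i) \<le> 1" for i using exhaust_3[of i] by auto
  then show ?thesis
    using degree_insertion_le[of "\<lambda>c. [:c:]" "trip [:0, 1 :: 'a:] 0 0" 1 p] by (simp add: restrict1_def)
qed

lemma ring_hom_map_poly_Const: "ring_hom (\<lambda>g::'a::comm_ring_1 poly. map_poly Const g)"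
proof -
  have add: "map_poly Const (g + h) = map_poly Const g + map_poly Const h" for g h :: "'a poly"
    by (rule poly_eqI) (simp add: coeff_map_poly Const_simps)
  have smult: "map_poly Const (smult c g) = smult (Const c) (map_poly Const g)" for c and g :: "'a poly"
    by (rule poly_eqI) (simp add: coeff_map_poly Const_simps)
  have pCons: "map_poly Const (pCons c g) = pCons (Const c) (map_poly Const g)" for c and g :: "'a poly"
    by (rule poly_eqI) (simp add: coeff_map_poly Const_simps coeff_pCons split: nat.split)
  have "map_poly Const (g * h) = map_poly Const g * map_poly Const h" for g h :: "'a poly"
    by (induction g) (simp_all add: add smult pCons Const_simps)
  then show ?thesis using add pCons[of 1 0] by (simp add: ring_hom_def Const_simps flip: one_pCons)
qed

text \<open>The substitution factors through \<open>restrict1\<close>, by evaluation of the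
  univariate polynomial at x1.\<close>

lemma subst_axis_eq_0:
  fixes p :: "'a::comm_ring_1 mpoly3"
  assumes "restrict1 p = 0"
  shows "subst (trip (xvar 1) 0 0) p = 0"
proof -
  have "subst (trip (xvar 1) 0 0) p = poly (map_poly Const (restrict1 p)) (xvar 1)"
  proof (rule ring_hom_mpoly3_eqI[of _ "\<lambda>p. poly (map_poly Const (restrict1 p)) (xvar 1)"])
    show "ring_hom (\<lambda>p :: 'a mpoly3. poly (map_poly Const (restrict1 p)) (xvar 1))"
    proof (rule ring_hom_comp[of "\<lambda>g. poly g (xvar 1)" "\<lambda>p. map_poly Const (restrict1 p)"])
      show "ring_hom (\<lambda>g :: 'a mpoly3 poly. poly g (xvar 1))" by (simp add: ring_hom_def)
      show "ring_hom (\<lambda>p :: 'a mpoly3. map_poly Const (restrict1 p))"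
        by (rule ring_hom_comp[OF ring_hom_map_poly_Const ring_hom_restrict1])
    qed
    show "subst (trip (xvar 1) 0 0) (xvar i) = poly (map_poly Const (restrict1 (xvar i))) (xvar 1 :: 'a mpoly3)" for i
      using exhaust_3[of i] by (auto simp: map_poly_pCons Const_simps)
  qed (simp_all add: ring_hom_subst map_poly_pCons)
  then show ?thesis using assms by simp
qed

context odd_card
begin

text \<open>For p invariant under all shifts x1 -> x1 + t x3, the difference of p and its part free
  of x1 is divisible by x1, hence by the product N of all x1 + t x3. On the axis N becomes x1^q, and
  the quotient is again invariant, of smaller degree.\<close>

lemma restrict1_unipotent:
  assumes "\<And>t. subst (trip (lin 1 0 t) (xvar 2) (xvar 3)) p = (p :: 'a mpoly3)"
    and "coeff (restrict1 p) k \<noteq> 0"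
  shows "CARD('a) dvd k"
  using assms
proof (induction "tdeg p" arbitrary: p k rule: less_induct)
  case less
  let ?q = "CARD('a)"
  let ?\<tau> = "\<lambda>t. trip (lin 1 0 t) (xvar 2) (xvar 3) :: 3 \<Rightarrow> 'a mpoly3"
  let ?\<nu> = "trip 0 (xvar 2) (xvar 3) :: 3 \<Rightarrow> 'a mpoly3"
  define p0 where "p0 = subst ?\<nu> p"
  have ring: "subst \<sigma> p0 = subst (\<lambda>i. subst \<sigma> (?\<nu> i)) p" for \<sigma> by (simp add: p0_def subst_subst)
  have nu: "subst ?\<nu> (?\<nu> i) = ?\<nu> i" "subst (?\<tau> t) (?\<nu> i) = ?\<nu> i" for i t
    using exhaust_3[of i] by (auto simp: subst_hom)
  have p0_inv: "subst (?\<tau> t) p0 = p0" "subst ?\<nu> p0 = p0" for t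
    unfolding ring nu by (simp_all add: p0_def)
  have dvd1: "lin 1 0 0 dvd p - p0"
    using lin3_dvd_iff[of "(1, 0, 0)" "p - p0"] p0_inv by (simp add: normalized_def subst_hom p0_def)
  have "lin 1 0 t dvd p - p0" for t
  proof -
    from dvd1 obtain r where "p - p0 = lin 1 0 0 * r" by blast
    then have "subst (?\<tau> t) (p - p0) = lin 1 0 t * subst (?\<tau> t) r" by (simp add: subst_hom subst_lin Const_simps)
    then show ?thesis using less.prems p0_inv by (simp add: subst_hom)
  qed
  then have "(\<Prod>x\<in>range (\<lambda>t. (1, 0, t)). lin3 x) dvd p - p0"
    by (intro prod_lin3_dvd) (auto simp: normalized_def)
  moreover define N where "N = (\<Prod>t\<in>(UNIV :: 'a set). lin 1 0 t)"
  moreover have "(\<Prod>x\<in>range (\<lambda>t. (1, 0, t :: 'a)). lin3 x) = N"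
    unfolding N_def by (subst prod.reindex) (auto simp: inj_on_def)
  ultimately obtain p' where p': "p - p0 = N * p'" by auto
  have N0: "N \<noteq> 0" by (simp add: N_def)
  have tN: "tdeg N = ?q" unfolding N_def by (subst tdeg_prod) (auto simp: tdeg_lin)
  have rN: "restrict1 N = monom 1 ?q"
    by (simp add: N_def restrict1_hom lin_def prod_constant monom_altdef)
  \<comment> \<open>As \<open>p0\<close> is free of x1, only its constant term survives on the
    axis.\<close>
  have r0: "restrict1 p0 = [:const_term p:]"
    unfolding p0_def
  proof (rule ring_hom_mpoly3_eqI)
    show "ring_hom (\<lambda>p. restrict1 (subst ?\<nu> p))"
      by (rule ring_hom_comp[OF ring_hom_restrict1 ring_hom_subst])
    show "ring_hom (\<lambda>p :: 'a mpoly3. [:const_term p:])"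
      by (rule ring_hom_comp[OF ring_hom_poly_const ring_hom_const_term])
    show "restrict1 (subst ?\<nu> (xvar i)) = [:const_term (xvar i):]" for i
      using exhaust_3[of i] by (auto simp: restrict1_hom)
  qed simp
  have r: "restrict1 p = [:const_term p:] + monom 1 ?q * restrict1 p'"
    using arg_cong[OF p', of restrict1] by (simp add: restrict1_hom r0 rN diff_eq_eq add.commute)
  show ?case
  proof (cases "k = 0 \<or> p' = 0")
    case True
    then show ?thesis using less.prems(2) by (auto simp: r restrict1_hom coeff_pCons split: nat.splits)
  next
    case False
    then have k: "?q \<le> k" "coeff (restrict1 p') (k - ?q) \<noteq> 0"
      using less.prems(2) by (auto simp: r coeff_monom_mult coeff_pCons split: nat.splits if_splits)
    have "tdeg p0 \<le> 1 * tdeg p"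
      unfolding p0_def by (rule tdeg_subst_le) (auto intro!: tdeg_trip_le)
    then have "tdeg (N * p') \<le> tdeg p" unfolding p'[symmetric] by (intro tdeg_diff_le) auto
    then have "tdeg p' < tdeg p"
      using False N0 tN one_less_card_field[where ?'a = 'a] by (simp add: tdeg_mult)
    moreover have "subst (?\<tau> t) p' = p'" for t
    proof -
      have "subst (?\<tau> t) N = (\<Prod>s\<in>(UNIV :: 'a set). lin 1 0 (t + s))"
        by (simp add: N_def subst_hom subst_lin, simp add: xvar_lin Const_mult_lin lin_add)
      also have "\<dots> = N"
        unfolding N_def by (rule prod.reindex_bij_witness[where i = "\<lambda>s. s - t" and j = "\<lambda>s. t + s"]) auto
      finally have \<tau>N: "subst (?\<tau> t) N = N" .
      have "N * p' = subst (?\<tau> t) (N * p')"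
        unfolding p'[symmetric] by (simp add: subst_hom less.prems(1) p0_inv)
      then have "N * subst (?\<tau> t) p' = N * p'" by (simp only: subst_hom \<tau>N)
      then show ?thesis using N0 by simp
    qed
    ultimately have "?q dvd k - ?q" using less.hyps k(2) by blast
    then show ?thesis using k(1) by (simp add: dvd_diff_nat dvd_minus_self)
  qed
qed

section \<open>Invariants of two variables\<close>

text \<open>The polynomials in two variables are the polynomials in \<open>x\<^sub>1\<close> and \<open>x\<^sub>3\<close>.\<close>

abbreviation act2 :: "'a \<Rightarrow> 'a \<Rightarrow> 'a \<Rightarrow> 'a \<Rightarrow> 3 \<Rightarrow> 'a mpoly3"
  where "act2 a b c d \<equiv> trip (lin a 0 b) (xvar 2) (lin c 0 d)"

definition binary_invariant :: "'a mpoly3 \<Rightarrow> bool"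
  where "binary_invariant p \<longleftrightarrow> subst (trip (xvar 1) 0 (xvar 3)) p = p \<and>
    (\<forall>a b c d. a * d - b * c = 1 \<longrightarrow> subst (act2 a b c d) p = p)"

abbreviation flip3 :: "3 \<Rightarrow> 'a mpoly3"
  where "flip3 \<equiv> trip (xvar 1) (xvar 2) (- xvar 3)"

text \<open>The first Dickson invariant: up to a scalar, the product of one linear form in x1 and x3
  for each point of the projective line.\<close>

definition skew :: "'a mpoly3"
  where "skew = xvar 1 ^ CARD('a) * xvar 3 - xvar 1 * xvar 3 ^ CARD('a)"

lemma skew_nz: "skew \<noteq> 0"
  using skew_neq_0[of 3 1] by (simp add: skew_def mult.commute)

lemma tdeg_skew: "tdeg skew = CARD('a) + 1"
proof -
  have "scale skew = monom skew (CARD('a) + 1)"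
    by (simp add: skew_def scale_hom scale_xvar_monom monom_power mult_monom diff_monom del: scale_xvar)
  then show ?thesis using skew_nz by (simp add: tdeg_def degree_monom_eq)
qed

text \<open>This is the determinant with rows (x1^q, x3^q) and (x1, x3), and a matrix over F acts on
  both rows alike.\<close>

lemma binary_invariant_skew: "binary_invariant skew"
proof -
  have "subst (act2 a b c d) skew = skew" if "a * d - b * c = 1" for a b c d
  proof -
    let ?q = "CARD('a)" and ?C = "Const :: 'a \<Rightarrow> 'a mpoly3"
    have "subst (act2 a b c d) skew =
      (?C a * xvar 1 ^ ?q + ?C b * xvar 3 ^ ?q) * (?C c * xvar 1 + ?C d * xvar 3)
      - (?C a * xvar 1 + ?C b * xvar 3) * (?C c * xvar 1 ^ ?q + ?C d * xvar 3 ^ ?q)"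
      by (simp add: skew_def subst_hom frobenius_lin Const_simps) (simp add: lin_def Const_simps)
    also have "\<dots> = (?C a * ?C d - ?C b * ?C c) * skew" unfolding skew_def by algebra
    also have "?C a * ?C d - ?C b * ?C c = 1" using that by (simp flip: Const_simps)
    finally show ?thesis by simp
  qed
  then show ?thesis by (simp add: binary_invariant_def) (simp add: skew_def subst_hom)
qed

lemma binary_invariant_diff:
  "binary_invariant p \<Longrightarrow> binary_invariant r \<Longrightarrow> binary_invariant (p - r)"
  by (simp add: binary_invariant_def subst_hom)

lemma binary_invariant_cancel:
  assumes "binary_invariant (p * r)" "binary_invariant p" "p \<noteq> 0"
  shows "binary_invariant r"
proof -
  have "subst \<sigma> r = r" if "subst \<sigma> (p * r) = p * r" "subst \<sigma> p = p" for \<sigma>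
    using that assms(3) by (simp add: subst_hom)
  then show ?thesis using assms unfolding binary_invariant_def by blast
qed

text \<open>All nonzero linear forms in x1 and x3 lie in one orbit up to scalars, so with x3 their
  product divides p. By degree this product is \<open>skew\<close> up to a scalar.\<close>

lemma skew_dvd:
  assumes p: "binary_invariant p" and "xvar 3 dvd p"
  shows "skew dvd p"
proof -
  let ?S = "insert (0, 0, 1) (range (\<lambda>t. (1, 0, t))) :: ('a \<times> 'a \<times> 'a) set"
  let ?E = "\<Prod>x\<in>?S. lin3 x"
  have S: "?S \<subseteq> normalized" by (auto simp: normalized_def)
  have dvd: "?E dvd r" if r: "binary_invariant r" and "xvar 3 dvd r" for r
  proof (rule prod_lin3_dvd[OF _ S])
    fix x assume "x \<in> ?S"
    obtain s where s: "r = xvar 3 * s" using \<open>xvar 3 dvd r\<close> by blast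
    consider "x = (0, 0, 1)" | t where "x = (1, 0, t)" using \<open>x \<in> ?S\<close> by auto
    then show "lin3 x dvd r"
    proof cases
      case 2
      \<comment> \<open>This element of determinant 1 sends x3 to x1 + t x3.\<close>
      have "r = subst (act2 0 (- 1) 1 t) r" using r by (simp add: binary_invariant_def)
      also have "\<dots> = lin 1 0 t * subst (act2 0 (- 1) 1 t) s" by (simp add: s subst_hom)
      finally show ?thesis using 2 by (metis dvd_triv_left lin3.simps)
    qed (use s in \<open>simp add: xvar_lin\<close>)
  qed simp
  have "card ?S = CARD('a) + 1"
    by (subst card_insert_disjoint) (auto simp: card_image inj_on_def)
  then have "tdeg skew \<le> tdeg ?E" using tdeg_skew tdeg_prod_lin3[OF S] by simp
  moreover have "?E dvd skew"
  proof (rule dvd[OF binary_invariant_skew])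
    have "xvar 3 dvd xvar 3 ^ CARD('a)" by (simp add: dvd_power)
    then show "xvar 3 dvd skew" by (simp add: skew_def)
  qed
  ultimately obtain k where k: "k \<noteq> 0" "skew = Const k * ?E"
    using dvd_tdeg_le_imp_associated skew_nz by blast
  obtain s where s: "p = ?E * s" using dvd[OF assms] by blast
  have "Const k * Const (inverse k) = (1 :: 'a mpoly3)"
    using k(1) by (simp add: Const_simps flip: Const_simps(4))
  then have "p = skew * (Const (inverse k) * s)" by (simp add: k(2) s)
  then show ?thesis by simp
qed

section \<open>Restriction to the cone\<close>

abbreviation cone :: "3 \<Rightarrow> 'a mpoly3"
  where "cone \<equiv> trip (xvar 1 ^ 2) (xvar 1 * xvar 3) (xvar 3 ^ 2)"

lemma cone_f2: "subst cone f2 = skew ^ 2"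
proof -
  have "subst cone f2 = (xvar 1 ^ CARD('a)) ^ 2 * xvar 3 ^ 2 + xvar 1 ^ 2 * (xvar 3 ^ CARD('a)) ^ 2
    - 2 * (xvar 1 ^ CARD('a) * xvar 1) * (xvar 3 ^ CARD('a) * xvar 3)"
    by (simp add: f2_def subst_hom power_mult_distrib flip: power_mult) (simp add: mult_ac)
  also have "\<dots> = skew ^ 2" unfolding skew_def by algebra
  finally show ?thesis .
qed

lemma trip_comp: "(\<lambda>i. h (trip x y z i)) = trip (h x) (h y) (h z)"
  by (rule trip_eqI) simp_all

text \<open>The parametrization of the cone is equivariant, \<open>rho\<close> being the symmetric
  square of the action on the two variables.\<close>

lemma binary_invariant_cone:
  assumes "p \<in> invariants"
  shows "binary_invariant (subst cone p)"
proof -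
  have "subst (act2 a b c d) (subst cone p) = subst cone p" if "a * d - b * c = 1" for a b c d
  proof -
    have "(\<lambda>i. subst (act2 a b c d) (cone i)) = (\<lambda>i. subst cone (rho a b c d i))"
      unfolding rho_def trip_comp
      by (simp add: subst_hom subst_lin Const_simps)
        (simp add: lin_def Const_simps power2_eq_square algebra_simps)
    then have "subst (act2 a b c d) (subst cone p) = subst cone (subst (rho a b c d) p)"
      by (simp only: subst_subst)
    then show ?thesis using invariantsD[OF assms that] by simp
  qed
  then show ?thesis
    by (simp add: binary_invariant_def subst_subst trip_comp subst_hom)
qed

text \<open>Negating the second parameter negates only the middle coordinate of the cone.\<close>

lemma flip3_cone:
  assumes "even_poly p"
  shows "subst flip3 (subst cone p) = subst cone p"
proof -
  have "subst flip3 (subst cone p) = subst cone (subst flip2 p)"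
    by (simp add: subst_subst trip_comp subst_hom)
  then show ?thesis using assms by (simp add: even_poly_def)
qed

text \<open>Each factor becomes the square of x1. Only multiples of q (q - 1) can occur as exponents
  of binary invariants on the axis, so powers of \<open>f3\<close> suffice to match them
  there.\<close>

lemma restrict1_cone_f3: "restrict1 (subst cone f3) = monom 1 (CARD('a) * (CARD('a) - 1))"
proof -
  have "restrict1 (subst cone (lin 1 b c)) = monom 1 2" for b c
    by (simp add: subst_lin restrict1_hom Const_simps monom_altdef)
  then have "restrict1 (subst cone f3) = monom 1 2 ^ card (L :: ('a \<times> 'a) set)"
    by (simp add: f3_lin subst_hom restrict1_hom case_prod_beta)
  then show ?thesis by (simp add: monom_power card_L)
qed

end

section \<open>The algebra generated by the three basic polynomials\<close>

inductive_set poly_algebra :: "'a::comm_ring_1 mpoly3 set \<Rightarrow> 'a mpoly3 set"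
  for B :: "'a mpoly3 set"
  where
    Const: "Const c \<in> poly_algebra B"
  | base: "p \<in> B \<Longrightarrow> p \<in> poly_algebra B"
  | add: "p \<in> poly_algebra B \<Longrightarrow> r \<in> poly_algebra B \<Longrightarrow> p + r \<in> poly_algebra B"
  | mult: "p \<in> poly_algebra B \<Longrightarrow> r \<in> poly_algebra B \<Longrightarrow> p * r \<in> poly_algebra B"

context odd_card
begin

abbreviation A :: "'a mpoly3 set" where "A \<equiv> poly_algebra {f1, f2, f3}"

lemma A_power: "p \<in> A \<Longrightarrow> p ^ n \<in> A"
  by (induction n) (use poly_algebra.Const[of 1] in \<open>auto intro: poly_algebra.mult simp: Const_simps\<close>)

lemma A_sum: "(\<And>i. i \<in> I \<Longrightarrow> h i \<in> A) \<Longrightarrow> sum h I \<in> A"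
  by (induction I rule: infinite_finite_induct)
    (use poly_algebra.Const[of 0] in \<open>auto intro: poly_algebra.add simp: Const_simps\<close>)

lemma A_even_invariant: "p \<in> A \<Longrightarrow> p \<in> invariants \<and> even_poly p"
  by (induction rule: poly_algebra.induct)
    (use f1_invariant f2_invariant f3_invariant even_f1 even_f2 even_f3 in
      \<open>auto intro: invariants_ring even_poly_closed\<close>)

lemma tdeg_f2_le: "tdeg (f2 :: 'a mpoly3) \<le> CARD('a) + 1"
proof -
  let ?q = "CARD('a)"
  have "tdeg (xvar 1 ^ ?q * xvar 3 :: 'a mpoly3) \<le> ?q + 1"
    by (rule order.trans[OF tdeg_mult_le]) (simp add: tdeg_power)
  moreover have "tdeg (xvar 1 * xvar 3 ^ ?q :: 'a mpoly3) \<le> ?q + 1"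
    by (rule order.trans[OF tdeg_mult_le]) (simp add: tdeg_power)
  moreover have "tdeg (2 * xvar 2 ^ (?q + 1) :: 'a mpoly3) \<le> ?q + 1"
    by (rule order.trans[OF tdeg_mult_le]) (simp add: tdeg_power del: power_Suc)
  ultimately show ?thesis unfolding f2_def by (blast intro: tdeg_diff_le tdeg_add_le)
qed

lemma tdeg_f3: "tdeg (f3 :: 'a mpoly3) = card (L :: ('a \<times> 'a) set)"
  unfolding f3_lin by (subst tdeg_prod) (auto simp: case_prod_beta tdeg_lin)

lemma tdeg_f1: "tdeg (f1 :: 'a mpoly3) = 2"
proof (rule antisym)
  show "tdeg (f1 :: 'a mpoly3) \<le> 2" unfolding f1_def
    by (rule tdeg_diff_le) (auto intro!: order.trans[OF tdeg_mult_le] simp: tdeg_power)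
  have "subst (trip (xvar 1) (xvar 2) 0) (f1 :: 'a mpoly3) = - (xvar 2 ^ 2)"
    by (simp add: f1_def subst_hom)
  moreover have "tdeg (subst (trip (xvar 1) (xvar 2) 0) (f1 :: 'a mpoly3)) \<le> 1 * tdeg (f1 :: 'a mpoly3)"
    by (rule tdeg_subst_le) (auto intro!: tdeg_trip_le)
  ultimately show "2 \<le> tdeg (f1 :: 'a mpoly3)" by (simp add: tdeg_power)
qed

text \<open>Dickson's theorem on the invariants of \<open>SL\<^sub>2\<close>, for those that are even in \<open>x\<^sub>3\<close>:\<close>

lemma binary_invariant_lift:
  assumes "binary_invariant p" "subst flip3 p = p" "tdeg p \<le> 2 * n"
  shows "\<exists>P\<in>A. tdeg P \<le> n \<and> subst cone P = p"
  using assms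
proof (induction n arbitrary: p rule: less_induct)
  case (less n)
  let ?q = "CARD('a)"
  let ?M = "?q * (?q - 1)"
  have inv: "subst (act2 a b c d) p = p" if "a * d - b * c = 1" for a b c d
    using less.prems(1) that by (simp add: binary_invariant_def)
  \<comment> \<open>The unipotent elements force divisibility by q, the diagonal ones divisibility
    by q - 1.\<close>
  have coeff: "?M dvd k" if "coeff (restrict1 p) k \<noteq> 0" for k
  proof -
    have "?q dvd k"
      by (rule restrict1_unipotent[OF _ that]) (use inv[of 1 1 _ 0] in \<open>simp add: xvar_lin\<close>)
    moreover have "(?q - 1) dvd k"
    proof (rule card_field_minus_1_dvd)
      fix r :: 'a assume r: "r \<noteq> 0"
      have "restrict1 (subst (act2 r 0 0 (1 / r)) p) = pcompose (restrict1 p) [:0, r:]"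
      proof (rule ring_hom_mpoly3_eqI)
        show "ring_hom (\<lambda>p :: 'a mpoly3. pcompose (restrict1 p) [:0, r:])"
          by (simp add: ring_hom_def restrict1_hom pcompose_add pcompose_mult pcompose_1)
        show "restrict1 (subst (act2 r 0 0 (1 / r)) (xvar i)) = pcompose (restrict1 (xvar i)) [:0, r:]" for i
          using exhaust_3[of i] by (auto simp: lin_def restrict1_hom Const_simps pcompose_pCons)
      qed (simp_all add: ring_hom_comp ring_hom_restrict1 ring_hom_subst)
      then have "pcompose (restrict1 p) [:0, r:] = restrict1 p" using inv[of r "1 / r" 0 0] r by simp
      then have "r ^ k * coeff (restrict1 p) k = coeff (restrict1 p) k" by (metis coeff_pcompose_linear)
      then show "r ^ k = 1" using that by simp
    qed
    moreover have "coprime ?q (?q - 1)"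
      using coprime_diff_one_right_nat[of ?q] by (simp add: coprime_commute)
    ultimately show ?thesis by (simp add: divides_mult)
  qed
  have deg: "degree (restrict1 p) \<le> 2 * n" using degree_restrict1_le less.prems(3) order.trans by blast
  have M: "2 \<le> ?M" using card_L_gt_1 card_L by simp
  \<comment> \<open>A combination of powers of \<open>f3\<close> with the same restriction to the
    axis. Taking k up to n reaches all exponents, as these are at most 2 n and \<open>?M\<close> is
    at least 2.\<close>
  define P0 where "P0 = (\<Sum>k\<le>n. Const (coeff (restrict1 p) (?M * k)) * f3 ^ k)"
  have P0A: "P0 \<in> A"
    unfolding P0_def by (intro A_sum poly_algebra.mult poly_algebra.Const A_power poly_algebra.base) auto
  have tP0: "tdeg P0 \<le> n" unfolding P0_def
  proof (rule tdeg_sum_le)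
    fix k
    show "tdeg (Const (coeff (restrict1 p) (?M * k)) * f3 ^ k) \<le> n"
    proof (cases "coeff (restrict1 p) (?M * k) = 0")
      case False
      then have "?M * k \<le> 2 * n" using deg le_degree order.trans by blast
      then have "k * card (L :: ('a \<times> 'a) set) \<le> n" unfolding card_L[symmetric] by (simp add: mult.commute)
      then show ?thesis by (intro order.trans[OF tdeg_mult_le]) (simp add: tdeg_power tdeg_f3)
    qed (simp add: Const_simps)
  qed
  have "restrict1 (subst cone P0) = (\<Sum>k\<le>n. monom (coeff (restrict1 p) (?M * k)) (?M * k))"
    by (simp add: P0_def subst_hom restrict1_hom restrict1_cone_f3 monom_power smult_monom)
  also have "\<dots> = restrict1 p"
  proof (rule poly_eqI)
    fix j
    have "coeff (\<Sum>k\<le>n. monom (coeff (restrict1 p) (?M * k)) (?M * k)) j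
        = (\<Sum>k\<le>n. if ?M * k = j then coeff (restrict1 p) j else 0)"
      by (simp add: coeff_sum if_distrib cong: if_cong)
    also have "\<dots> = coeff (restrict1 p) j"
    proof (cases "coeff (restrict1 p) j = 0")
      case False
      then obtain k where k: "j = ?M * k" using coeff by blast
      have "?M * k \<le> 2 * n" using False deg le_degree order.trans k by blast
      from order.trans[OF mult_le_mono1[OF M] this] have "k \<le> n" by simp
      moreover have "(?M * k' = j) = (k' = k)" for k' using M k by auto
      ultimately show ?thesis by simp
    next
      case True
      then show ?thesis by (intro trans[OF sum.neutral]) auto
    qed
    finally show "coeff (\<Sum>k\<le>n. monom (coeff (restrict1 p) (?M * k)) (?M * k)) j = coeff (restrict1 p) j" .
  qed
  finally have res: "restrict1 (subst cone P0) = restrict1 p" .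
  define d where "d = p - subst cone P0"
  have d_inv: "binary_invariant d" unfolding d_def
    using less.prems(1) A_even_invariant[OF P0A] by (intro binary_invariant_diff binary_invariant_cone) auto
  have d_flip: "subst flip3 d = d"
    using less.prems(2) flip3_cone A_even_invariant[OF P0A] by (simp add: d_def subst_hom)
  have x3_dvd: "xvar 3 dvd r" if "subst (trip (xvar 1) (xvar 2) 0) r = 0" for r :: "'a mpoly3"
    using lin3_dvd_iff[of "(0, 0, 1)" r] that by (simp add: normalized_def xvar_lin)
  show ?case
  proof (cases "d = 0")
    case True
    then show ?thesis using P0A tP0 by (auto simp: d_def)
  next
    case False
    have "tdeg (subst cone P0) \<le> 2 * tdeg P0"
      by (rule tdeg_subst_le) (auto intro!: tdeg_trip_le order.trans[OF tdeg_mult_le] simp: tdeg_power)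
    then have td: "tdeg d \<le> 2 * n" unfolding d_def using tP0 less.prems(3) by (intro tdeg_diff_le) auto
    have "restrict1 d = 0" by (simp add: d_def restrict1_hom res)
    then have "subst (trip (xvar 1) 0 0) d = 0" by (rule subst_axis_eq_0)
    moreover have "subst (trip (xvar 1) 0 0) d = subst (trip (xvar 1) (xvar 2) 0) (subst (trip (xvar 1) 0 (xvar 3)) d)"
      by (simp add: subst_subst trip_comp subst_hom)
    ultimately have "subst (trip (xvar 1) (xvar 2) 0) d = 0"
      using d_inv by (simp add: binary_invariant_def)
    \<comment> \<open>As \<open>skew\<close> is odd under \<open>flip3\<close> and d is even, the
      quotient r is odd. Hence r also vanishes at x3 = 0, which yields a second factor
      \<open>skew\<close>.\<close>
    then obtain r where r: "d = skew * r" using skew_dvd[OF d_inv x3_dvd] by blast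
    have r_inv: "binary_invariant r"
      using binary_invariant_cancel binary_invariant_skew d_inv r skew_nz by blast
    have skew_flip: "subst flip3 skew = - skew" using odd by (simp add: skew_def subst_hom)
    have "- (skew * subst flip3 r) = skew * r" using d_flip by (simp add: r subst_hom skew_flip)
    then have "skew * subst flip3 r = skew * (- r)"
      unfolding mult_minus_right by (rule sym[OF iffD1[OF minus_equation_iff]])
    then have r_flip: "subst flip3 r = - r" using skew_nz by (simp only: mult_cancel_left) auto
    have "subst (trip (xvar 1) (xvar 2) 0) r = subst (trip (xvar 1) (xvar 2) 0) (subst flip3 r)"
      by (simp add: subst_subst trip_comp subst_hom)
    then have "2 * subst (trip (xvar 1) (xvar 2) 0) r = 0"
      unfolding r_flip by (metis add.right_inverse mult_2 subst_hom(5))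
    then have "subst (trip (xvar 1) (xvar 2) 0) r = 0" using two_neq_0_mpoly3[OF two_neq_0] by simp
    then obtain s where s: "r = skew * s" using skew_dvd[OF r_inv x3_dvd] by blast
    have s_inv: "binary_invariant s"
      using binary_invariant_cancel binary_invariant_skew r_inv s skew_nz by blast
    have "skew * subst flip3 s = skew * s" using r_flip by (simp add: s subst_hom skew_flip)
    then have s_flip: "subst flip3 s = s" using skew_nz by simp
    have "s \<noteq> 0" using False r s by auto
    \<comment> \<open>The square of \<open>skew\<close> is the restriction of \<open>f2\<close>: the
      degree 2 (q + 1) lost on the cone corresponds to q + 1 before restriction.\<close>
    then have "2 * (?q + 1) + tdeg s \<le> 2 * n" using td skew_nz tdeg_skew by (simp add: r s tdeg_mult)
    then have n: "?q + 1 \<le> n" "tdeg s \<le> 2 * (n - (?q + 1))" by auto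
    then obtain P where P: "P \<in> A" "tdeg P \<le> n - (?q + 1)" "subst cone P = s"
      using less.IH[of "n - (?q + 1)" s] s_inv s_flip by auto
    have "tdeg (f2 * P) \<le> n" using tdeg_mult_le[of f2 P] tdeg_f2_le P(2) n(1) by linarith
    then have "tdeg (P0 + f2 * P) \<le> n" using tP0 by (intro tdeg_add_le)
    moreover have "P0 + f2 * P \<in> A" using P0A P(1) by (auto intro: poly_algebra.intros)
    moreover have "subst cone (P0 + f2 * P) = p"
    proof -
      have "subst cone (P0 + f2 * P) = subst cone P0 + skew ^ 2 * s" by (simp only: subst_hom cone_f2 P(3))
      also have "skew ^ 2 * s = d" by (simp add: r s power2_eq_square mult.assoc)
      finally show ?thesis by (simp add: d_def)
    qed
    ultimately show ?thesis by blast
  qed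
qed

section \<open>The ideal of the cone\<close>

lemma subst_square_inj:
  assumes "subst (\<lambda>i. xvar i ^ 2) p = (0 :: 'a mpoly3)"
  shows "p = 0"
proof (rule poly_mapping_eqI)
  fix m
  have "Poly_Mapping.lookup (subst (\<lambda>i. xvar i ^ 2) p) (m + m) = Poly_Mapping.lookup p m" for p :: "'a mpoly3"
  proof (induction p rule: mpoly3_single_induct)
    case (single m' c)
    have "subst (\<lambda>i. xvar i ^ 2) (Poly_Mapping.single m' c) = Poly_Mapping.single (m' + m') c"
      unfolding single_eq by (simp add: subst_hom lookup_add power_add power2_eq_square power_mult_distrib)
    moreover have "m' = m" if "m' + m' = m + m"
    proof (rule poly_mapping_eqI)
      fix i
      show "Poly_Mapping.lookup m' i = Poly_Mapping.lookup m i"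
        using arg_cong[OF that, of "\<lambda>m. Poly_Mapping.lookup m i"] by (simp add: lookup_add)
    qed
    ultimately show ?case by (auto simp: lookup_single when_def)
  qed (simp_all add: subst_hom lookup_add)
  then show "Poly_Mapping.lookup p m = Poly_Mapping.lookup 0 m" using assms by (metis lookup_zero)
qed

text \<open>Modulo \<open>f1\<close> the square of x2 may be replaced by x1 x3, which leaves degree
  at most 1 in x2.\<close>

lemma f1_dvd_normal_form:
  "\<exists>a b. subst (trip (xvar 1) 0 (xvar 3)) a = a \<and> subst (trip (xvar 1) 0 (xvar 3)) b = b \<and>
    f1 dvd p - (a + xvar 2 * b :: 'a mpoly3)"
proof (induction p rule: mpoly3_induct)
  case (Const c)
  then show ?case by (intro exI[of _ "Const c"] exI[of _ 0]) (simp add: subst_hom)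
next
  case (xvar i)
  show ?case
  proof (cases "i = 2")
    case True
    then show ?thesis by (intro exI[of _ 0] exI[of _ 1]) (simp add: subst_hom)
  next
    case False
    then show ?thesis using exhaust_3[of i] by (intro exI[of _ "xvar i"] exI[of _ 0]) (auto simp: subst_hom)
  qed
next
  case (add p r)
  then obtain a b a' b' where *: "subst (trip (xvar 1) 0 (xvar 3)) a = a" "subst (trip (xvar 1) 0 (xvar 3)) b = b"
    "f1 dvd p - (a + xvar 2 * b)" "subst (trip (xvar 1) 0 (xvar 3)) a' = a'"
    "subst (trip (xvar 1) 0 (xvar 3)) b' = b'" "f1 dvd r - (a' + xvar 2 * b')" by blast
  have "p + r - ((a + a') + xvar 2 * (b + b')) = (p - (a + xvar 2 * b)) + (r - (a' + xvar 2 * b'))"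
    by algebra
  then have "f1 dvd p + r - ((a + a') + xvar 2 * (b + b'))" using * by (metis dvd_add)
  then show ?case using * by (intro exI[of _ "a + a'"] exI[of _ "b + b'"]) (simp add: subst_hom)
next
  case (mult p r)
  then obtain a b a' b' where *: "subst (trip (xvar 1) 0 (xvar 3)) a = a" "subst (trip (xvar 1) 0 (xvar 3)) b = b"
    "f1 dvd p - (a + xvar 2 * b)" "subst (trip (xvar 1) 0 (xvar 3)) a' = a'"
    "subst (trip (xvar 1) 0 (xvar 3)) b' = b'" "f1 dvd r - (a' + xvar 2 * b')" by blast
  let ?a = "a * a' + xvar 1 * xvar 3 * b * b'" and ?b = "a * b' + a' * b"
  have "p * r - (?a + xvar 2 * ?b)
      = (p - (a + xvar 2 * b)) * r + (a + xvar 2 * b) * (r - (a' + xvar 2 * b')) - f1 * (b * b')"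
    unfolding f1_def by algebra
  then have "f1 dvd p * r - (?a + xvar 2 * ?b)" using * by (metis dvd_add dvd_diff dvd_mult dvd_mult2 dvd_triv_left)
  then show ?case using * by (intro exI[of _ ?a] exI[of _ ?b]) (simp add: subst_hom)
qed

text \<open>In the normal form a + x2 b the summands restrict to polynomials of different parity in
  the second parameter, so both vanish. Both a and b are then zero, because squaring the variables
  is injective.\<close>

lemma cone_kernel:
  assumes "subst cone p = 0"
  shows "f1 dvd p"
proof -
  let ?\<pi> = "trip (xvar 1) 0 (xvar 3) :: 3 \<Rightarrow> 'a mpoly3"
  obtain a b where ab: "subst ?\<pi> a = a" "subst ?\<pi> b = b" "f1 dvd p - (a + xvar 2 * b)"
    using f1_dvd_normal_form by blast
  have sq: "subst cone h = subst (\<lambda>i. xvar i ^ 2) h" if "subst ?\<pi> h = h" for h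
  proof -
    have "subst cone (subst ?\<pi> h) = subst (\<lambda>i. xvar i ^ 2) (subst ?\<pi> h)"
      by (simp add: subst_subst trip_comp subst_hom)
    then show ?thesis by (simp add: that)
  qed
  have "subst cone f1 = 0" by (simp add: f1_def subst_hom power_mult_distrib)
  moreover obtain k where "p - (a + xvar 2 * b) = f1 * k" using ab(3) by blast
  ultimately have "subst cone (p - (a + xvar 2 * b)) = 0" by (simp only: subst_hom) simp
  then have 1: "subst cone a + xvar 1 * xvar 3 * subst cone b = 0"
    by (simp add: subst_hom assms neg_eq_iff_add_eq_0)
  have "subst flip3 (subst cone h) = subst cone h" if "subst ?\<pi> h = h" for h
    unfolding sq[OF that] subst_subst
    by (rule arg_cong[where f = "\<lambda>\<sigma>. subst \<sigma> h"]) (rule ext, metis (no_types, lifting) exhaust_3 power2_minus subst_hom(7) subst_xvar trip_simps)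
  then have "subst cone a - xvar 1 * xvar 3 * subst cone b = 0"
    using arg_cong[OF 1, of "subst flip3"] ab by (simp add: subst_hom)
  with 1 have "2 * subst cone a = 0" by algebra
  then have a: "subst cone a = 0" using two_neq_0_mpoly3[OF two_neq_0] by simp
  with 1 have "subst cone b = 0" by simp
  with a have "a = 0" "b = 0" using sq ab subst_square_inj by metis+
  then show ?thesis using ab(3) by simp
qed

text \<open>Lifting the restriction to the cone changes p only by a multiple of \<open>f1\<close>,
  whose cofactor is again an even invariant. The degree bound on the lift makes the cofactor smaller
  than p.\<close>

lemma even_invariant_in_A:
  assumes "p \<in> invariants" "even_poly p"
  shows "p \<in> A"
  using assms
proof (induction "tdeg p" arbitrary: p rule: less_induct)
  case less
  have "tdeg (subst cone p) \<le> 2 * tdeg p"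
    by (rule tdeg_subst_le) (auto intro!: tdeg_trip_le order.trans[OF tdeg_mult_le] simp: tdeg_power)
  then obtain P where P: "P \<in> A" "tdeg P \<le> tdeg p" "subst cone P = subst cone p"
    using binary_invariant_lift[of "subst cone p" "tdeg p"] binary_invariant_cone flip3_cone less.prems by blast
  then have "f1 dvd p - P" by (intro cone_kernel) (simp add: subst_hom)
  then obtain r where r: "p - P = f1 * r" by blast
  then have p: "p = P + f1 * r" by (simp add: algebra_simps)
  show ?case
  proof (cases "r = 0")
    case True
    then show ?thesis using P p by simp
  next
    case False
    have f1: "f1 \<noteq> (0 :: 'a mpoly3)" using tdeg_f1 by auto
    have "tdeg (f1 * r) \<le> tdeg p" unfolding r[symmetric] using P by (intro tdeg_diff_le) auto
    then have "tdeg r < tdeg p" using False f1 by (simp add: tdeg_mult tdeg_f1)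
    moreover have "f1 * r \<in> invariants"
      unfolding r[symmetric] using less.prems A_even_invariant[OF P(1)] by (intro invariants_ring) auto
    then have "r \<in> invariants" using invariants_cancel f1_invariant f1 by blast
    moreover have "even_poly (f1 * r)"
      unfolding r[symmetric] using less.prems A_even_invariant[OF P(1)] by (intro even_poly_closed) auto
    then have "even_poly r" using even_f1 f1 by (simp add: even_poly_def subst_hom)
    ultimately have "r \<in> A" using less.hyps by blast
    then show ?thesis unfolding p using P(1) by (auto intro: poly_algebra.intros)
  qed
qed

end

section \<open>Vectors of polynomials\<close>

definition tv :: "'b \<Rightarrow> 'b \<Rightarrow> 'b \<Rightarrow> 'b ^ 3"
  where "tv x y z = (\<chi> i. trip x y z i)"

lemma tv_nth [simp]: "tv x y z $ 1 = x" "tv x y z $ 2 = y" "tv x y z $ 3 = z"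
  by (simp_all add: tv_def)

lemma tv_eq_iff: "(u :: 'b ^ 3) = v \<longleftrightarrow> u $ 1 = v $ 1 \<and> u $ 2 = v $ 2 \<and> u $ 3 = v $ 3"
  by (simp add: vec_eq_iff forall_3)

definition dot :: "'b::comm_ring_1 ^ 3 \<Rightarrow> 'b ^ 3 \<Rightarrow> 'b"
  where "dot u v = u $ 1 * v $ 1 + u $ 2 * v $ 2 + u $ 3 * v $ 3"

definition cross :: "'b::comm_ring_1 ^ 3 \<Rightarrow> 'b ^ 3 \<Rightarrow> 'b ^ 3"
  where "cross u v = tv (u $ 2 * v $ 3 - u $ 3 * v $ 2) (u $ 3 * v $ 1 - u $ 1 * v $ 3)
    (u $ 1 * v $ 2 - u $ 2 * v $ 1)"

lemma dot_zero [simp]: "dot 0 v = 0" "dot v 0 = 0"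
  and cross_zero [simp]: "cross 0 v = 0" "cross v 0 = 0"
  by (simp_all add: dot_def cross_def tv_eq_iff)

lemma dot_linear: "dot (u + v) w = dot u w + dot v w" "dot (p *s u) w = p * dot u w"
  by (simp_all add: dot_def algebra_simps)

section \<open>Coordinates on differential forms\<close>

text \<open>A form is described by its coefficients with respect to \<open>1\<close>; \<open>dx\<^sub>1, dx\<^sub>2, dx\<^sub>3\<close>;
  \<open>dx\<^sub>2 \<and> dx\<^sub>3, dx\<^sub>3 \<and> dx\<^sub>1, dx\<^sub>1 \<and> dx\<^sub>2\<close>; and \<open>dx\<^sub>1 \<and> dx\<^sub>2 \<and> dx\<^sub>3\<close>. The sign in \<open>part2\<close>
  comes from the basis element for the set {2, 3}, which is \<open>dx\<^sub>3 \<and> dx\<^sub>2\<close>.\<close>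

definition part0 :: "'a::comm_ring_1 form \<Rightarrow> 'a mpoly3"
  where "part0 \<omega> = \<omega> $ {}"

definition part1 :: "'a::comm_ring_1 form \<Rightarrow> 'a mpoly3 ^ 3"
  where "part1 \<omega> = tv (\<omega> $ {1}) (\<omega> $ {2}) (\<omega> $ {3})"

definition part2 :: "'a::comm_ring_1 form \<Rightarrow> 'a mpoly3 ^ 3"
  where "part2 \<omega> = tv (- \<omega> $ {2, 3}) (\<omega> $ {3, 1}) (\<omega> $ {1, 2})"

text \<open>The increasing order 3, 1, 2 is an even permutation of 1, 2, 3, so no sign
  appears.\<close>

definition part3 :: "'a::comm_ring_1 form \<Rightarrow> 'a mpoly3"
  where "part3 \<omega> = \<omega> $ UNIV"

definition mk :: "'a::comm_ring_1 mpoly3 \<Rightarrow> 'a mpoly3 ^ 3 \<Rightarrow> 'a mpoly3 ^ 3 \<Rightarrow> 'a mpoly3 \<Rightarrow> 'a form"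
  where "mk p u v c = (\<chi> S. if S = {} then p else if S = {1} then u $ 1 else if S = {2} then u $ 2
    else if S = {3} then u $ 3 else if S = {2, 3} then - v $ 1 else if S = {3, 1} then v $ 2
    else if S = {1, 2} then v $ 3 else c)"

lemma subset_cases_3: "(S :: 3 set) \<in> {{}, {1}, {2}, {3}, {2, 3}, {3, 1}, {1, 2}, UNIV}"
proof -
  have U: "{1, 2, 3} = (UNIV :: 3 set)" by (rule UNIV_3[symmetric])
  have Int: "S \<inter> {i} = (if i \<in> S then {i} else {})" for i by auto
  have "S = S \<inter> {1} \<union> S \<inter> {2} \<union> S \<inter> {3}" using U by blast
  then have "S = (if 1 \<in> S then {1} else {}) \<union> (if 2 \<in> S then {2} else {}) \<union> (if 3 \<in> S then {3} else {})"
    unfolding Int .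
  moreover have "(if b1 then {1} else {}) \<union> (if b2 then {2} else {}) \<union> (if b3 then {3} else {})
      \<in> {{}, {1}, {2}, {3}, {2, 3}, {3, 1}, {1, 2}, UNIV :: 3 set}" for b1 b2 b3
    using U by (cases b1; cases b2; cases b3) (simp_all add: insert_commute)
  ultimately show ?thesis by metis
qed

lemma UNIV_3_neq:
  "(UNIV :: 3 set) \<noteq> {}" "(UNIV :: 3 set) \<noteq> {i}" "(UNIV :: 3 set) \<noteq> {i, j}"
proof -
  have pair: "(UNIV :: 3 set) \<noteq> {i, j}" for i j
  proof
    assume "(UNIV :: 3 set) = {i, j}"
    then have "card (UNIV :: 3 set) = card {i, j}" by simp
    moreover have "card {i, j} \<le> 2" by (simp add: card_insert_if)
    ultimately show False by simp
  qed
  then show "(UNIV :: 3 set) \<noteq> {i, j}" .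
  show "(UNIV :: 3 set) \<noteq> {i}" using pair[of i i] by simp
  show "(UNIV :: 3 set) \<noteq> {}" by simp
qed

lemmas set3_neq = UNIV_3_neq UNIV_3_neq[symmetric] three_distinct doubleton_eq_iff

lemma parts_mk [simp]:
  "part0 (mk p u v c) = p" "part1 (mk p u v c) = u" "part2 (mk p u v c) = v" "part3 (mk p u v c) = c"
  by (simp_all add: part0_def part1_def part2_def part3_def mk_def set3_neq tv_eq_iff)

lemma form_eqI:
  assumes "part0 \<omega> = part0 \<eta>" "part1 \<omega> = part1 \<eta>" "part2 \<omega> = part2 \<eta>" "part3 \<omega> = part3 \<eta>"
  shows "\<omega> = \<eta>"
proof -
  have "\<omega> $ S = \<eta> $ S" for S
    using subset_cases_3[of S] assms by (auto simp: part0_def part1_def part2_def part3_def tv_eq_iff)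
  then show ?thesis by (simp add: vec_eq_iff)
qed

lemma parts_add [simp]:
  "part0 (\<omega> + \<eta>) = part0 \<omega> + part0 \<eta>" "part1 (\<omega> + \<eta>) = part1 \<omega> + part1 \<eta>"
  "part2 (\<omega> + \<eta>) = part2 \<omega> + part2 \<eta>" "part3 (\<omega> + \<eta>) = part3 \<omega> + part3 \<eta>"
  by (simp_all add: part0_def part1_def part2_def part3_def tv_eq_iff)

lemma parts_zero [simp]: "part0 0 = 0" "part1 0 = 0" "part2 0 = 0" "part3 0 = 0"
  by (simp_all add: part0_def part1_def part2_def part3_def tv_eq_iff)

lemma parts_scale [simp]:
  "part0 (p *s \<omega>) = p * part0 \<omega>" "part1 (p *s \<omega>) = p *s part1 \<omega>"
  "part2 (p *s \<omega>) = p *s part2 \<omega>" "part3 (p *s \<omega>) = p * part3 \<omega>"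
  by (simp_all add: part0_def part1_def part2_def part3_def tv_eq_iff)

lemma wedge_sign_empty [simp]: "wedge_sign {} B = 1" "wedge_sign A {} = 1"
  by (simp_all add: wedge_sign_def)

lemma wedge_sign_more:
  "wedge_sign {3} {2} = (1::'a::comm_ring_1)" "wedge_sign {1} {3} = (-1::'a)" "wedge_sign {2} {1} = (-1::'a)"
  "wedge_sign {1} {2, 3} = (-1::'a)" "wedge_sign {2} {3, 1} = (1::'a)" "wedge_sign {3} {1, 2} = (1::'a)"
  "wedge_sign {2, 3} {1} = (-1::'a)" "wedge_sign {3, 1} {2} = (1::'a)" "wedge_sign {1, 2} {3} = (1::'a)"
proof -
  note o = three_order three_order_not three_distinct
  have 1: "{(a::3, b::3). a \<in> {3} \<and> b \<in> {2} \<and> b < a} = {}" using o by (auto simp only:)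
  have 2: "{(a::3, b::3). a \<in> {1} \<and> b \<in> {3} \<and> b < a} = {(1, 3)}" using o by (auto simp only:)
  have 3: "{(a::3, b::3). a \<in> {2} \<and> b \<in> {1} \<and> b < a} = {(2, 1)}" using o by (auto simp only:)
  have 4: "{(a::3, b::3). a \<in> {1} \<and> b \<in> {2, 3} \<and> b < a} = {(1, 3)}" using o by (auto simp only:)
  have 5: "{(a::3, b::3). a \<in> {2} \<and> b \<in> {3, 1} \<and> b < a} = {(2, 3), (2, 1)}" using o by (auto simp only:)
  have 6: "{(a::3, b::3). a \<in> {3} \<and> b \<in> {1, 2} \<and> b < a} = {}" using o by (auto simp only:)
  have 7: "{(a::3, b::3). a \<in> {2, 3} \<and> b \<in> {1} \<and> b < a} = {(2, 1)}" using o by (auto simp only:)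
  have 8: "{(a::3, b::3). a \<in> {3, 1} \<and> b \<in> {2} \<and> b < a} = {}" using o by (auto simp only:)
  have 9: "{(a::3, b::3). a \<in> {1, 2} \<and> b \<in> {3} \<and> b < a} = {(1, 3), (2, 3)}" using o by (auto simp only:)
  show "wedge_sign {3} {2} = (1::'a::comm_ring_1)" "wedge_sign {1} {3} = (-1::'a)" "wedge_sign {2} {1} = (-1::'a)"
    "wedge_sign {1} {2, 3} = (-1::'a)" "wedge_sign {2} {3, 1} = (1::'a)" "wedge_sign {3} {1, 2} = (1::'a)"
    "wedge_sign {2, 3} {1} = (-1::'a)" "wedge_sign {3, 1} {2} = (1::'a)" "wedge_sign {1, 2} {3} = (1::'a)"
    unfolding wedge_sign_def 1 2 3 4 5 6 7 8 9 using three_distinct by simp_all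
qed

lemma sum_subsets_3:
  "(\<Sum>S\<in>UNIV. h S) = h {} + h {1} + h {2} + h {3} + h {2, 3} + h {3, 1} + h {1, 2} + h (UNIV :: 3 set)"
  for h :: "3 set \<Rightarrow> 'b::comm_monoid_add"
proof -
  have U: "(UNIV :: 3 set set) = {{}, {1}, {2}, {3}, {2, 3}, {3, 1}, {1, 2}, UNIV}"
    using subset_cases_3 by blast
  show ?thesis
    by (subst (1) U) (simp add: set3_neq add.assoc)
qed

lemma wedge_nth_single: "(\<omega> \<^bold>\<and> \<eta>) $ {i} = \<omega> $ {} * \<eta> $ {i} + \<omega> $ {i} * \<eta> $ {}"
  by (simp add: wedge_def Pow_insert)

lemma wedge_nth_pair:
  assumes "i \<noteq> j"
  shows "(\<omega> \<^bold>\<and> \<eta>) $ {i, j} = \<omega> $ {} * \<eta> $ {i, j} + wedge_sign {i} {j} * \<omega> $ {i} * \<eta> $ {j}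
    + wedge_sign {j} {i} * \<omega> $ {j} * \<eta> $ {i} + \<omega> $ {i, j} * \<eta> $ {}"
proof -
  have "Pow {i, j} = {{}, {i}, {j}, {i, j}}" by (auto simp: Pow_insert)
  moreover have "{i, j} - {i} = {j}" "{i, j} - {j} = {i}" using assms by auto
  moreover have "{i} \<noteq> {i, j}" "{j} \<noteq> {i, j}" using assms by auto
  ultimately show ?thesis using assms by (simp add: wedge_def add.assoc)
qed

lemma wedge_nth_UNIV:
  "(\<omega> \<^bold>\<and> \<eta>) $ UNIV = \<omega> $ {} * \<eta> $ UNIV + \<omega> $ UNIV * \<eta> $ {}
    - \<omega> $ {1} * \<eta> $ {2, 3} + \<omega> $ {2} * \<eta> $ {3, 1} + \<omega> $ {3} * \<eta> $ {1, 2}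
    - \<omega> $ {2, 3} * \<eta> $ {1} + \<omega> $ {3, 1} * \<eta> $ {2} + \<omega> $ {1, 2} * \<eta> $ {3}"
proof -
  have d: "UNIV - {1::3} = {2, 3}" "UNIV - {2::3} = {3, 1}" "UNIV - {3::3} = {1, 2}"
    "UNIV - {2::3, 3} = {1}" "UNIV - {3::3, 1} = {2}" "UNIV - {1::3, 2} = {3}"
    using exhaust_3 three_distinct by blast+
  show ?thesis by (simp add: wedge_def sum_subsets_3 d wedge_sign_more)
qed

lemma parts_wedge:
  "part0 (\<omega> \<^bold>\<and> \<eta>) = part0 \<omega> * part0 \<eta>"
  "part1 (\<omega> \<^bold>\<and> \<eta>) = part0 \<omega> *s part1 \<eta> + part0 \<eta> *s part1 \<omega>"
  "part2 (\<omega> \<^bold>\<and> \<eta>) = part0 \<omega> *s part2 \<eta> + part0 \<eta> *s part2 \<omega> + cross (part1 \<omega>) (part1 \<eta>)"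
  "part3 (\<omega> \<^bold>\<and> \<eta>) = part0 \<omega> * part3 \<eta> + part0 \<eta> * part3 \<omega>
    + dot (part1 \<omega>) (part2 \<eta>) + dot (part2 \<omega>) (part1 \<eta>)"
proof -
  show "part0 (\<omega> \<^bold>\<and> \<eta>) = part0 \<omega> * part0 \<eta>" by (simp add: part0_def wedge_def)
  show "part1 (\<omega> \<^bold>\<and> \<eta>) = part0 \<omega> *s part1 \<eta> + part0 \<eta> *s part1 \<omega>"
    by (simp add: part0_def part1_def wedge_nth_single tv_eq_iff mult.commute)
  show "part2 (\<omega> \<^bold>\<and> \<eta>) = part0 \<omega> *s part2 \<eta> + part0 \<eta> *s part2 \<omega> + cross (part1 \<omega>) (part1 \<eta>)"
    by (simp add: part0_def part1_def part2_def cross_def wedge_nth_pair three_distinct wedge_sign_pairs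
        wedge_sign_more tv_eq_iff algebra_simps)
  show "part3 (\<omega> \<^bold>\<and> \<eta>) = part0 \<omega> * part3 \<eta> + part0 \<eta> * part3 \<omega>
    + dot (part1 \<omega>) (part2 \<eta>) + dot (part2 \<omega>) (part1 \<eta>)"
    by (simp add: part0_def part1_def part2_def part3_def dot_def wedge_nth_UNIV algebra_simps)
qed

lemma mk_add: "mk p u v c + mk p' u' v' c' = mk (p + p') (u + u') (v + v') (c + c')"
  by (rule form_eqI) simp_all

lemma mk_wedge:
  "mk p u v c \<^bold>\<and> mk p' u' v' c' = mk (p * p') (p *s u' + p' *s u)
    (p *s v' + p' *s v + cross u u') (p * c' + p' * c + dot u v' + dot v u')"
  by (rule form_eqI) (simp_all add: parts_wedge)

lemma of_poly_mk: "of_poly p = mk p 0 0 0"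
  by (rule form_eqI; unfold parts_mk)
    (simp_all add: of_poly_def part0_def part1_def part2_def part3_def axis_def tv_eq_iff)

lemma dx_mk: "dx i = mk 0 (axis i 1) 0 0"
  using exhaust_3[of i]
  by (intro form_eqI; unfold parts_mk)
    (auto simp: dx_def part0_def part1_def part2_def part3_def axis_def tv_eq_iff set3_neq)

definition grad :: "'a::comm_ring_1 mpoly3 \<Rightarrow> 'a mpoly3 ^ 3"
  where "grad p = tv (partial 1 p) (partial 2 p) (partial 3 p)"

lemma sum_axis: "(\<Sum>k\<in>UNIV. c k *s dx k) = mk 0 (tv (c 1) (c 2) (c 3)) 0 0"
  by (rule form_eqI) (simp_all add: sum_3 dx_mk tv_eq_iff axis_def)

lemma diff_mk: "diff p = mk 0 (grad p) 0 0"
  by (simp add: diff_def grad_def sum_axis)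

definition kphi :: "'b::comm_ring_1 ^ 3 \<Rightarrow> 'b ^ 3"
  where "kphi v = tv (v $ 3) (- 2 * v $ 2) (v $ 1)"

lemma coeff2_part2:
  "coeff2 2 3 \<omega> = part2 \<omega> $ 1" "coeff2 3 1 \<omega> = part2 \<omega> $ 2" "coeff2 1 2 \<omega> = part2 \<omega> $ 3"
  by (simp_all add: coeff2_def wedge_sign_pairs part2_def)

lemma phi_mk: "phi \<omega> = mk 0 (kphi (part2 \<omega>)) 0 0"
  by (rule form_eqI) (simp_all add: phi_def dx_mk coeff2_part2 kphi_def axis_def tv_eq_iff)

lemma vol_mk: "dx 1 \<^bold>\<and> dx 2 \<^bold>\<and> dx 3 = mk 0 0 0 1"
  by (simp add: dx_mk mk_wedge cross_def dot_def axis_def, rule form_eqI) (simp_all add: tv_eq_iff)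

lemma Omega_2_iff: "\<omega> \<in> Omega 2 \<longleftrightarrow> part0 \<omega> = 0 \<and> part1 \<omega> = 0 \<and> part3 \<omega> = 0"
proof
  assume "\<omega> \<in> Omega 2"
  then have "\<omega> $ S = 0" if "card S \<noteq> 2" for S using that by (auto simp: Omega_def)
  then show "part0 \<omega> = 0 \<and> part1 \<omega> = 0 \<and> part3 \<omega> = 0"
    by (simp add: part0_def part1_def part3_def tv_eq_iff)
next
  assume *: "part0 \<omega> = 0 \<and> part1 \<omega> = 0 \<and> part3 \<omega> = 0"
  have "card S = 2" if "\<omega> $ S \<noteq> 0" for S
    using subset_cases_3[of S] * that by (auto simp: part0_def part1_def part3_def tv_eq_iff)
  then show "\<omega> \<in> Omega 2" by (simp add: Omega_def)
qed

section \<open>The group action in coordinates\<close>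

text \<open>The action on the coefficients of a 1-form. The basis forms transform like the
  variables, so the coefficient matrix of \<open>rho\<close> enters transposed.\<close>

definition vec_action :: "'a::comm_ring_1 \<Rightarrow> 'a \<Rightarrow> 'a \<Rightarrow> 'a \<Rightarrow> 'a mpoly3 ^ 3 \<Rightarrow> 'a mpoly3 ^ 3"
  where "vec_action a b c d u =
    tv (Const a ^ 2 * subst (rho a b c d) (u $ 1) + Const a * Const c * subst (rho a b c d) (u $ 2)
        + Const c ^ 2 * subst (rho a b c d) (u $ 3))
      (2 * Const a * Const b * subst (rho a b c d) (u $ 1)
        + (Const a * Const d + Const b * Const c) * subst (rho a b c d) (u $ 2)
        + 2 * Const c * Const d * subst (rho a b c d) (u $ 3))
      (Const b ^ 2 * subst (rho a b c d) (u $ 1) + Const b * Const d * subst (rho a b c d) (u $ 2)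
        + Const d ^ 2 * subst (rho a b c d) (u $ 3))"

definition vec_invariants :: "('a::comm_ring_1 mpoly3 ^ 3) set"
  where "vec_invariants = {u. \<forall>a b c d. a * d - b * c = 1 \<longrightarrow> vec_action a b c d u = u}"

lemma group_SL2: "group (SL2 :: ('a::field^2^2) monoid)"
proof (rule groupI)
  fix g :: "'a^2^2" assume "g \<in> carrier SL2"
  then have g: "det g = 1" by (simp add: SL2_def)
  then have inv: "matrix_inv g ** g = mat 1" by (simp add: matrix_inv_inverse)
  then have "det (matrix_inv g) * det g = 1" by (metis det_I det_mul)
  with g inv show "\<exists>h\<in>carrier SL2. h \<otimes>\<^bsub>SL2\<^esub> g = \<one>\<^bsub>SL2\<^esub>"
    by (intro bexI[of _ "matrix_inv g"]) (simp_all add: SL2_def)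
qed (simp_all add: SL2_def det_mul matrix_mul_assoc)

lemma group_PSL2: "group (PSL2 :: ('a::field^2^2) set monoid)"
proof -
  interpret SL2: group "SL2 :: ('a^2^2) monoid" by (rule group_SL2)
  have det: "det (- mat 1 :: 'a^2^2) = 1" by (simp add: det_2 mat_def)
  have "subgroup {mat 1, - mat 1 :: 'a^2^2} SL2"
  proof (rule SL2.subgroupI)
    fix x :: "'a^2^2" assume x: "x \<in> {mat 1, - mat 1}"
    then have "x \<otimes>\<^bsub>SL2\<^esub> x = \<one>\<^bsub>SL2\<^esub>" "x \<in> carrier SL2"
      using det by (auto simp: SL2_def matrix_mult_minus)
    then have "inv\<^bsub>SL2\<^esub> x = x" by (intro SL2.inv_equality)
    then show "inv\<^bsub>SL2\<^esub> x \<in> {mat 1, - mat 1}" using x by simp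
  qed (use det in \<open>auto simp: SL2_def matrix_mult_minus\<close>)
  then have "{mat 1, - mat 1 :: 'a^2^2} \<lhd> SL2"
    by (intro SL2.normalI) (auto simp: r_coset_def l_coset_def SL2_def matrix_mult_minus)
  then show ?thesis unfolding PSL2_def by (rule normal.factorgroup_is_group)
qed

definition mat2 :: "'a::field \<Rightarrow> 'a \<Rightarrow> 'a \<Rightarrow> 'a \<Rightarrow> 'a^2^2"
  where "mat2 a b c d = vector [vector [a, b], vector [c, d]]"

lemma mat2_nth [simp]:
  "mat2 a b c d $ 1 $ 1 = a" "mat2 a b c d $ 1 $ 2 = b" "mat2 a b c d $ 2 $ 1 = c" "mat2 a b c d $ 2 $ 2 = d"
  by (simp_all add: mat2_def)

lemma mat2_mult:
  "mat2 a b c d ** mat2 a' b' c' d' = mat2 (a * a' + b * c') (a * b' + b * d') (c * a' + d * c') (c * b' + d * d')"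
  by (simp add: vec_eq_iff forall_2 matrix_matrix_mult_def sum_2)

lemma mat2_eta: "g = mat2 (g $ 1 $ 1) (g $ 1 $ 2) (g $ 2 $ 1) (g $ 2 $ 2)"
  by (simp add: vec_eq_iff forall_2)

lemma matrix_inv_mat2:
  assumes "a * d - b * c = 1"
  shows "matrix_inv (mat2 a b c d) = mat2 d (- b) (- c) a"
  by (rule matrix_inv_unique)
    (use assms in \<open>simp add: mat2_mult vec_eq_iff forall_2 mat_def algebra_simps\<close>)

lemma carrier_PSL2:
  "carrier PSL2 = {{g, - g} | g :: 'a::field^2^2. det g = 1}"
  by (auto simp: PSL2_def FactGroup_def RCOSETS_def r_coset_def SL2_def matrix_mult_minus)

lemma sorted_list_of_set_3:
  "sorted_list_of_set {i::3} = [i]" "sorted_list_of_set {2::3, 3} = [3, 2]"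
  "sorted_list_of_set {3::3, 1} = [3, 1]" "sorted_list_of_set {1::3, 2} = [1, 2]"
  "sorted_list_of_set (UNIV :: 3 set) = [3, 1, 2]"
proof -
  have U: "{3::3, 1, 2} = UNIV" unfolding UNIV_3 by auto
  show "sorted_list_of_set {i::3} = [i]" "sorted_list_of_set {2::3, 3} = [3, 2]"
    "sorted_list_of_set {3::3, 1} = [3, 1]" "sorted_list_of_set {1::3, 2} = [1, 2]"
    "sorted_list_of_set (UNIV :: 3 set) = [3, 1, 2]"
    by (subst sorted_list_of_set_unique[symmetric]; use three_order three_distinct U in auto)+
qed

text \<open>The dual action involves the inverse of C, hence the matrix is taken from the inverse
  coset. Under \<open>kphi\<close> the 2-form part transforms like a 1-form, which is the
  equivariance of phi.\<close>

lemma act_form_eq: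
  fixes C :: "('a::field^2^2) set"
  assumes C: "C \<in> carrier PSL2" and det: "a * d - b * c = 1"
    and inv: "inv\<^bsub>PSL2\<^esub> C = {mat2 a b c d, - mat2 a b c d}"
  shows "part0 (act_form C \<omega>) = subst (rho a b c d) (part0 \<omega>)"
    and "part1 (act_form C \<omega>) = vec_action a b c d (part1 \<omega>)"
    and "kphi (part2 (act_form C \<omega>)) = vec_action a b c d (kphi (part2 \<omega>))"
    and "part3 (act_form C \<omega>) = subst (rho a b c d) (part3 \<omega>)"
proof -
  interpret PSL2: group "PSL2 :: ('a^2^2) set monoid" by (rule group_PSL2)
  have act: "act_V (inv\<^bsub>PSL2\<^esub> C) v = mat2 a b c d ** v ** mat2 d (- b) (- c) a" for v
    using act_V_representative[OF PSL2.inv_closed[OF C], of "mat2 a b c d"] inv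
    by (simp add: matrix_inv_mat2[OF det])
  have basis: "vbasis $ 1 = mat2 0 (-1) 0 (0::'a)" "vbasis $ 2 = mat2 1 0 0 (- 1 :: 'a)" "vbasis $ 3 = mat2 0 0 1 (0::'a)"
    by (simp_all add: vbasis_def mat2_def)
  have coord: "xcoord 1 (mat2 x y z w) = - y" "xcoord 2 (mat2 x y z w) = x" "xcoord 3 (mat2 x y z w) = z"
    for x y z w :: 'a by (simp_all add: xcoord_def)
  let ?h = "\<lambda>i. act_dual C (xcoord i)"
  have h: "?h 1 (vbasis $ 1) = a ^ 2" "?h 1 (vbasis $ 2) = 2 * a * b" "?h 1 (vbasis $ 3) = b ^ 2"
    "?h 2 (vbasis $ 1) = a * c" "?h 2 (vbasis $ 2) = a * d + b * c" "?h 2 (vbasis $ 3) = b * d"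
    "?h 3 (vbasis $ 1) = c ^ 2" "?h 3 (vbasis $ 2) = 2 * c * d" "?h 3 (vbasis $ 3) = d ^ 2"
    by (simp_all add: act_dual_def act basis mat2_mult coord power2_eq_square algebra_simps)
  have "(\<lambda>i. lin_poly (?h i)) = rho a b c d"
    unfolding rho_def by (rule trip_eqI) (simp_all add: lin_poly_def sum_3 h lin_def)
  then have poly: "act_poly C p = subst (rho a b c d) p" for p by (simp add: act_poly_def)
  let ?A = "Const a" and ?B = "Const b" and ?C = "Const c" and ?D = "Const d"
  define \<theta> where "\<theta> i = lin_form (?h i)" for i
  have \<theta>: "\<theta> 1 = mk 0 (tv (?A ^ 2) (2 * ?A * ?B) (?B ^ 2)) 0 0"
    "\<theta> 2 = mk 0 (tv (?A * ?C) (?A * ?D + ?B * ?C) (?B * ?D)) 0 0"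
    "\<theta> 3 = mk 0 (tv (?C ^ 2) (2 * ?C * ?D) (?D ^ 2)) 0 0"
    by (simp_all add: \<theta>_def lin_form_def sum_axis h Const_simps)
  have wl: "wedge_list [mk p u v c] = mk p u v c" "wedge_list [] = mk 1 0 0 0"
    "wedge_list [mk p u v c, mk p' u' v' c'] = mk p u v c \<^bold>\<and> mk p' u' v' c'"
    "wedge_list [mk p u v c, mk p' u' v' c', mk p'' u'' v'' c''] = mk p u v c \<^bold>\<and> (mk p' u' v' c' \<^bold>\<and> mk p'' u'' v'' c'')"
    for p u v c p' u' v' c' p'' u'' v'' and c'' :: "'a mpoly3"
    by (simp_all add: wedge_list_def of_poly_mk mk_wedge)
  have Det: "?A * ?D - ?B * ?C = 1" using det by (simp flip: Const_simps)
  let ?s = "subst (rho a b c d)"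
  let ?\<omega>1 = "part1 \<omega>" and ?\<omega>2 = "part2 \<omega>"
  have co: "\<omega> $ {} = part0 \<omega>" "\<omega> $ {1} = ?\<omega>1 $ 1" "\<omega> $ {2} = ?\<omega>1 $ 2" "\<omega> $ {3} = ?\<omega>1 $ 3"
    "\<omega> $ {2, 3} = - ?\<omega>2 $ 1" "\<omega> $ {3, 1} = ?\<omega>2 $ 2" "\<omega> $ {1, 2} = ?\<omega>2 $ 3" "\<omega> $ UNIV = part3 \<omega>"
    by (simp_all add: part0_def part1_def part2_def part3_def)
  have expand: "act_form C \<omega> = ?s (part0 \<omega>) *s mk 1 0 0 0
      + ?s (?\<omega>1 $ 1) *s \<theta> 1 + ?s (?\<omega>1 $ 2) *s \<theta> 2 + ?s (?\<omega>1 $ 3) *s \<theta> 3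
      + (- ?s (?\<omega>2 $ 1)) *s (\<theta> 3 \<^bold>\<and> \<theta> 2) + ?s (?\<omega>2 $ 2) *s (\<theta> 3 \<^bold>\<and> \<theta> 1)
      + ?s (?\<omega>2 $ 3) *s (\<theta> 1 \<^bold>\<and> \<theta> 2) + ?s (part3 \<omega>) *s (\<theta> 3 \<^bold>\<and> (\<theta> 1 \<^bold>\<and> \<theta> 2))"
    unfolding act_form_def sum_subsets_3 sorted_list_of_set_3 poly \<theta>_def[symmetric] co
    by (simp add: wl \<theta> subst_hom)
  show "part0 (act_form C \<omega>) = ?s (part0 \<omega>)"
    unfolding expand \<theta> by (simp add: mk_wedge)
  show "part1 (act_form C \<omega>) = vec_action a b c d (part1 \<omega>)"
    unfolding expand \<theta> vec_action_def by (simp add: mk_wedge tv_eq_iff mult.commute)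
  \<comment> \<open>The determinant of the symmetric square is the cube of the determinant.\<close>
  have dots: "dot (tv (?C ^ 2) (2 * ?C * ?D) (?D ^ 2))
      (cross (tv (?A ^ 2) (2 * ?A * ?B) (?B ^ 2)) (tv (?A * ?C) (?A * ?D + ?B * ?C) (?B * ?D)))
      = (?A * ?D - ?B * ?C) ^ 3"
    unfolding dot_def cross_def tv_nth by algebra
  show "part3 (act_form C \<omega>) = ?s (part3 \<omega>)"
    unfolding expand \<theta> by (simp add: mk_wedge dots Det)
  \<comment> \<open>For determinant 1 the minors of the symmetric square are, up to order and
    constant factors, again entries of it.\<close>
  have c32: "cross (tv (?C ^ 2) (2 * ?C * ?D) (?D ^ 2)) (tv (?A * ?C) (?A * ?D + ?B * ?C) (?B * ?D))
      = tv (- (?D ^ 2)) (?C * ?D) (- (?C ^ 2))"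
    unfolding cross_def tv_eq_iff tv_nth using Det by (intro conjI; algebra)
  have c31: "cross (tv (?C ^ 2) (2 * ?C * ?D) (?D ^ 2)) (tv (?A ^ 2) (2 * ?A * ?B) (?B ^ 2))
      = tv (- 2 * ?B * ?D) (?A * ?D + ?B * ?C) (- 2 * ?A * ?C)"
    unfolding cross_def tv_eq_iff tv_nth using Det by (intro conjI; algebra)
  have c12: "cross (tv (?A ^ 2) (2 * ?A * ?B) (?B ^ 2)) (tv (?A * ?C) (?A * ?D + ?B * ?C) (?B * ?D))
      = tv (?B ^ 2) (- ?A * ?B) (?A ^ 2)"
    unfolding cross_def tv_eq_iff tv_nth using Det by (intro conjI; algebra)
  show "kphi (part2 (act_form C \<omega>)) = vec_action a b c d (kphi (part2 \<omega>))"
    unfolding expand \<theta> mk_wedge c32 c31 c12 vec_action_def kphi_def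
    by (simp add: tv_eq_iff subst_hom algebra_simps)
qed

context odd_card
begin

lemma kphi_inj: "kphi u = kphi v \<longleftrightarrow> u = (v :: 'a mpoly3 ^ 3)"
  using two_neq_0_mpoly3[OF two_neq_0] by (auto simp: kphi_def tv_eq_iff)

text \<open>The homogeneous parts are invariant separately. Inversion permutes the group, so the
  condition can be imposed for all matrices of determinant 1 directly.\<close>

lemma invariant_forms_iff:
  "\<omega> \<in> (invariant_forms :: 'a form set) \<longleftrightarrow> part0 \<omega> \<in> invariants \<and> part1 \<omega> \<in> vec_invariants
    \<and> kphi (part2 \<omega>) \<in> vec_invariants \<and> part3 \<omega> \<in> invariants" (is "_ \<longleftrightarrow> ?R")
proof -
  interpret PSL2: group "PSL2 :: ('a^2^2) set monoid" by (rule group_PSL2)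
  have iff: "act_form C \<omega> = \<omega> \<longleftrightarrow> subst (rho a b c d) (part0 \<omega>) = part0 \<omega>
      \<and> vec_action a b c d (part1 \<omega>) = part1 \<omega> \<and> vec_action a b c d (kphi (part2 \<omega>)) = kphi (part2 \<omega>)
      \<and> subst (rho a b c d) (part3 \<omega>) = part3 \<omega>"
    if "C \<in> carrier PSL2" "a * d - b * c = 1" "inv\<^bsub>PSL2\<^esub> C = {mat2 a b c d, - mat2 a b c d}" for C a b c d
    unfolding act_form_eq[OF that, symmetric] kphi_inj by (metis form_eqI)
  have det: "det (mat2 a b c d) = a * d - b * c" for a b c d :: 'a by (simp add: det_2)
  show ?thesis
  proof
    assume \<omega>: "\<omega> \<in> invariant_forms"
    have "subst (rho a b c d) (part0 \<omega>) = part0 \<omega>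
      \<and> vec_action a b c d (part1 \<omega>) = part1 \<omega> \<and> vec_action a b c d (kphi (part2 \<omega>)) = kphi (part2 \<omega>)
      \<and> subst (rho a b c d) (part3 \<omega>) = part3 \<omega>" if d: "a * d - b * c = 1" for a b c d
    proof -
      let ?D = "{mat2 a b c d, - mat2 a b c d}"
      have D: "?D \<in> carrier PSL2" using d det by (auto simp: carrier_PSL2)
      have "act_form (inv\<^bsub>PSL2\<^esub> ?D) \<omega> = \<omega>" using \<omega> D by (simp add: invariant_forms_def)
      then show ?thesis using iff[OF PSL2.inv_closed[OF D] d] PSL2.inv_inv[OF D] by simp
    qed
    then show ?R by (simp add: invariants_def vec_invariants_def)
  next
    assume R: ?R
    have "act_form C \<omega> = \<omega>" if C: "C \<in> carrier PSL2" for C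
    proof -
      obtain g where g: "det g = 1" "inv\<^bsub>PSL2\<^esub> C = {g, - g}"
        using PSL2.inv_closed[OF C] by (auto simp: carrier_PSL2)
      obtain a b c d where "g = mat2 a b c d" using mat2_eta by blast
      with g det R show ?thesis by (subst iff[OF C, of a d b c]) (auto simp: invariants_def vec_invariants_def)
    qed
    then show "\<omega> \<in> invariant_forms" by (simp add: invariant_forms_def)
  qed
qed

end

section \<open>Invariant vector fields\<close>

lemma kphi_linear: "kphi (u + v) = kphi u + kphi v" "kphi (p *s u) = p *s kphi u" "kphi 0 = 0"
  by (simp_all add: kphi_def tv_eq_iff algebra_simps)

lemma grad_Const [simp]: "grad (Const c) = 0"
  and grad_add: "grad (p + r) = grad p + grad r"
  and grad_mult: "grad (p * r) = p *s grad r + r *s grad p"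
  by (simp_all add: grad_def tv_eq_iff partial_add partial_mult algebra_simps)

lemma vec_action_linear:
  "vec_action a b c d (u + v) = vec_action a b c d u + vec_action a b c d v"
  "vec_action a b c d (u - v) = vec_action a b c d u - vec_action a b c d v"
  "vec_action a b c d (p *s u) = subst (rho a b c d) p *s vec_action a b c d u"
  "vec_action a b c d 0 = 0"
  by (simp_all add: vec_action_def tv_eq_iff subst_hom algebra_simps)

lemma vec_invariants_closed:
  "u \<in> vec_invariants \<Longrightarrow> v \<in> vec_invariants \<Longrightarrow> u + v \<in> vec_invariants"
  "u \<in> vec_invariants \<Longrightarrow> v \<in> vec_invariants \<Longrightarrow> u - v \<in> vec_invariants"
  "p \<in> invariants \<Longrightarrow> u \<in> vec_invariants \<Longrightarrow> p *s u \<in> vec_invariants"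
  "0 \<in> vec_invariants"
  by (auto simp: vec_invariants_def vec_action_linear invariants_def)

lemma invariants_0_1: "0 \<in> invariants" "1 \<in> invariants"
  by (simp_all add: invariants_def subst_hom)

text \<open>Equivariance of phi after the exterior product of 1-forms; in general the two sides
  differ by the factor a d - b c.\<close>

lemma cross_action:
  assumes "a * d - b * c = (1::'a::comm_ring_1)"
  shows "kphi (cross (vec_action a b c d u) (vec_action a b c d v)) = vec_action a b c d (kphi (cross u v))"
proof -
  have Det: "Const a * Const d - Const b * Const c = 1" using assms by (simp flip: Const_simps)
  have "kphi (cross (vec_action a b c d u) (vec_action a b c d v))
      = (Const a * Const d - Const b * Const c) *s vec_action a b c d (kphi (cross u v))"
    unfolding kphi_def cross_def vec_action_def tv_eq_iff tv_nth subst_hom vector_smult_component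
    by (intro conjI) (simp_all add: power2_eq_square algebra_simps)
  then show ?thesis by (simp add: Det)
qed

lemma cross_invariant:
  assumes "u \<in> vec_invariants" "v \<in> vec_invariants"
  shows "kphi (cross u v) \<in> vec_invariants"
proof -
  have "vec_action a b c d (kphi (cross u v)) = kphi (cross u v)" if "a * d - b * c = 1" for a b c d
    using cross_action[OF that, of u v] assms that by (simp add: vec_invariants_def)
  then show ?thesis by (simp add: vec_invariants_def)
qed

text \<open>Parity as a 1-form: the reflection also negates the basis form of x2, so the middle
  coefficient has the opposite parity.\<close>

definition even_vec :: "'a::comm_ring_1 mpoly3 ^ 3 \<Rightarrow> bool"
  where "even_vec u \<longleftrightarrow> even_poly (u $ 1) \<and> odd_poly (u $ 2) \<and> even_poly (u $ 3)"

definition odd_vec :: "'a::comm_ring_1 mpoly3 ^ 3 \<Rightarrow> bool"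
  where "odd_vec u \<longleftrightarrow> odd_poly (u $ 1) \<and> even_poly (u $ 2) \<and> odd_poly (u $ 3)"

lemma even_vec_grad: "even_poly p \<Longrightarrow> even_vec (grad p)"
  by (simp add: even_vec_def grad_def even_poly_partial)

lemma odd_vec_grad: "odd_poly p \<Longrightarrow> odd_vec (grad p)"
  by (simp add: odd_vec_def grad_def even_poly_def odd_poly_def partial_flip2 partial_uminus)

text \<open>The product of two even 1-forms is fixed by the reflection as a 2-form. Its parity
  changes when the coefficients are read as those of a 1-form, where the middle coefficient carries
  the sign.\<close>

lemma odd_vec_cross: "even_vec u \<Longrightarrow> even_vec v \<Longrightarrow> odd_vec (cross u v)"
  by (simp add: even_vec_def odd_vec_def cross_def even_poly_closed)

lemma odd_vec_kphi: "odd_vec u \<Longrightarrow> odd_vec (kphi u)"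
  by (simp add: odd_vec_def kphi_def) (simp add: even_poly_def odd_poly_def subst_hom)

lemma even_dot_odd_vec: "odd_vec u \<Longrightarrow> odd_vec v \<Longrightarrow> even_poly (dot u v)"
  by (simp add: odd_vec_def dot_def even_poly_closed)

context odd_card
begin

definition half :: "'a mpoly3" where "half = Const (1 / 2)"

lemma two_half: "2 * half = 1"
  using two_neq_0 by (simp add: half_def flip: Const_simps)

definition kinv :: "'a mpoly3 ^ 3 \<Rightarrow> 'a mpoly3 ^ 3"
  where "kinv u = tv (u $ 3) (- half * u $ 2) (u $ 1)"

lemma kphi_kinv [simp]: "kphi (kinv u) = u"
proof -
  have "2 * (half * x) = x" for x using two_half by (simp flip: mult.assoc)
  then show ?thesis by (simp add: kphi_def kinv_def tv_eq_iff)
qed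

lemma kinv_kphi [simp]: "kinv (kphi v) = v"
  by (metis kphi_inj kphi_kinv)

lemma kinv_linear: "kinv (u + v) = kinv u + kinv v" "kinv (p *s u) = p *s kinv u"
  by (simp_all add: kinv_def tv_eq_iff algebra_simps)

text \<open>The G-invariant symmetric form u1 w3 - u2 w2 / 2 + u3 w1, dual to the polar form of
  \<open>f1\<close>.\<close>

definition bil :: "'a mpoly3 ^ 3 \<Rightarrow> 'a mpoly3 ^ 3 \<Rightarrow> 'a mpoly3"
  where "bil u w = dot u (kinv w)"

lemma bil_kphi: "bil u (kphi v) = dot u v" "bil (kphi v) u = dot u v"
proof -
  show "bil u (kphi v) = dot u v" by (simp add: bil_def)
  have "2 * (half * x) = x" for x using two_half by (simp flip: mult.assoc)
  then have "x * (2 * half) * y = x * y" for x y by (simp add: two_half)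
  then show "bil (kphi v) u = dot u v"
    by (simp add: bil_def dot_def kphi_def kinv_def)
qed

lemma bil_linear: "bil (u + v) w = bil u w + bil v w" "bil (p *s u) w = p * bil u w"
  by (simp_all add: bil_def dot_linear)

lemma bil_action:
  assumes "a * d - b * c = (1::'a)"
  shows "bil (vec_action a b c d u) (vec_action a b c d v) = subst (rho a b c d) (bil u v)"
proof -
  have Det: "Const a * Const d - Const b * Const c = (1 :: 'a mpoly3)" using assms by (simp flip: Const_simps)
  have half: "subst (rho a b c d) half = half" by (simp add: half_def)
  show ?thesis
    unfolding bil_def dot_def kinv_def vec_action_def tv_nth subst_hom half
    using Det two_half by algebra
qed

lemma bil_invariant:
  assumes "u \<in> vec_invariants" "v \<in> vec_invariants"
  shows "bil u v \<in> invariants"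
proof -
  have "subst (rho a b c d) (bil u v) = bil u v" if "a * d - b * c = 1" for a b c d
    using bil_action[OF that, of u v] assms that by (simp add: vec_invariants_def)
  then show ?thesis by (simp add: invariants_def)
qed

lemma even_bil: "even_vec u \<Longrightarrow> even_vec v \<Longrightarrow> even_poly (bil u v)"
  by (simp add: bil_def dot_def kinv_def even_vec_def)
    (simp add: even_poly_def odd_poly_def subst_hom half_def)

lemma grad_invariant:
  assumes "p \<in> invariants"
  shows "grad p \<in> (vec_invariants :: ('a mpoly3 ^ 3) set)"
proof -
  have "vec_action a b c d (grad p) = grad p" if "a * d - b * c = 1" for a b c d
  proof -
    have "grad p = grad (subst (rho a b c d) p)" using invariantsD[OF assms that] by simp
    also have "\<dots> = vec_action a b c d (grad p)"
      by (simp add: grad_def vec_action_def tv_eq_iff chain_rule sum_3 rho_def partial_lin Const_simps algebra_simps)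
    finally show ?thesis by simp
  qed
  then show ?thesis by (simp add: vec_invariants_def)
qed

text \<open>The Binet-Cauchy identity for \<open>bil\<close>. It controls those 2-forms that arise
  as products of 1-forms.\<close>

lemma cross_cross_identity:
  "dot (kphi (cross u v)) (cross w w') = 2 * (bil u w * bil v w' - bil u w' * bil v w)"
  unfolding dot_def kphi_def cross_def bil_def kinv_def tv_nth using two_half by algebra

section \<open>The gradients of the basic invariants\<close>

definition J :: "3 \<Rightarrow> 'a mpoly3 ^ 3" where "J i = grad (fs i)"

definition N :: "3 \<Rightarrow> 'a mpoly3 ^ 3"
  where "N = trip (cross (J 2) (J 3)) (cross (J 3) (J 1)) (cross (J 1) (J 2))"

lemma fs_even_invariant: "fs i \<in> (invariants :: 'a mpoly3 set)" "even_poly (fs i :: 'a mpoly3)" "fs i \<in> A"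
  using exhaust_3[of i] f1_invariant f2_invariant f3_invariant even_f1 even_f2 even_f3
  by (auto simp: fs_def intro: poly_algebra.base)

lemma J_invariant: "J i \<in> vec_invariants"
  unfolding J_def by (intro grad_invariant fs_even_invariant)

lemma N_cross: "\<exists>j k. N i = cross (J j) (J k)"
  using exhaust_3[of i] by (elim disjE; simp add: N_def; blast)

lemma kphi_N_invariant: "kphi (N i) \<in> vec_invariants"
  using N_cross[of i] cross_invariant J_invariant by metis

lemma even_J: "even_vec (J i)"
  unfolding J_def by (intro even_vec_grad fs_even_invariant)

lemma odd_N: "odd_vec (N i)"
  using N_cross[of i] odd_vec_cross even_J by metis

lemma f4_dot: "f4 = dot (J 1) (N 1)"
  by (simp add: f4_def det_3 dot_def N_def cross_def J_def fs_def grad_def algebra_simps)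

text \<open>Determinants with a repeated row vanish, so the J and the N are dual to each other up to
  \<open>f4\<close>.\<close>

lemma dot_J_N: "dot (J i) (N j) = (if i = j then f4 else 0)"
  using exhaust_3[of i] exhaust_3[of j]
  by (auto simp: f4_dot N_def dot_def cross_def algebra_simps)

lemma dot_N_invariant: "u \<in> vec_invariants \<Longrightarrow> dot u (N i) \<in> invariants"
  using bil_invariant[OF _ kphi_N_invariant] by (simp add: bil_kphi)

lemma f4_invariant: "f4 \<in> (invariants :: 'a mpoly3 set)"
  using dot_N_invariant[OF J_invariant, of 1 1] by (simp add: f4_dot)

lemma const_term_other_factors: "x \<in> L \<Longrightarrow> const_term (other_factors x) = 0"
proof -
  assume "x \<in> L"
  then have "card (L - {x}) = card (L :: ('a \<times> 'a) set) - 1" by (simp add: card_Diff_singleton)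
  then have "L - {x} \<noteq> {}" using card_L_gt_1 by (metis card.empty less_not_refl zero_less_diff)
  then show "const_term (other_factors x) = 0"
    by (simp add: other_factors_def const_term_hom case_prod_beta power_0_left)
qed

text \<open>Each \<open>fs i\<close> has only terms of degree at least 2. This is the source of the
  vanishing constant terms in the minimality argument.\<close>

lemma const_term_J: "const_term (J i $ k) = 0"
proof -
  have "0 < CARD('a)" by simp
  then have "const_term (grad f1 $ k) = (0::'a)" "const_term (grad f2 $ k) = (0::'a)" "const_term (grad f3 $ k) = (0::'a)"
    using exhaust_3[of k]
    by (auto simp: grad_def partial_f1 partial_f2 partial_f3 const_term_hom const_term_other_factors power_0_left)
  then show ?thesis using exhaust_3[of i] by (auto simp: J_def fs_def)
qed

lemma const_term_cross: "const_term (cross u (J i) $ k) = 0" "const_term (dot u (J i)) = 0"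
  using exhaust_3[of k] by (auto simp: cross_def dot_def const_term_hom const_term_J)

lemma const_term_N: "const_term (N i $ k) = 0"
  using N_cross[of i] const_term_cross by metis

lemma const_term_dot_N: "const_term (dot u (N i)) = 0"
  by (simp add: dot_def const_term_hom const_term_N)

lemma const_term_bil_J: "const_term (bil u (J i)) = 0"
  by (simp add: bil_def dot_def kinv_def const_term_hom const_term_J)

section \<open>Cramer's rule and the generators of the invariant 1-forms\<close>

lemma cramer: "f4 *s u = dot u (N 1) *s J 1 + dot u (N 2) *s J 2 + dot u (N 3) *s J 3"
  unfolding f4_dot dot_def N_def cross_def trip_simps tv_eq_iff tv_nth
  by (simp add: algebra_simps)

lemma cramer_dual: "f4 *s v = dot (J 1) v *s N 1 + dot (J 2) v *s N 2 + dot (J 3) v *s N 3"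
  unfolding f4_dot dot_def N_def cross_def trip_simps tv_eq_iff tv_nth
  by (simp add: algebra_simps)

lemma vec_scale_cancel: "f4 *s u = f4 *s v \<longleftrightarrow> u = (v :: 'a mpoly3 ^ 3)"
  using f4_neq_0 by (simp add: tv_eq_iff)

lemma invariant_split:
  assumes "p \<in> invariants"
  obtains e r where "p + subst flip2 p = e" "p - subst flip2 p = f4 * r"
    "e \<in> invariants" "even_poly (e :: 'a mpoly3)" "r \<in> invariants" "even_poly r"
proof -
  have "p - subst flip2 p \<in> invariants" "odd_poly (p - subst flip2 p)"
    using assms flip2_invariants by (auto intro: invariants_ring simp: odd_poly_def subst_hom subst_flip2_flip2)
  then obtain r where "p - subst flip2 p = f4 * r" "r \<in> invariants" "even_poly r"
    using f4_dvd[OF f4_invariant] by blast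
  moreover have "p + subst flip2 p \<in> invariants" "even_poly (p + subst flip2 p)"
    using assms flip2_invariants
    by (auto intro: invariants_ring simp: even_poly_def subst_hom subst_flip2_flip2 add.commute)
  ultimately show ?thesis using that by blast
qed

lemma invariant_decomposition:
  assumes "p \<in> invariants"
  obtains e r where "p = e + f4 * r" "e \<in> A" "r \<in> A"
proof -
  obtain e r where er: "p + subst flip2 p = e" "p - subst flip2 p = f4 * r"
    "e \<in> invariants" "even_poly e" "r \<in> invariants" "even_poly r" by (rule invariant_split[OF assms])
  have "2 * p = e + f4 * r" unfolding er(1,2)[symmetric] by simp
  then have "half * (2 * p) = half * e + f4 * (half * r)" by (simp add: algebra_simps)
  moreover have "half * (2 * p) = p" by (metis mult.assoc mult.commute mult_1 two_half)
  moreover have "half * x \<in> A" if "x \<in> A" for x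
    using that unfolding half_def by (intro poly_algebra.mult poly_algebra.Const)
  ultimately show ?thesis using that er even_invariant_in_A by metis
qed

lemma even_f4_mult_imp_odd: "even_poly (f4 * p) \<Longrightarrow> odd_poly (p :: 'a mpoly3)"
proof -
  assume "even_poly (f4 * p)"
  then have "subst flip2 f4 * subst flip2 p = f4 * p" by (simp add: even_poly_def subst_hom)
  then have "- (f4 * subst flip2 p) = f4 * p" using odd_f4 by (simp add: odd_poly_def)
  then have "f4 * subst flip2 p = f4 * (- p)"
    unfolding mult_minus_right by (rule sym[OF iffD1[OF minus_equation_iff]])
  then show "odd_poly p" using f4_neq_0 unfolding odd_poly_def by (simp only: mult_cancel_left) auto
qed

lemma vec_invariants_generators:
  assumes u: "u \<in> vec_invariants"
  shows "\<exists>(b :: 3 \<Rightarrow> _) (d :: 3 \<Rightarrow> _). (\<forall>i. b i \<in> A) \<and> (\<forall>i. d i \<in> A) \<and> u = b 1 *s J 1 + b 2 *s J 2 + b 3 *s J 3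
      + d 1 *s kphi (N 1) + d 2 *s kphi (N 2) + d 3 *s kphi (N 3)"
proof -
  have "\<exists>e r. dot u (N i) = e + f4 * r \<and> e \<in> A \<and> r \<in> A" for i
    using invariant_decomposition[OF dot_N_invariant[OF u]] by metis
  then obtain e b where eb: "\<And>i. dot u (N i) = e i + f4 * b i" "\<And>i. e i \<in> A" "\<And>i. b i \<in> A" by metis
  \<comment> \<open>The subtracted combination accounts for the multiples of \<open>f4\<close> in
    all pairings with the \<open>N i\<close>; those of \<open>u'\<close> are the even invariants
    \<open>e i\<close>.\<close>
  define u' where "u' = u - (b 1 *s J 1 + b 2 *s J 2 + b 3 *s J 3)"
  have "f4 *s u = (e 1 *s J 1 + e 2 *s J 2 + e 3 *s J 3) + f4 *s (b 1 *s J 1 + b 2 *s J 2 + b 3 *s J 3)"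
    unfolding cramer[of u] eb(1) by (simp add: tv_eq_iff algebra_simps)
  then have f4u': "f4 *s u' = e 1 *s J 1 + e 2 *s J 2 + e 3 *s J 3"
    by (simp add: u'_def tv_eq_iff algebra_simps)
  have bI: "b i \<in> invariants" for i using A_even_invariant eb by blast
  have u'I: "u' \<in> vec_invariants" unfolding u'_def
    by (intro vec_invariants_closed u bI J_invariant)
  have "\<exists>d\<in>A. bil u' (J i) = f4 * d" for i
  proof -
    have "f4 * bil u' (J i) = e 1 * bil (J 1) (J i) + e 2 * bil (J 2) (J i) + e 3 * bil (J 3) (J i)"
      by (simp add: f4u' bil_linear flip: bil_linear(2)[of f4])
    \<comment> \<open>The \<open>e i\<close> and the values of \<open>bil\<close> on two gradients
      are even. As \<open>f4\<close> is odd, \<open>bil u' (J i)\<close> has to be odd, hence is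
      divisible by \<open>f4\<close>.\<close>
    moreover have "even_poly \<dots>"
      using A_even_invariant eb(2) even_bil even_J by (intro even_poly_closed) auto
    ultimately have "odd_poly (bil u' (J i))" by (simp add: even_f4_mult_imp_odd)
    then show ?thesis
      using f4_dvd[OF f4_invariant bil_invariant[OF u'I J_invariant]] even_invariant_in_A by metis
  qed
  then obtain d where d: "\<And>i. d i \<in> A" "\<And>i. bil u' (J i) = f4 * d i" by metis
  have sym: "dot (J i) (kinv u') = bil u' (J i)" for i
    using bil_kphi(2)[of "kinv u'" "J i"] by simp
  have "f4 *s kinv u' = f4 *s (d 1 *s N 1 + d 2 *s N 2 + d 3 *s N 3)"
    unfolding cramer_dual[of "kinv u'"] sym d(2) by (simp add: tv_eq_iff algebra_simps)
  then have "kinv u' = d 1 *s N 1 + d 2 *s N 2 + d 3 *s N 3" by (simp only: vec_scale_cancel)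
  then have "u' = kphi (d 1 *s N 1 + d 2 *s N 2 + d 3 *s N 3)" by (metis kphi_kinv)
  then have "u = b 1 *s J 1 + b 2 *s J 2 + b 3 *s J 3
      + d 1 *s kphi (N 1) + d 2 *s kphi (N 2) + d 3 *s kphi (N 3)"
    by (simp add: u'_def kphi_linear diff_eq_eq add_ac)
  then show ?thesis using eb(3) d(1) by (intro exI[of _ b] exI[of _ d]) simp
qed

section \<open>Generation\<close>

text \<open>The generators in coordinates, with each triple indexed so that one argument serves all
  its members.\<close>

definition gens :: "'a form set"
  where "gens = range (\<lambda>i. of_poly (fs i)) \<union> {of_poly f4} \<union> range (\<lambda>i. mk 0 (J i) 0 0)
    \<union> range (\<lambda>i. mk 0 (kphi (N i)) 0 0) \<union> range (\<lambda>i. mk 0 0 (kinv (J i)) 0) \<union> {mk 0 0 0 1}"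

lemma phi_inv_diff: "phi_inv (diff p) = mk 0 0 (kinv (grad p)) 0"
  unfolding phi_inv_def
proof (rule inv_into_f_eq)
  show "inj_on phi (Omega 2 :: 'a form set)"
  proof (rule inj_onI)
    fix \<omega> \<eta> :: "'a form"
    assume *: "\<omega> \<in> Omega 2" "\<eta> \<in> Omega 2" "phi \<omega> = phi \<eta>"
    then have "kphi (part2 \<omega>) = kphi (part2 \<eta>)" by (metis phi_mk parts_mk(2))
    with * show "\<omega> = \<eta>" by (intro form_eqI) (simp_all add: kphi_inj Omega_2_iff)
  qed
qed (simp_all add: Omega_2_iff phi_mk diff_mk)

lemma gens_eq:
  "{of_poly f1, of_poly f2, of_poly f3, of_poly f4,
     diff f1, diff f2, diff f3,
     phi (diff f2 \<^bold>\<and> diff f3), phi (diff f3 \<^bold>\<and> diff f1), phi (diff f1 \<^bold>\<and> diff f2),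
     phi_inv (diff f1), phi_inv (diff f2), phi_inv (diff f3),
     dx 1 \<^bold>\<and> dx 2 \<^bold>\<and> dx 3} = gens"
proof -
  have range: "range h = {h 1, h 2, h 3}" for h :: "3 \<Rightarrow> 'a form"
    by (metis UNIV_3 image_empty image_insert)
  have grads: "grad f1 = J 1" "grad f2 = J 2" "grad f3 = J 3" by (simp_all add: J_def fs_def)
  have "phi (diff f2 \<^bold>\<and> diff f3) = mk 0 (kphi (N 1)) 0 0" "phi (diff f3 \<^bold>\<and> diff f1) = mk 0 (kphi (N 2)) 0 0"
    "phi (diff f1 \<^bold>\<and> diff f2) = mk 0 (kphi (N 3)) 0 0"
    by (simp_all add: phi_mk diff_mk mk_wedge grads N_def)
  note phis = this
  show ?thesis
    unfolding gens_def range phi_inv_diff phis vol_mk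
    unfolding diff_mk grads
    by (simp only: fs_def trip_simps Un_insert_left Un_empty_left)
qed

lemma generated_algebra_subset:
  assumes "\<omega> \<in> generated_algebra B" "\<And>c. of_poly (Const c) \<in> T" "B \<subseteq> T"
    "\<And>\<omega> \<eta>. \<omega> \<in> T \<Longrightarrow> \<eta> \<in> T \<Longrightarrow> \<omega> + \<eta> \<in> T" "\<And>\<omega> \<eta>. \<omega> \<in> T \<Longrightarrow> \<eta> \<in> T \<Longrightarrow> \<omega> \<^bold>\<and> \<eta> \<in> T"
  shows "\<omega> \<in> T"
  using assms(1) by induction (use assms(2-5) in auto)

lemma invariant_forms_closed:
  "of_poly (Const c) \<in> (invariant_forms :: 'a form set)"
  "\<omega> \<in> invariant_forms \<Longrightarrow> \<eta> \<in> invariant_forms \<Longrightarrow> \<omega> + \<eta> \<in> (invariant_forms :: 'a form set)"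
  "\<omega> \<in> invariant_forms \<Longrightarrow> \<eta> \<in> invariant_forms \<Longrightarrow> \<omega> \<^bold>\<and> \<eta> \<in> (invariant_forms :: 'a form set)"
proof -
  show "of_poly (Const c) \<in> (invariant_forms :: 'a form set)"
    by (simp add: invariant_forms_iff of_poly_mk kphi_linear vec_invariants_closed invariants_0_1 invariants_ring)
  show "\<omega> \<in> invariant_forms \<Longrightarrow> \<eta> \<in> invariant_forms \<Longrightarrow> \<omega> + \<eta> \<in> (invariant_forms :: 'a form set)"
    by (simp add: invariant_forms_iff kphi_linear vec_invariants_closed invariants_ring)
  have dot: "dot u v \<in> invariants" "dot v u \<in> invariants"
    if "u \<in> vec_invariants" "kphi v \<in> vec_invariants" for u v :: "'a mpoly3 ^ 3"
    using bil_invariant[OF that] by (simp_all add: bil_kphi) (simp add: dot_def mult.commute)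
  show "\<omega> \<in> invariant_forms \<Longrightarrow> \<eta> \<in> invariant_forms \<Longrightarrow> \<omega> \<^bold>\<and> \<eta> \<in> (invariant_forms :: 'a form set)"
    by (simp add: invariant_forms_iff parts_wedge kphi_linear vec_invariants_closed invariants_ring
        cross_invariant dot)
qed

lemma gens_invariant: "gens \<subseteq> invariant_forms"
  by (auto simp: gens_def invariant_forms_iff of_poly_mk kphi_linear vec_invariants_closed invariants_0_1
      fs_even_invariant f4_invariant J_invariant kphi_N_invariant)

lemma invariant_forms_generated:
  assumes "\<omega> \<in> (invariant_forms :: 'a form set)"
  shows "\<omega> \<in> generated_algebra gens"
proof -
  let ?S = "generated_algebra gens"
  have gen: "of_poly (fs i) \<in> ?S" "of_poly f4 \<in> ?S" "mk 0 (J i) 0 0 \<in> ?S" "mk 0 (kphi (N i)) 0 0 \<in> ?S"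
    "mk 0 0 (kinv (J i)) 0 \<in> ?S" "mk 0 0 0 1 \<in> ?S" for i
    by (rule generated_algebra.base, simp add: gens_def)+
  \<comment> \<open>Only the images under phi of these 2-forms are generators; the 2-forms
    themselves are products of two differentials.\<close>
  have gen_N: "mk 0 0 (N i) 0 \<in> ?S" for i
  proof -
    obtain j k where "N i = cross (J j) (J k)" using N_cross by blast
    then have "mk 0 0 (N i) 0 = mk 0 (J j) 0 0 \<^bold>\<and> mk 0 (J k) 0 0" by (simp add: mk_wedge)
    then show ?thesis using generated_algebra.mult gen(3) by metis
  qed
  have A: "of_poly p \<in> ?S" if "p \<in> A" for p
    using that
  proof induction
    case (base p)
    then show ?case using gen(1)[of 1] gen(1)[of 2] gen(1)[of 3] by (auto simp: fs_def)
  next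
    case (add p r)
    then show ?case using generated_algebra.add[of "of_poly p" gens "of_poly r"] by (simp add: of_poly_mk mk_add)
  next
    case (mult p r)
    then show ?case using generated_algebra.mult[of "of_poly p" gens "of_poly r"] by (simp add: of_poly_mk mk_wedge)
  qed (rule generated_algebra.scalar)
  have inv: "of_poly p \<in> ?S" if p: "p \<in> invariants" for p
  proof -
    obtain e r where "p = e + f4 * r" "e \<in> A" "r \<in> A" by (rule invariant_decomposition[OF p])
    then have "of_poly p = of_poly e + of_poly f4 \<^bold>\<and> of_poly r" by (simp add: of_poly_mk mk_wedge mk_add)
    then show ?thesis using A \<open>e \<in> A\<close> \<open>r \<in> A\<close> gen(2) by (metis generated_algebra.add generated_algebra.mult)
  qed
  have scale: "mk 0 (p *s u) (p *s v) (p * c) \<in> ?S" if "p \<in> A" "mk 0 u v c \<in> ?S" for p u v c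
    using generated_algebra.mult[OF A[OF that(1)] that(2)] by (simp add: of_poly_mk mk_wedge)
  have scale1: "mk 0 (p *s u) 0 0 \<in> ?S" if "p \<in> A" "mk 0 u 0 0 \<in> ?S" for p u
    using scale[OF that] by (simp add: tv_eq_iff[symmetric])
  have scale2: "mk 0 0 (p *s u) 0 \<in> ?S" if "p \<in> A" "mk 0 0 u 0 \<in> ?S" for p u
    using scale[OF that] by (simp add: tv_eq_iff[symmetric])
  have add1: "mk 0 (u + v) 0 0 \<in> ?S" if "mk 0 u 0 0 \<in> ?S" "mk 0 v 0 0 \<in> ?S" for u v
    using generated_algebra.add[OF that] by (simp add: mk_add)
  have add2: "mk 0 0 (u + v) 0 \<in> ?S" if "mk 0 0 u 0 \<in> ?S" "mk 0 0 v 0 \<in> ?S" for u v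
    using generated_algebra.add[OF that] by (simp add: mk_add)
  have one: "mk 0 u 0 0 \<in> ?S" if u: "u \<in> vec_invariants" for u
  proof -
    obtain b d :: "3 \<Rightarrow> 'a mpoly3" where bd: "\<And>i. b i \<in> A" "\<And>i. d i \<in> A" "u = b 1 *s J 1 + b 2 *s J 2 + b 3 *s J 3
      + d 1 *s kphi (N 1) + d 2 *s kphi (N 2) + d 3 *s kphi (N 3)"
      using vec_invariants_generators[OF u] by metis
    show ?thesis unfolding bd(3) by (intro add1 scale1 bd gen)
  qed
  have two: "mk 0 0 v 0 \<in> ?S" if v: "kphi v \<in> vec_invariants" for v
  proof -
    obtain b d :: "3 \<Rightarrow> 'a mpoly3" where bd: "\<And>i. b i \<in> A" "\<And>i. d i \<in> A" "kphi v = b 1 *s J 1 + b 2 *s J 2 + b 3 *s J 3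
      + d 1 *s kphi (N 1) + d 2 *s kphi (N 2) + d 3 *s kphi (N 3)"
      using vec_invariants_generators[OF v] by metis
    have "v = kinv (kphi v)" by simp
    also have "\<dots> = b 1 *s kinv (J 1) + b 2 *s kinv (J 2) + b 3 *s kinv (J 3)
      + d 1 *s N 1 + d 2 *s N 2 + d 3 *s N 3"
      unfolding bd(3) by (simp add: kinv_linear)
    finally show ?thesis using bd gen gen_N by (metis add2 scale2)
  qed
  have three: "mk 0 0 0 c \<in> ?S" if "c \<in> invariants" for c
    using generated_algebra.mult[OF inv[OF that] gen(6)] by (simp add: of_poly_mk mk_wedge)
  have "\<omega> = of_poly (part0 \<omega>) + mk 0 (part1 \<omega>) 0 0 + mk 0 0 (part2 \<omega>) 0 + mk 0 0 0 (part3 \<omega>)"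
    by (rule form_eqI) (simp_all add: of_poly_mk)
  then show ?thesis
    using assms inv one two three unfolding invariant_forms_iff by (metis generated_algebra.add)
qed

section \<open>Minimality\<close>

text \<open>The odd part of an invariant is always a multiple of \<open>f\<^sub>4\<close>; being reduced only restricts the
  constant term of the cofactor.\<close>

definition reduced :: "'a mpoly3 \<Rightarrow> bool"
  where "reduced p \<longleftrightarrow> p \<in> invariants \<and> (\<exists>y. p - subst flip2 p = f4 * y \<and> const_term y = 0)"

lemma not_reduced_f4: "\<not> reduced f4"
proof
  assume "reduced f4"
  then obtain y :: "'a mpoly3" where y: "f4 - subst flip2 f4 = f4 * y" "const_term y = 0"
    by (auto simp: reduced_def)
  have "f4 * 2 = f4 * y" using y(1) odd_f4 by (simp add: odd_poly_def)
  then have "y = 2" using f4_neq_0 by simp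
  then show False using y(2) two_neq_0 by (simp add: const_term_hom)
qed

lemma reduced_even: "p \<in> invariants \<Longrightarrow> even_poly p \<Longrightarrow> reduced p"
  by (auto simp: reduced_def even_poly_def const_term_hom intro: exI[of _ 0])

lemma reduced_0: "reduced 0"
  by (rule reduced_even) (simp_all add: invariants_0_1 even_poly_def subst_hom)

lemma reduced_add:
  assumes "reduced p" "reduced r"
  shows "reduced (p + r)"
proof -
  obtain y z where "p - subst flip2 p = f4 * y" "const_term y = 0" "r - subst flip2 r = f4 * z" "const_term z = 0"
    using assms by (auto simp: reduced_def)
  moreover have "p + r - subst flip2 (p + r) = (p - subst flip2 p) + (r - subst flip2 r)"
    by (simp add: subst_hom)
  ultimately have "p + r - subst flip2 (p + r) = f4 * (y + z)" "const_term (y + z) = 0"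
    by (simp_all add: distrib_left const_term_hom)
  then show ?thesis using assms by (auto simp: reduced_def invariants_ring)
qed

lemma const_term_flip2: "const_term (subst flip2 p) = const_term p"
proof (rule const_term_subst)
  show "const_term (flip2 i) = 0" for i using exhaust_3[of i] by (auto simp: const_term_hom)
qed

text \<open>Writing s for the reflection, p r - s(p r) = p (r - s r) + (p - s p) s r. The first
  cofactor of \<open>f4\<close> has constant term 0 because r is reduced, the second because r
  vanishes at the origin.\<close>

lemma reduced_mult:
  assumes p: "p \<in> invariants" and r: "reduced r" "const_term r = 0"
  shows "reduced (p * r)"
proof -
  obtain y where y: "r - subst flip2 r = f4 * y" "const_term y = 0" using r by (auto simp: reduced_def)
  obtain e s where s: "p - subst flip2 p = f4 * s" by (rule invariant_split[OF p])
  have "p * r - subst flip2 (p * r) = p * (r - subst flip2 r) + (p - subst flip2 p) * subst flip2 r"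
    by (simp add: subst_hom algebra_simps)
  also have "\<dots> = f4 * (p * y + s * subst flip2 r)" unfolding y s by (simp add: algebra_simps)
  finally show ?thesis
    using p r y by (auto simp: reduced_def invariants_ring const_term_hom const_term_flip2
        intro!: exI[of _ "p * y + s * subst flip2 r"])
qed

text \<open>In the same twisted product rule each cofactor is now multiplied by a polynomial that
  vanishes at the origin.\<close>

lemma reduced_prod:
  assumes "p \<in> invariants" "const_term p = 0" "r \<in> invariants" "const_term r = 0"
  shows "reduced (p * r)"
proof -
  obtain s where s: "p - subst flip2 p = f4 * s" using invariant_split[OF assms(1)] by metis
  obtain t where t: "r - subst flip2 r = f4 * t" using invariant_split[OF assms(3)] by metis
  have "p * r - subst flip2 (p * r) = p * (r - subst flip2 r) + (p - subst flip2 p) * subst flip2 r"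
    by (simp add: subst_hom algebra_simps)
  also have "\<dots> = f4 * (p * t + s * subst flip2 r)" unfolding s t by (simp add: algebra_simps)
  finally show ?thesis
    using assms by (auto simp: reduced_def invariants_ring const_term_hom const_term_flip2
        intro!: exI[of _ "p * t + s * subst flip2 r"])
qed

lemma reduced_minus: "reduced p \<Longrightarrow> const_term p = 0 \<Longrightarrow> reduced (- p)"
  using reduced_mult[OF invariants_ring(1)[of "- 1"], of p] by (simp add: Const_simps)

lemma irredundantI:
  assumes "\<And>c. of_poly (Const c) \<in> T" "\<And>\<eta>. \<eta> \<in> gens \<Longrightarrow> \<eta> \<noteq> \<omega> \<Longrightarrow> \<eta> \<in> T"
    "\<And>\<eta> \<eta>'. \<eta> \<in> T \<Longrightarrow> \<eta>' \<in> T \<Longrightarrow> \<eta> + \<eta>' \<in> T" "\<And>\<eta> \<eta>'. \<eta> \<in> T \<Longrightarrow> \<eta>' \<in> T \<Longrightarrow> \<eta> \<^bold>\<and> \<eta>' \<in> T"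
    "\<omega> \<in> gens" "\<omega> \<notin> T"
  shows "generated_algebra (gens - {\<omega>}) \<noteq> invariant_forms"
proof
  assume "generated_algebra (gens - {\<omega>}) = invariant_forms"
  then have "\<omega> \<in> generated_algebra (gens - {\<omega>})" using assms(5) gens_invariant by blast
  then have "\<omega> \<in> T" by (rule generated_algebra_subset) (use assms in auto)
  with assms(6) show False by blast
qed

text \<open>The function part of a product depends only on the function parts of the factors, so
  without \<open>f4\<close> only even polynomials arise in it.\<close>

lemma irredundant_f4: "generated_algebra (gens - {of_poly f4}) \<noteq> invariant_forms"
proof (rule irredundantI[where T = "{\<omega> :: 'a form. even_poly (part0 \<omega>)}"])
  have "subst flip2 (f4 :: 'a mpoly3) \<noteq> f4"
  proof
    assume "subst flip2 (f4 :: 'a mpoly3) = f4"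
    then have "f4 + f4 = (0 :: 'a mpoly3)" using odd_f4 by (metis odd_poly_def add.right_inverse)
    then show False using f4_neq_0 two_neq_0_mpoly3[OF two_neq_0] by (metis mult_2 mult_eq_0_iff)
  qed
  then show "of_poly f4 \<notin> {\<omega> :: 'a form. even_poly (part0 \<omega>)}" by (simp add: of_poly_mk even_poly_def)
  have "even_poly (0 :: 'a mpoly3)" by (simp add: even_poly_def subst_hom)
  then show "\<eta> \<in> {\<omega> :: 'a form. even_poly (part0 \<omega>)}" if "\<eta> \<in> gens" "\<eta> \<noteq> of_poly f4" for \<eta>
    using that fs_even_invariant by (auto simp: gens_def of_poly_mk)
qed (auto simp: of_poly_mk parts_wedge even_poly_closed gens_def)

text \<open>Pairing the gradient of the function part with \<open>N i\<close> is a derivation. It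
  sends \<open>fs i\<close> to \<open>f4\<close>, the other two to 0, and \<open>f4\<close> to an
  even invariant, as its gradient and \<open>N i\<close> are both odd.\<close>

lemma irredundant_fs: "generated_algebra (gens - {of_poly (fs i)}) \<noteq> invariant_forms"
proof (rule irredundantI[where T = "{\<omega> :: 'a form. part0 \<omega> \<in> invariants \<and> reduced (dot (grad (part0 \<omega>)) (N i))}"])
  have grad_0: "grad 0 = (0 :: 'a mpoly3 ^ 3)" by (simp add: grad_def tv_eq_iff)
  show "of_poly (fs i) \<notin> {\<omega> :: 'a form. part0 \<omega> \<in> invariants \<and> reduced (dot (grad (part0 \<omega>)) (N i))}"
    using not_reduced_f4 dot_J_N[of i i] by (simp add: of_poly_mk J_def)
  have "reduced (dot (grad f4) (N i))"
    using odd_f4 f4_invariant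
    by (intro reduced_even dot_N_invariant grad_invariant even_dot_odd_vec odd_vec_grad odd_N)
  then show "\<eta> \<in> {\<omega> :: 'a form. part0 \<omega> \<in> invariants \<and> reduced (dot (grad (part0 \<omega>)) (N i))}"
    if "\<eta> \<in> gens" "\<eta> \<noteq> of_poly (fs i)" for \<eta>
    using that f4_invariant dot_J_N
    by (auto simp: gens_def of_poly_mk fs_even_invariant reduced_0 grad_0 invariants_0_1 J_def split: if_splits)
  show "\<eta> \<^bold>\<and> \<eta>' \<in> {\<omega> :: 'a form. part0 \<omega> \<in> invariants \<and> reduced (dot (grad (part0 \<omega>)) (N i))}"
    if "\<eta> \<in> {\<omega> :: 'a form. part0 \<omega> \<in> invariants \<and> reduced (dot (grad (part0 \<omega>)) (N i))}"
      "\<eta>' \<in> {\<omega> :: 'a form. part0 \<omega> \<in> invariants \<and> reduced (dot (grad (part0 \<omega>)) (N i))}" for \<eta> \<eta>'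
    using that by (simp add: parts_wedge invariants_ring grad_mult dot_linear reduced_add reduced_mult const_term_dot_N)
qed (auto simp: of_poly_mk invariants_ring reduced_0 grad_add dot_linear reduced_add gens_def)

text \<open>Pairing with \<open>N i\<close> singles out \<open>J i\<close> among the gradients and
  gives even invariants on the \<open>kphi (N j)\<close>, which are odd like
  \<open>N i\<close>.\<close>

lemma irredundant_J: "generated_algebra (gens - {mk 0 (J i) 0 0}) \<noteq> invariant_forms"
proof (rule irredundantI[where
      T = "{\<omega> :: 'a form. part0 \<omega> \<in> invariants \<and> part1 \<omega> \<in> vec_invariants \<and> reduced (dot (part1 \<omega>) (N i))}"])
  show "mk 0 (J i) 0 0 \<notin> {\<omega> :: 'a form. part0 \<omega> \<in> invariants \<and> part1 \<omega> \<in> vec_invariants \<and> reduced (dot (part1 \<omega>) (N i))}"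
    using not_reduced_f4 by (simp add: dot_J_N)
  have "reduced (dot (kphi (N j)) (N i))" for j
    by (intro reduced_even dot_N_invariant kphi_N_invariant even_dot_odd_vec odd_vec_kphi odd_N)
  then show "\<eta> \<in> {\<omega> :: 'a form. part0 \<omega> \<in> invariants \<and> part1 \<omega> \<in> vec_invariants \<and> reduced (dot (part1 \<omega>) (N i))}"
    if "\<eta> \<in> gens" "\<eta> \<noteq> mk 0 (J i) 0 0" for \<eta>
    using that f4_invariant
    by (auto simp: gens_def of_poly_mk fs_even_invariant reduced_0 invariants_0_1 vec_invariants_closed
        J_invariant kphi_N_invariant dot_J_N)
  show "\<eta> \<^bold>\<and> \<eta>' \<in> {\<omega> :: 'a form. part0 \<omega> \<in> invariants \<and> part1 \<omega> \<in> vec_invariants \<and> reduced (dot (part1 \<omega>) (N i))}"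
    if "\<eta> \<in> {\<omega> :: 'a form. part0 \<omega> \<in> invariants \<and> part1 \<omega> \<in> vec_invariants \<and> reduced (dot (part1 \<omega>) (N i))}"
      "\<eta>' \<in> {\<omega> :: 'a form. part0 \<omega> \<in> invariants \<and> part1 \<omega> \<in> vec_invariants \<and> reduced (dot (part1 \<omega>) (N i))}" for \<eta> \<eta>'
    using that by (simp add: parts_wedge invariants_ring vec_invariants_closed dot_linear reduced_add reduced_mult
        const_term_dot_N)
qed (auto simp: of_poly_mk invariants_ring vec_invariants_closed reduced_0 dot_linear reduced_add gens_def)

text \<open>The same argument with the two families exchanged: \<open>bil\<close> with
  \<open>J i\<close> is even on all gradients and singles out \<open>kphi (N i)\<close>.\<close>

lemma irredundant_N: "generated_algebra (gens - {mk 0 (kphi (N i)) 0 0}) \<noteq> invariant_forms"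
proof (rule irredundantI[where
      T = "{\<omega> :: 'a form. part0 \<omega> \<in> invariants \<and> part1 \<omega> \<in> vec_invariants \<and> reduced (bil (part1 \<omega>) (J i))}"])
  have bil_0: "bil 0 u = 0" for u by (simp add: bil_def)
  show "mk 0 (kphi (N i)) 0 0 \<notin> {\<omega> :: 'a form. part0 \<omega> \<in> invariants \<and> part1 \<omega> \<in> vec_invariants \<and> reduced (bil (part1 \<omega>) (J i))}"
    using not_reduced_f4 by (simp add: bil_kphi dot_J_N)
  have "reduced (bil (J j) (J i))" for j
    by (intro reduced_even bil_invariant J_invariant even_bil even_J)
  then show "\<eta> \<in> {\<omega> :: 'a form. part0 \<omega> \<in> invariants \<and> part1 \<omega> \<in> vec_invariants \<and> reduced (bil (part1 \<omega>) (J i))}"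
    if "\<eta> \<in> gens" "\<eta> \<noteq> mk 0 (kphi (N i)) 0 0" for \<eta>
    using that f4_invariant
    by (auto simp: gens_def of_poly_mk fs_even_invariant reduced_0 invariants_0_1 vec_invariants_closed
        J_invariant kphi_N_invariant dot_J_N bil_kphi bil_0)
  show "\<eta> \<^bold>\<and> \<eta>' \<in> {\<omega> :: 'a form. part0 \<omega> \<in> invariants \<and> part1 \<omega> \<in> vec_invariants \<and> reduced (bil (part1 \<omega>) (J i))}"
    if "\<eta> \<in> {\<omega> :: 'a form. part0 \<omega> \<in> invariants \<and> part1 \<omega> \<in> vec_invariants \<and> reduced (bil (part1 \<omega>) (J i))}"
      "\<eta>' \<in> {\<omega> :: 'a form. part0 \<omega> \<in> invariants \<and> part1 \<omega> \<in> vec_invariants \<and> reduced (bil (part1 \<omega>) (J i))}" for \<eta> \<eta>'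
    using that by (simp add: parts_wedge invariants_ring vec_invariants_closed bil_linear reduced_add reduced_mult
        const_term_bil_J)
  show "of_poly (Const c) \<in> {\<omega> :: 'a form. part0 \<omega> \<in> invariants \<and> part1 \<omega> \<in> vec_invariants \<and> reduced (bil (part1 \<omega>) (J i))}"
    for c by (simp add: of_poly_mk invariants_ring vec_invariants_closed reduced_0 bil_0)
qed (auto simp: invariants_ring vec_invariants_closed bil_linear reduced_add gens_def)

text \<open>Here products of 1-forms contribute to the 2-form part as well. By the Binet-Cauchy
  identity their pairings with \<open>N i\<close> are built from products of two invariants that
  vanish at the origin, hence are reduced.\<close>

lemma irredundant_kinv_J: "generated_algebra (gens - {mk 0 0 (kinv (J i)) 0}) \<noteq> invariant_forms"
proof (rule irredundantI[where T = "{\<omega> :: 'a form. part0 \<omega> \<in> invariants \<and> part1 \<omega> \<in> vec_invariants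
      \<and> reduced (dot (kphi (part2 \<omega>)) (N i))}"])
  let ?T = "{\<omega> :: 'a form. part0 \<omega> \<in> invariants \<and> part1 \<omega> \<in> vec_invariants \<and> reduced (dot (kphi (part2 \<omega>)) (N i))}"
  show "mk 0 0 (kinv (J i)) 0 \<notin> ?T" using not_reduced_f4 by (simp add: dot_J_N)
  show "\<eta> \<in> ?T" if "\<eta> \<in> gens" "\<eta> \<noteq> mk 0 0 (kinv (J i)) 0" for \<eta>
    using that f4_invariant
    by (auto simp: gens_def of_poly_mk fs_even_invariant reduced_0 invariants_0_1 vec_invariants_closed
        J_invariant kphi_N_invariant dot_J_N kphi_linear)
  have cross: "reduced (dot (kphi (cross u v)) (N i))" if "u \<in> vec_invariants" "v \<in> vec_invariants" for u v
  proof -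
    obtain j k where N: "N i = cross (J j) (J k)" using N_cross by blast
    let ?x = "bil u (J j) * bil v (J k)" and ?y = "bil u (J k) * bil v (J j)"
    have "reduced ?x" "reduced ?y"
      using that by (auto intro!: reduced_prod bil_invariant J_invariant const_term_bil_J)
    moreover have "const_term ?x = 0" "const_term ?y = 0" by (simp_all add: const_term_hom const_term_bil_J)
    ultimately have "reduced (?x + - ?y)" by (intro reduced_add reduced_minus)
    from reduced_add[OF this this] have "reduced ((?x + - ?y) + (?x + - ?y))" .
    then show ?thesis unfolding N cross_cross_identity by (simp only: mult_2 diff_conv_add_uminus)
  qed
  show "\<eta> \<^bold>\<and> \<eta>' \<in> ?T" if "\<eta> \<in> ?T" "\<eta>' \<in> ?T" for \<eta> \<eta>'
    using that by (simp add: parts_wedge invariants_ring vec_invariants_closed kphi_linear dot_linear reduced_add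
        reduced_mult const_term_dot_N cross)
qed (auto simp: of_poly_mk invariants_ring vec_invariants_closed reduced_0 kphi_linear dot_linear reduced_add gens_def)

text \<open>Forms of lower degree produce 3-forms only by pairing 1-forms with 2-forms, and all
  1-forms among the generators vanish at the origin.\<close>

lemma irredundant_vol: "generated_algebra (gens - {mk 0 0 0 1}) \<noteq> invariant_forms"
proof (rule irredundantI[where T = "{\<omega> :: 'a form. (\<forall>k. const_term (part1 \<omega> $ k) = 0) \<and> const_term (part3 \<omega>) = 0}"])
  have "const_term (kphi (N i) $ k) = 0" for i k
    using exhaust_3[of k] by (auto simp: kphi_def const_term_hom const_term_N)
  then show "\<eta> \<in> {\<omega> :: 'a form. (\<forall>k. const_term (part1 \<omega> $ k) = 0) \<and> const_term (part3 \<omega>) = 0}"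
    if "\<eta> \<in> gens" "\<eta> \<noteq> mk 0 0 0 1" for \<eta>
    using that by (auto simp: gens_def of_poly_mk const_term_hom const_term_J)
qed (auto simp: of_poly_mk const_term_hom gens_def parts_wedge dot_def)

lemma minimal_generating_set_gens: "minimal_generating_set gens invariant_forms"
  unfolding minimal_generating_set_def
proof (intro conjI ballI equalityI subsetI)
  show "\<omega> \<in> invariant_forms" if "\<omega> \<in> generated_algebra gens" for \<omega>
    by (rule generated_algebra_subset[OF that]) (use invariant_forms_closed gens_invariant in auto)
  show "\<omega> \<in> generated_algebra gens" if "\<omega> \<in> invariant_forms" for \<omega>
    using that by (rule invariant_forms_generated)
  show "generated_algebra (gens - {\<omega>}) \<noteq> invariant_forms" if "\<omega> \<in> gens" for \<omega>
    using that irredundant_f4 irredundant_fs irredundant_J irredundant_N irredundant_kinv_J irredundant_vol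
    unfolding gens_def[THEN arg_cong, of "\<lambda>B. \<omega> \<in> B"] by blast
qed

end

theorem corollary1p6:
  assumes "odd CARD('a::{field,finite})"
  shows "minimal_generating_set
    {of_poly f1, of_poly f2, of_poly f3, of_poly f4,
     diff f1, diff f2, diff f3,
     phi (diff f2 \<^bold>\<and> diff f3), phi (diff f3 \<^bold>\<and> diff f1), phi (diff f1 \<^bold>\<and> diff f2),
     phi_inv (diff f1), phi_inv (diff f2), phi_inv (diff f3),
     dx 1 \<^bold>\<and> dx 2 \<^bold>\<and> dx 3}
    (invariant_forms :: 'a form set)"
proof -
  interpret odd_card "TYPE('a)" by unfold_locales (rule assms)
  show ?thesis unfolding gens_eq by (rule minimal_generating_set_gens)
qed

end
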